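(* Let $1<p<\infty$, $1/p+1/p'=1$, and let $\lambda=(\lambda_k)_{k\in\mathbb{Z}}$, $\beta=(\beta_k)_{k\in\mathbb{Z}}$ be sequences with nonzero components such that $\varphi_\lambda\in L_{p'}(\mathbb{T})$, $\varphi_\beta\in L_p(\mathbb{T})$, and $\beta_k=\beta_{-k}$, $\lambda_k=\lambda_{-k}$ for all $k\in\mathbb{Z}$. Assume that $\{\log(\beta_k/\lambda_k)/2^k:k\in\mathbb{N}\}$ and $\{\lambda_k:k\in\mathbb{N}\}$ are nondecreasing, positive sequences. Then there exists a positive constant $c$ such that for all $f\in\Phi_{\lambda,p}(\mathbb{T})$ and $m\in\mathbb{N}$ $$\|f-Q_m(f)\|_p\le c\,\|f\|_{\Phi_{\lambda,p}(\mathbb{T})}\sum_{k\in\mathbb{N}}\lambda_{mk}^{-1},$$ and consequently $$M_{2m+1}(U_{\lambda,p}(\mathbb{T}),\varphi_\beta)_p\le c\sum_{k\in\mathbb{N}}\lambda_{mk}^{-1}.$$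
   Context: $\mathbb{N}=\{1,2,\dots\}$; $\mathbb{T}=[0,2\pi]$ with endpoints identified. Functions are real-valued (in particular $\varphi_\lambda$ and $\varphi_\beta$). $\|f\|_p=(2\pi)^{-1/p}(\int_{\mathbb{T}}|f|^p)^{1/p}$; $(f_1*f_2)(x)=(2\pi)^{-1}\int_{\mathbb{T}}f_1(y)f_2(x-y)dy$. For a sequence $\lambda$ with nonzero components, $\varphi_\lambda=\sum_{k\in\mathbb{Z}}\lambda_k^{-1}e^{ik\cdot}$ in the distributional sense; similarly $\varphi_\beta=\sum_{k\in\mathbb{Z}}\beta_k^{-1}e^{ik\cdot}$. $\Phi_{\lambda,p}(\mathbb{T})=\{f=\varphi_\lambda*g: g\in L_p(\mathbb{T})\}$ with $\|f\|_{\Phi_{\lambda,p}(\mathbb{T})}=\|g\|_p$, and $U_{\lambda,p}(\mathbb{T})$ is its unit ball. Put $H_m(x)=\sum_{|k|\le m}\frac{\beta_k}{\lambda_k} e^{ikx}$, $\delta_m=2\pi/(2m+1)$, $V_m(g)=H_m*g$, and for $f=\varphi_\lambda*g$ with $g\in L_p(\mathbb{T})$, $$Q_m(f)=\frac1{2m+1}\sum_{l=0}^{2m}V_m(g)(\delta_m l)\,\varphi_\beta(\cdot-\delta_m l).$$ For $\mathbb{W}\subset L_p(\mathbb{T})$ and $\psi\in L_p(\mathbb{T})$, $M_n(\mathbb{W},\psi)_p=\sup_{f\in\mathbb{W}}\inf_{c_l\in\mathbb{R},\,y_l\in\mathbb{T}}\|f-\sum_{l=1}^n c_l\psi(\cdot-y_l)\|_p$.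 The right-hand sides may be $+\infty$, in which case the bounds are trivial. *)

theory Defs
  imports "HOL-Analysis.Analysis"
begin

text \<open>
  The torus is \<open>[0, 2\<pi>]\<close> with endpoints identified: functions on it are \<open>2\<pi>\<close>-periodic functions
  on the real line, integrated over \<open>{0..2\<pi>}\<close>.  Elements of \<open>L\<^sub>p\<close> are represented by Borel
  functions (every class modulo null sets contains one); identities between elements of \<open>L\<^sub>p\<close>
  are identities almost everywhere.
\<close>

definition Lp_torus :: "real \<Rightarrow> (real \<Rightarrow> real) set" where
  "Lp_torus p = {f. (\<forall>x. f (x + 2 * pi) = f x) \<and> f \<in> borel_measurable borel \<and>
     set_integrable lborel {0..2 * pi} (\<lambda>x. \<bar>f x\<bar> powr p)}"

text \<open>Meaningful for \<open>f \<in> Lp_torus p\<close>; a non-integrable integrand would give the value \<open>0\<close>.\<close>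

definition Lp_norm :: "real \<Rightarrow> (real \<Rightarrow> real) \<Rightarrow> real" where
  "Lp_norm p f = (2 * pi) powr (- 1 / p) * (LBINT x:{0..2 * pi}. \<bar>f x\<bar> powr p) powr (1 / p)"

definition torus_conv :: "(real \<Rightarrow> real) \<Rightarrow> (real \<Rightarrow> real) \<Rightarrow> real \<Rightarrow> real" where
  "torus_conv f g x = 1 / (2 * pi) * (LBINT y:{0..2 * pi}. f y * g (x - y))"

definition torus_test_function :: "(real \<Rightarrow> real) \<Rightarrow> bool" where
  "torus_test_function h \<longleftrightarrow> (\<forall>x. h (x + 2 * pi) = h x) \<and>
     (\<forall>n x. (deriv ^^ n) h field_differentiable at x)"

text \<open>
  \<open>\<phi> = \<Sum>\<^sub>k a\<^sub>k e\<^sup>i\<^sup>k\<^sup>x\<close> in the sense of distributions: the partial sums, paired with any test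
  function, converge to the pairing with \<open>\<phi>\<close>.
\<close>

definition distributional_fourier_series :: "(int \<Rightarrow> real) \<Rightarrow> (real \<Rightarrow> real) \<Rightarrow> bool" where
  "distributional_fourier_series a \<phi> \<longleftrightarrow> (\<forall>h. torus_test_function h \<longrightarrow>
     (\<lambda>n. LBINT x:{0..2 * pi}.
            (\<Sum>k = - int n..int n. of_real (a k) * cis (of_int k * x)) * of_real (h x))
       \<longlonglongrightarrow> complex_of_real (LBINT x:{0..2 * pi}. \<phi> x * h x))"

text \<open>\<open>\<phi>\<close> is the function \<open>\<phi>_lam\<close> of a sequence \<open>\<lambda>\<close>.\<close>

definition is_phi :: "(int \<Rightarrow> real) \<Rightarrow> (real \<Rightarrow> real) \<Rightarrow> bool" where
  "is_phi lam \<phi> \<longleftrightarrow> distributional_fourier_series (\<lambda>k. 1 / lam k) \<phi>"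

definition Phi_space :: "(real \<Rightarrow> real) \<Rightarrow> real \<Rightarrow> (real \<Rightarrow> real) set" where
  "Phi_space \<phi> p = {f \<in> Lp_torus p. \<exists>g \<in> Lp_torus p. AE x in lborel. f x = torus_conv \<phi> g x}"

text \<open>
  The \<open>g\<close> with \<open>f = \<phi> * g\<close>.  As all Fourier coefficients of \<open>\<phi> = \<phi>_lam\<close> are nonzero, \<open>g\<close> is
  determined by \<open>f\<close> up to a null set, and nothing below depends on the representative chosen.
\<close>

definition Phi_density :: "(real \<Rightarrow> real) \<Rightarrow> real \<Rightarrow> (real \<Rightarrow> real) \<Rightarrow> real \<Rightarrow> real" where
  "Phi_density \<phi> p f =
     (SOME g. g \<in> Lp_torus p \<and> (AE x in lborel. f x = torus_conv \<phi> g x))"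

definition Phi_norm :: "(real \<Rightarrow> real) \<Rightarrow> real \<Rightarrow> (real \<Rightarrow> real) \<Rightarrow> real" where
  "Phi_norm \<phi> p f = Lp_norm p (Phi_density \<phi> p f)"

definition Phi_ball :: "(real \<Rightarrow> real) \<Rightarrow> real \<Rightarrow> (real \<Rightarrow> real) set" where
  "Phi_ball \<phi> p = {f \<in> Phi_space \<phi> p. Phi_norm \<phi> p f \<le> 1}"

text \<open>For even sequences the exponential sum is real, so that \<open>Re\<close> only changes the type.\<close>

definition H_kernel :: "(int \<Rightarrow> real) \<Rightarrow> (int \<Rightarrow> real) \<Rightarrow> nat \<Rightarrow> real \<Rightarrow> real" where
  "H_kernel lam \<beta> m x =
     Re (\<Sum>k = - int m..int m. of_real (\<beta> k / lam k) * cis (of_int k * x))"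

lemma of_real_H_kernel:
  assumes "\<And>k. lam (- k) = lam k" "\<And>k. \<beta> (- k) = \<beta> k"
  shows "complex_of_real (H_kernel lam \<beta> m x) =
    (\<Sum>k = - int m..int m. of_real (\<beta> k / lam k) * cis (of_int k * x))" (is "_ = ?S")
proof -
  have real: "z \<in> \<real>" if "cnj z = z" for z
    using that by (simp add: Reals_cnj_iff)
  have "cnj ?S = (\<Sum>k = - int m..int m. of_real (\<beta> k / lam k) * cis (of_int (- k) * x))"
    by (simp add: cis_cnj)
  also have "\<dots> = ?S"
    by (rule sum.reindex_bij_witness[where i = uminus and j = uminus]) (auto simp: assms)
  finally have "?S \<in> \<real>"
    by (rule real)
  then show ?thesis
    unfolding H_kernel_def by (rule of_real_Re)
qed

definition V_op :: "(int \<Rightarrow> real) \<Rightarrow> (int \<Rightarrow> real) \<Rightarrow> nat \<Rightarrow> (real \<Rightarrow> real) \<Rightarrow> real \<Rightarrow> real" where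
  "V_op lam \<beta> m g = torus_conv (H_kernel lam \<beta> m) g"

definition mesh :: "nat \<Rightarrow> real" where
  "mesh m = 2 * pi / (2 * real m + 1)"

definition Q_op :: "(int \<Rightarrow> real) \<Rightarrow> (int \<Rightarrow> real) \<Rightarrow> (real \<Rightarrow> real) \<Rightarrow> (real \<Rightarrow> real) \<Rightarrow> real \<Rightarrow>
    nat \<Rightarrow> (real \<Rightarrow> real) \<Rightarrow> real \<Rightarrow> real" where
  "Q_op lam \<beta> \<phi>_lam \<phi>_\<beta> p m f x =
     1 / (2 * real m + 1) *
     (\<Sum>l = 0..2 * m. V_op lam \<beta> m (Phi_density \<phi>_lam p f) (mesh m * real l) *
        \<phi>_\<beta> (x - mesh m * real l))"

definition M_approx :: "nat \<Rightarrow> (real \<Rightarrow> real) set \<Rightarrow> (real \<Rightarrow> real) \<Rightarrow> real \<Rightarrow> ennreal" where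
  "M_approx n W \<psi> p =
     (SUP f\<in>W. INF c\<in>(UNIV :: (nat \<Rightarrow> real) set). INF y\<in>{1..n} \<rightarrow> {0..2 * pi}.
        ennreal (Lp_norm p (\<lambda>x. f x - (\<Sum>l = 1..n. c l * \<psi> (x - y l)))))"

end

theory Submission imports Defs "HOL-Complex_Analysis.Complex_Analysis" begin

text \<open>
  Sampling at \<open>2m + 1\<close> equidistant points reproduces every frequency \<open>|k| \<le> m\<close> exactly. Hence
  \<open>f - Q\<^sub>m f\<close> is the tail \<open>\<Sum>\<^sub>|\<^sub>k\<^sub>|\<^sub>>\<^sub>m \<lambda>\<^sub>k\<^sup>-\<^sup>1 c\<^sub>k(g) e\<^sup>i\<^sup>k\<^sup>x\<close> of \<open>f\<close> minus an aliasing error. The aliasing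
  error has size \<open>\<lambda>\<^sub>m\<^sup>-\<^sup>1 \<parallel>g\<parallel>\<^sub>1\<close>, since \<open>\<beta>\<^sub>k / \<lambda>\<^sub>k\<close> grows doubly exponentially. The tail is handled by
  Abel summation and the uniform \<open>L\<^sub>p\<close> bound for partial sums of Fourier series (M. Riesz).
  For \<open>p \<le> 2\<close> and \<open>u > 0\<close> that bound comes from the mean value property of \<open>F\<^sup>p\<close>, where \<open>F\<close> is the
  analytic polynomial with \<open>Re F\<close> equal to a Fejer mean of \<open>u\<close>; for \<open>p > 2\<close> it follows by duality.
\<close>

subsection \<open>The normalized measure on the torus\<close>

text \<open>Of the series on the right only the first term \<open>1 / \<lambda>\<^sub>m\<close> is
  used as a bound; the whole series decides between two cases. If it diverges, the right side is
  infinite unless \<open>g\<close> vanishes almost everywhere, and then so does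
  \<open>f - Q\<^sub>m f\<close>. If it converges, monotonicity makes all of
  \<open>1 / \<lambda>\<^sub>k\<close> summable, so that \<open>\<phi>_lam\<close> agrees almost
  everywhere with an absolutely convergent cosine series; for \<open>\<phi>_\<beta>\<close> the
  growth hypothesis always gives this. Both functions are known only through pairings with test
  functions, so the agreement rests on a uniqueness theorem for Fourier series. The tail is the
  delicate part: the triangle inequality frequency by frequency would produce the sum of
  \<open>1 / \<lambda>\<^sub>k\<close> over all \<open>k > m\<close>, which is only controlled by
  \<open>m\<close> times the series. Bounds for partial sums that do not depend on their length
  avoid this loss. Evenness of both sequences turns the exponential sums into cosine sums, so that
  all kernels are real.\<close>

definition torus :: "real measure" where
  "torus = density lborel (\<lambda>x. ennreal (indicator {0..2 * pi} x / (2 * pi)))"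

lemma sets_torus [simp, measurable_cong]: "sets torus = sets borel"
  and space_torus [simp]: "space torus = UNIV"
  by (simp_all add: torus_def)

lemma integral_torus:
  fixes f :: "real \<Rightarrow> 'a::{banach, second_countable_topology}"
  assumes "f \<in> borel_measurable borel"
  shows "integral\<^sup>L torus f = (LBINT x:{0..2 * pi}. f x) /\<^sub>R (2 * pi)"
proof -
  have "integral\<^sup>L torus f = (LBINT x. (1 / (2 * pi)) *\<^sub>R (indicat_real {0..2 * pi} x *\<^sub>R f x))"
    using assms unfolding torus_def by (subst integral_density) auto
  then show ?thesis
    by (simp only: integral_scaleR_right set_lebesgue_integral_def inverse_eq_divide)
qed

lemma integrable_torus_iff:
  fixes f :: "real \<Rightarrow> 'a::{banach, second_countable_topology}"
  assumes "f \<in> borel_measurable borel"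
  shows "integrable torus f \<longleftrightarrow> set_integrable lborel {0..2 * pi} f"
proof -
  have "integrable torus f \<longleftrightarrow> integrable lborel (\<lambda>x. (1 / (2 * pi)) *\<^sub>R (indicat_real {0..2 * pi} x *\<^sub>R f x))"
    using assms unfolding torus_def by (subst integrable_density) auto
  also have "\<dots> \<longleftrightarrow> set_integrable lborel {0..2 * pi} f"
    unfolding set_integrable_def
  proof
    assume "integrable lborel (\<lambda>x. (1 / (2 * pi)) *\<^sub>R (indicat_real {0..2 * pi} x *\<^sub>R f x))"
    then have "integrable lborel (\<lambda>x. (2 * pi) *\<^sub>R ((1 / (2 * pi)) *\<^sub>R (indicat_real {0..2 * pi} x *\<^sub>R f x)))"
      by (rule integrable_scaleR_right)
    then show "integrable lborel (\<lambda>x. indicat_real {0..2 * pi} x *\<^sub>R f x)" by simp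
  qed (rule integrable_scaleR_right)
  finally show ?thesis .
qed

lemma nn_integral_torus:
  assumes "f \<in> borel_measurable borel"
  shows "integral\<^sup>N torus f = (\<integral>\<^sup>+x\<in>{0..2 * pi}. f x \<partial>lborel) * ennreal (1 / (2 * pi))"
proof -
  have "integral\<^sup>N torus f = (\<integral>\<^sup>+x. (f x * indicator {0..2 * pi} x) * ennreal (1 / (2 * pi)) \<partial>lborel)"
    using assms unfolding torus_def
    by (subst nn_integral_density) (auto intro!: nn_integral_cong split: split_indicator simp: mult_ac)
  then show ?thesis
    using assms by (simp add: nn_integral_multc)
qed

lemma emeasure_torus_UNIV: "emeasure torus UNIV = 1"
proof -
  have "emeasure torus UNIV = (\<integral>\<^sup>+x\<in>{0..2 * pi}. 1 \<partial>lborel) * ennreal (1 / (2 * pi))"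
    by (subst nn_integral_torus [symmetric]) auto
  then show ?thesis
    by (simp flip: ennreal_mult')
qed

interpretation torus: finite_measure torus
  by standard (simp add: emeasure_torus_UNIV)

lemma measure_torus_UNIV [simp]: "measure torus UNIV = 1"
  by (simp add: measure_def emeasure_torus_UNIV)

lemma AE_lborel_imp_AE_torus:
  assumes "AE x in lborel. P x" shows "AE x in torus. P x"
  using assms unfolding torus_def by (subst AE_density) auto

lemma integrable_torus_bounded:
  fixes f :: "real \<Rightarrow> real"
  assumes "f \<in> borel_measurable borel" "\<And>x. \<bar>f x\<bar> \<le> B"
  shows "integrable torus f"
  using assms by (intro torus.integrable_const_bound[where B = B]) auto

lemma integrable_torus_bounded_mult:
  fixes f g :: "real \<Rightarrow> real"
  assumes "integrable torus f" "g \<in> borel_measurable borel" "\<And>x. \<bar>g x\<bar> \<le> B"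
  shows "integrable torus (\<lambda>x. g x * f x)"
proof (rule Bochner_Integration.integrable_bound)
  show "integrable torus (\<lambda>x. B * \<bar>f x\<bar>)" using assms(1) by simp
  show "(\<lambda>x. g x * f x) \<in> borel_measurable torus" using assms by measurable
  have "0 \<le> B" using assms(3)[of 0] by simp
  then show "AE x in torus. norm (g x * f x) \<le> norm (B * \<bar>f x\<bar>)"
    using assms(3) by (auto simp: abs_mult intro!: mult_right_mono)
qed

subsection \<open>Norms\<close>

lemma Lp_norm_torus:
  assumes "f \<in> borel_measurable borel"
  shows "Lp_norm p f = (LINT x|torus. \<bar>f x\<bar> powr p) powr (1 / p)"
proof -
  let ?I = "LBINT x:{0..2 * pi}. \<bar>f x\<bar> powr p"
  have I: "?I \<ge> 0" by (simp add: set_lebesgue_integral_def)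
  have "Lp_norm p f = (?I / (2 * pi)) powr (1 / p)"
    using I by (simp add: Lp_norm_def powr_divide powr_minus_divide)
  then show ?thesis
    using assms by (simp add: integral_torus field_simps)
qed

text \<open>This is \<open>Lp_torus\<close> without periodicity: positive parts, products with
  \<open>sin (a * x)\<close> for real \<open>a\<close> and the test function of the duality argument
  then qualify without a periodicity check.\<close>

definition Lp_fun :: "real \<Rightarrow> (real \<Rightarrow> real) \<Rightarrow> bool" where
  "Lp_fun p f \<longleftrightarrow> f \<in> borel_measurable borel \<and> integrable torus (\<lambda>x. \<bar>f x\<bar> powr p)"

lemma Lp_torus_Lp_fun: "f \<in> Lp_torus p \<Longrightarrow> Lp_fun p f"
  unfolding Lp_torus_def Lp_fun_def by (auto simp: integrable_torus_iff)

lemma Lp_funD [measurable_dest]: "Lp_fun p f \<Longrightarrow> f \<in> borel_measurable borel"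
  by (simp add: Lp_fun_def)

lemma Lp_fun_bounded:
  assumes "0 \<le> p" "f \<in> borel_measurable borel" "\<And>x. \<bar>f x\<bar> \<le> B"
  shows "Lp_fun p f"
  unfolding Lp_fun_def using assms
  by (auto intro!: integrable_torus_bounded[where B = "B powr p"] powr_mono2)

lemma Lp_fun_le:
  assumes "0 \<le> p" "Lp_fun p g" "f \<in> borel_measurable borel" "\<And>x. \<bar>f x\<bar> \<le> \<bar>g x\<bar>"
  shows "Lp_fun p f"
  unfolding Lp_fun_def
proof
  show "integrable torus (\<lambda>x. \<bar>f x\<bar> powr p)"
    by (rule Bochner_Integration.integrable_bound[where f = "\<lambda>x. \<bar>g x\<bar> powr p"])
      (use assms in \<open>auto simp: Lp_fun_def intro!: powr_mono2\<close>)
qed fact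

lemma Lp_norm_nonneg [simp]: "0 \<le> Lp_norm p f"
  by (simp add: Lp_norm_def)

lemma Lp_norm_powr:
  assumes "p > 0" "f \<in> borel_measurable borel"
  shows "Lp_norm p f powr p = (LINT x|torus. \<bar>f x\<bar> powr p)"
  using assms by (simp add: Lp_norm_torus powr_powr)

lemma Lp_norm_le_iff:
  assumes "p > 0" "f \<in> borel_measurable borel" "B \<ge> 0"
  shows "Lp_norm p f \<le> B \<longleftrightarrow> (LINT x|torus. \<bar>f x\<bar> powr p) \<le> B powr p"
proof -
  have "Lp_norm p f \<le> B \<longleftrightarrow> Lp_norm p f powr p \<le> B powr p"
    using assms powr_mono2[of p "Lp_norm p f" B] powr_less_mono2[of p B "Lp_norm p f"]
    by (cases "Lp_norm p f \<le> B") auto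
  then show ?thesis unfolding Lp_norm_powr[OF assms(1,2)] .
qed

lemma Lp_norm_mono:
  assumes "p > 0" "Lp_fun p g" "f \<in> borel_measurable borel" "\<And>x. \<bar>f x\<bar> \<le> \<bar>g x\<bar>"
  shows "Lp_norm p f \<le> Lp_norm p g"
proof -
  have "(LINT x|torus. \<bar>f x\<bar> powr p) \<le> (LINT x|torus. \<bar>g x\<bar> powr p)"
  proof (rule integral_mono)
    show "integrable torus (\<lambda>x. \<bar>f x\<bar> powr p)" "integrable torus (\<lambda>x. \<bar>g x\<bar> powr p)"
      using Lp_fun_le[of p g f] assms by (auto simp: Lp_fun_def)
    show "\<bar>f x\<bar> powr p \<le> \<bar>g x\<bar> powr p" for x
      using assms by (intro powr_mono2) auto
  qed
  then show ?thesis
    using assms(1,3) Lp_funD[OF assms(2)] by (simp add: Lp_norm_le_iff Lp_norm_powr)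
qed

lemma Lp_norm_bounded:
  assumes "p > 0" "f \<in> borel_measurable borel" "\<And>x. \<bar>f x\<bar> \<le> B"
  shows "Lp_norm p f \<le> B"
proof -
  have B: "B \<ge> 0" using assms(3)[of 0] by simp
  have "(LINT x|torus. \<bar>f x\<bar> powr p) \<le> (LINT x|torus. B powr p)"
  proof (rule integral_mono)
    show "integrable torus (\<lambda>x. \<bar>f x\<bar> powr p)"
      using Lp_fun_bounded[of p f B] assms by (simp add: Lp_fun_def)
    show "\<bar>f x\<bar> powr p \<le> B powr p" for x
      using assms by (intro powr_mono2) auto
  qed simp
  then show ?thesis
    using assms(1,2) B by (simp add: Lp_norm_le_iff)
qed

lemma Lp_norm_cong_AE:
  assumes "AE x in torus. f x = g x" "f \<in> borel_measurable borel" "g \<in> borel_measurable borel"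
  shows "Lp_norm p f = Lp_norm p g"
proof -
  have "(LINT x|torus. \<bar>f x\<bar> powr p) = (LINT x|torus. \<bar>g x\<bar> powr p)"
    by (rule integral_cong_AE) (use assms in auto)
  then show ?thesis using assms by (simp add: Lp_norm_torus)
qed

section \<open>Convexity of powers, the Minkowski and Hoelder inequalities\<close>

text \<open>The graph of \<open>t powr p\<close> lies above its tangent at \<open>s\<close>; this is
  Young's inequality with exponents \<open>p\<close> and \<open>p / (p - 1)\<close>. Being linear in
  \<open>t\<close> and in \<open>t powr p\<close>, it can be averaged over \<open>t\<close>, which
  yields both convexity and Jensen's inequality.\<close>

lemma powr_tangent:
  fixes p s t :: real
  assumes "1 < p" "0 \<le> s" "0 \<le> t"
  shows "p * (t * s powr (p - 1)) \<le> t powr p + (p - 1) * s powr p"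
proof -
  let ?q = "p / (p - 1)"
  have "t * s powr (p - 1) \<le> t powr p / p + (s powr (p - 1)) powr ?q / ?q"
    using assms by (intro Youngs_inequality) (auto simp: field_simps)
  also have "(s powr (p - 1)) powr ?q = s powr p"
    using assms by (simp add: powr_powr)
  finally have "p * (t * s powr (p - 1)) \<le> p * (t powr p / p + s powr p / ?q)"
    using assms by (intro mult_left_mono) auto
  also have "\<dots> = t powr p + (p - 1) * s powr p"
    using assms by (simp add: field_simps)
  finally show ?thesis .
qed

lemma powr_mult_self: "0 \<le> (s::real) \<Longrightarrow> s * s powr (p - 1) = s powr p"
  by (metis powr_mult_base diff_add_cancel add.commute)

text \<open>The tangent inequality at the mean \<open>a * x + b * y\<close>, averaged with weights
  \<open>a\<close> and \<open>b\<close>: the linear terms recombine to \<open>p\<close> times the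
  power of the mean.\<close>

lemma powr_convex:
  fixes p a b x y :: real
  assumes "1 < p" "0 \<le> x" "0 \<le> y" "0 \<le> a" "0 \<le> b" "a + b = 1"
  shows "(a * x + b * y) powr p \<le> a * x powr p + b * y powr p"
proof -
  let ?s = "a * x + b * y"
  have s: "0 \<le> ?s" using assms by simp
  have "a * (p * (x * ?s powr (p - 1))) + b * (p * (y * ?s powr (p - 1)))
      \<le> a * (x powr p + (p - 1) * ?s powr p) + b * (y powr p + (p - 1) * ?s powr p)"
    using assms s by (intro add_mono mult_left_mono powr_tangent) auto
  also have "\<dots> = a * x powr p + b * y powr p + (p - 1) * ?s powr p"
    using assms(6) by (simp add: algebra_simps flip: distrib_right)
  also have "a * (p * (x * ?s powr (p - 1))) + b * (p * (y * ?s powr (p - 1))) = p * (?s * ?s powr (p - 1))"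
    by (simp add: algebra_simps)
  also have "?s * ?s powr (p - 1) = ?s powr p"
    using s by (rule powr_mult_self)
  finally show ?thesis by (simp add: algebra_simps)
qed

lemma Lp_fun_add:
  assumes "1 < p" "Lp_fun p f" "Lp_fun p g"
  shows "Lp_fun p (\<lambda>x. f x + g x)"
  unfolding Lp_fun_def
proof
  have *: "\<bar>a + b\<bar> powr p \<le> 2 powr p * (1/2 * \<bar>a\<bar> powr p + 1/2 * \<bar>b\<bar> powr p)" for a b :: real
  proof -
    have "\<bar>a + b\<bar> powr p \<le> (2 * (1/2 * \<bar>a\<bar> + 1/2 * \<bar>b\<bar>)) powr p"
      using assms by (intro powr_mono2) auto
    also have "\<dots> \<le> 2 powr p * (1/2 * \<bar>a\<bar> powr p + 1/2 * \<bar>b\<bar> powr p)"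
      using assms powr_convex[of p "\<bar>a\<bar>" "\<bar>b\<bar>" "1/2" "1/2"] by (subst powr_mult) auto
    finally show ?thesis .
  qed
  note [measurable] = Lp_funD[OF assms(2)] Lp_funD[OF assms(3)]
  show "(\<lambda>x. f x + g x) \<in> borel_measurable borel" by measurable
  show "integrable torus (\<lambda>x. \<bar>f x + g x\<bar> powr p)"
  proof (rule Bochner_Integration.integrable_bound)
    show "integrable torus (\<lambda>x. 2 powr p * (1/2 * \<bar>f x\<bar> powr p + 1/2 * \<bar>g x\<bar> powr p))"
      using assms(2,3) by (simp add: Lp_fun_def)
    show "(\<lambda>x. \<bar>f x + g x\<bar> powr p) \<in> borel_measurable torus" by measurable
    have "\<bar>f x + g x\<bar> powr p \<le> \<bar>2 powr p * (1/2 * \<bar>f x\<bar> powr p + 1/2 * \<bar>g x\<bar> powr p)\<bar>" for x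
      by (rule order_trans[OF * abs_ge_self])
    then show "AE x in torus. norm (\<bar>f x + g x\<bar> powr p)
        \<le> norm (2 powr p * (1/2 * \<bar>f x\<bar> powr p + 1/2 * \<bar>g x\<bar> powr p))"
      by (intro AE_I2) simp
  qed
qed

lemma Lp_fun_cmult: "Lp_fun p f \<Longrightarrow> Lp_fun p (\<lambda>x. c * f x)"
  by (auto simp: Lp_fun_def abs_mult powr_mult)

lemma Lp_norm_cmult:
  assumes "p > 0" "Lp_fun p f"
  shows "Lp_norm p (\<lambda>x. c * f x) = \<bar>c\<bar> * Lp_norm p f"
  using assms by (simp add: Lp_norm_torus Lp_funD abs_mult powr_mult powr_powr)

lemma Lp_norm_eq_0_AE:
  assumes "p > 0" "Lp_fun p f" "Lp_norm p f = 0"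
  shows "AE x in torus. f x = 0"
proof -
  have "(LINT x|torus. \<bar>f x\<bar> powr p) = 0"
    using Lp_norm_powr[of p f] assms by (simp add: Lp_funD)
  then have "AE x in torus. \<bar>f x\<bar> powr p = 0"
    using assms by (subst (asm) integral_nonneg_eq_0_iff_AE) (auto simp: Lp_fun_def)
  then show ?thesis by simp
qed

lemma Lp_norm_AE_zero:
  assumes "p > 0" "f \<in> borel_measurable borel" "AE x in torus. f x = 0"
  shows "Lp_norm p f = 0"
  using Lp_norm_cong_AE[of f "\<lambda>_. 0" p] assms by (simp add: Lp_norm_torus)

text \<open>Convexity is applied to \<open>\<bar>f x\<bar>\<close> and
  \<open>\<bar>g x\<bar>\<close>, each divided by its norm, with weights proportional to the norms;
  each normalized power integrates to \<open>1\<close>. Vanishing norms are split off because of the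
  division.\<close>

theorem Lp_norm_triangle:
  assumes p: "1 < p" and f: "Lp_fun p f" and g: "Lp_fun p g"
  shows "Lp_norm p (\<lambda>x. f x + g x) \<le> Lp_norm p f + Lp_norm p g"
proof -
  let ?a = "Lp_norm p f" and ?b = "Lp_norm p g"
  note [measurable] = Lp_funD[OF f] Lp_funD[OF g]
  show ?thesis
  proof (cases "?a = 0 \<or> ?b = 0")
    case True
    then show ?thesis
    proof
      assume "?a = 0"
      then have "AE x in torus. f x = 0" using Lp_norm_eq_0_AE[OF _ f] p by simp
      then have "Lp_norm p (\<lambda>x. f x + g x) = Lp_norm p g" by (intro Lp_norm_cong_AE) auto
      then show ?thesis by simp
    next
      assume "?b = 0"
      then have "AE x in torus. g x = 0" using Lp_norm_eq_0_AE[OF _ g] p by simp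
      then have "Lp_norm p (\<lambda>x. f x + g x) = Lp_norm p f" by (intro Lp_norm_cong_AE) auto
      then show ?thesis by simp
    qed
  next
    case False
    then have a: "?a > 0" and b: "?b > 0" using Lp_norm_nonneg[of p f] Lp_norm_nonneg[of p g] by linarith+
    let ?s = "?a + ?b"
    have pw: "\<bar>f x + g x\<bar> powr p \<le> ?s powr p *
       (?a / ?s * (\<bar>f x\<bar> powr p / ?a powr p) + ?b / ?s * (\<bar>g x\<bar> powr p / ?b powr p))" for x
    proof -
      have "\<bar>f x + g x\<bar> powr p \<le> (?s * (?a / ?s * (\<bar>f x\<bar> / ?a) + ?b / ?s * (\<bar>g x\<bar> / ?b))) powr p"
      proof (rule powr_mono2)
        have "?s * (?a / ?s * (\<bar>f x\<bar> / ?a) + ?b / ?s * (\<bar>g x\<bar> / ?b)) = \<bar>f x\<bar> + \<bar>g x\<bar>"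
          using a b by (simp add: distrib_left)
        then show "\<bar>f x + g x\<bar> \<le> ?s * (?a / ?s * (\<bar>f x\<bar> / ?a) + ?b / ?s * (\<bar>g x\<bar> / ?b))"
          by simp
      qed (use p in auto)
      also have "\<dots> = ?s powr p * (?a / ?s * (\<bar>f x\<bar> / ?a) + ?b / ?s * (\<bar>g x\<bar> / ?b)) powr p"
        using a b by (intro powr_mult)
      also have "\<dots> \<le> ?s powr p * (?a / ?s * (\<bar>f x\<bar> / ?a) powr p + ?b / ?s * (\<bar>g x\<bar> / ?b) powr p)"
        using a b p by (intro mult_left_mono powr_convex) (auto simp flip: add_divide_distrib)
      finally show ?thesis using a b by (simp add: powr_divide)
    qed
    have "(LINT x|torus. \<bar>f x + g x\<bar> powr p) \<le> (LINT x|torus. ?s powr p *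
       (?a / ?s * (\<bar>f x\<bar> powr p / ?a powr p) + ?b / ?s * (\<bar>g x\<bar> powr p / ?b powr p)))"
      using Lp_fun_add[OF p f g] f g pw by (intro integral_mono) (auto simp: Lp_fun_def)
    also have "\<dots> = ?s powr p * (?a / ?s * ((LINT x|torus. \<bar>f x\<bar> powr p) / ?a powr p) +
                    ?b / ?s * ((LINT x|torus. \<bar>g x\<bar> powr p) / ?b powr p))"
      using f g by (simp add: Lp_fun_def)
    also have "\<dots> = ?s powr p * (?a / ?s + ?b / ?s)"
      using a b p by (simp flip: Lp_norm_powr)
    also have "\<dots> = ?s powr p"
      using a b by (simp flip: add_divide_distrib)
    finally show ?thesis
      using p a b by (subst Lp_norm_le_iff) auto
  qed
qed

lemma Lp_norm_diff_triangle:
  assumes p: "1 < p" and f: "Lp_fun p f" and g: "Lp_fun p g"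
  shows "Lp_norm p (\<lambda>x. f x - g x) \<le> Lp_norm p f + Lp_norm p g"
  using Lp_norm_triangle[OF p f Lp_fun_cmult[OF g, of "-1"]] Lp_norm_cmult[of p g "-1"] p g by simp

lemma Lp_fun_diff:
  assumes "1 < p" "Lp_fun p f" "Lp_fun p g" shows "Lp_fun p (\<lambda>x. f x - g x)"
  using Lp_fun_add[OF assms(1,2) Lp_fun_cmult[OF assms(3), of "-1"]] by simp

lemma Lp_fun_sum:
  assumes "1 < p" "finite I" "\<And>i. i \<in> I \<Longrightarrow> Lp_fun p (f i)"
  shows "Lp_fun p (\<lambda>x. \<Sum>i\<in>I. f i x)"
  using assms(2,3)
proof (induction I rule: finite_induct)
  case empty
  then show ?case using assms(1) Lp_fun_bounded[of p "\<lambda>_. 0" 0] by simp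
next
  case (insert i I)
  then show ?case using Lp_fun_add[OF assms(1), of "f i"] by simp
qed

lemma Lp_norm_sum:
  assumes "1 < p" "finite I" "\<And>i. i \<in> I \<Longrightarrow> Lp_fun p (f i)"
  shows "Lp_norm p (\<lambda>x. \<Sum>i\<in>I. f i x) \<le> (\<Sum>i\<in>I. Lp_norm p (f i))"
  using assms(2,3)
proof (induction I rule: finite_induct)
  case empty
  then show ?case using assms(1) Lp_norm_bounded[of p "\<lambda>_. 0" 0] by simp
next
  case (insert i I)
  have "Lp_norm p (\<lambda>x. f i x + (\<Sum>i\<in>I. f i x)) \<le> Lp_norm p (f i) + Lp_norm p (\<lambda>x. \<Sum>i\<in>I. f i x)"
    using insert assms(1) by (intro Lp_norm_triangle Lp_fun_sum) auto
  then show ?case using insert by simp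
qed

text \<open>Young's inequality for \<open>f\<close> and \<open>g\<close> divided by their norms,
  integrated. Without the normalization the same inequality gives integrability of the
  product.\<close>

theorem Hoelder:
  assumes p: "1 < p" and q: "1 < q" and pq: "1 / p + 1 / q = 1" and f: "Lp_fun p f" and g: "Lp_fun q g"
  shows "integrable torus (\<lambda>x. f x * g x)"
    and "\<bar>LINT x|torus. f x * g x\<bar> \<le> Lp_norm p f * Lp_norm q g"
proof -
  note [measurable] = Lp_funD[OF f] Lp_funD[OF g]
  let ?a = "Lp_norm p f" and ?b = "Lp_norm q g"
  have Y: "\<bar>u * v\<bar> \<le> \<bar>u\<bar> powr p / p + \<bar>v\<bar> powr q / q" for u v :: real
    using Youngs_inequality[OF p q pq, of "\<bar>u\<bar>" "\<bar>v\<bar>"] by (simp add: abs_mult)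
  show int: "integrable torus (\<lambda>x. f x * g x)"
    by (rule Bochner_Integration.integrable_bound[where f = "\<lambda>x. \<bar>f x\<bar> powr p / p + \<bar>g x\<bar> powr q / q"])
      (use f g p q Y in \<open>auto simp: Lp_fun_def\<close>)
  show "\<bar>LINT x|torus. f x * g x\<bar> \<le> ?a * ?b"
  proof (cases "?a = 0 \<or> ?b = 0")
    case True
    then have "AE x in torus. f x * g x = 0"
    proof
      assume "?a = 0"
      from Lp_norm_eq_0_AE[OF _ f this] p show ?thesis by auto
    next
      assume "?b = 0"
      from Lp_norm_eq_0_AE[OF _ g this] q show ?thesis by auto
    qed
    then have "(LINT x|torus. f x * g x) = 0" by (simp add: integral_eq_zero_AE)
    then show ?thesis by simp
  next
    case False
    then have a: "?a > 0" and b: "?b > 0" using Lp_norm_nonneg[of p f] Lp_norm_nonneg[of q g] by linarith+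
    have pw: "\<bar>f x * g x\<bar> \<le> ?a * ?b * (\<bar>f x\<bar> powr p / ?a powr p / p + \<bar>g x\<bar> powr q / ?b powr q / q)" for x
    proof -
      have "\<bar>f x * g x\<bar> = ?a * ?b * \<bar>f x / ?a * (g x / ?b)\<bar>" using a b by (simp add: abs_mult)
      also have "\<dots> \<le> ?a * ?b * (\<bar>f x / ?a\<bar> powr p / p + \<bar>g x / ?b\<bar> powr q / q)"
        using a b by (intro mult_left_mono Y) auto
      finally show ?thesis using a b by (simp add: powr_divide)
    qed
    have "\<bar>LINT x|torus. f x * g x\<bar> \<le> (LINT x|torus. \<bar>f x * g x\<bar>)"
      by (rule integral_abs_bound)
    also have "\<dots> \<le> (LINT x|torus. ?a * ?b * (\<bar>f x\<bar> powr p / ?a powr p / p + \<bar>g x\<bar> powr q / ?b powr q / q))"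
      using f g int pw by (intro integral_mono) (auto simp: Lp_fun_def)
    also have "\<dots> = ?a * ?b * ((LINT x|torus. \<bar>f x\<bar> powr p) / ?a powr p / p + (LINT x|torus. \<bar>g x\<bar> powr q) / ?b powr q / q)"
      using f g by (simp add: Lp_fun_def)
    also have "\<dots> = ?a * ?b * (1 / p + 1 / q)"
      using a b p q by (simp flip: Lp_norm_powr)
    finally show ?thesis by (simp add: pq)
  qed
qed

lemma conjugate_exponent:
  fixes p :: real
  assumes "1 < p"
  shows "1 < p / (p - 1)" "1 / p + 1 / (p / (p - 1)) = 1"
proof -
  show "1 < p / (p - 1)" using assms by simp
  have "1 / p + 1 / (p / (p - 1)) = (1 + (p - 1)) / p"
    by (simp only: divide_divide_eq_right add_divide_distrib mult_1)
  then show "1 / p + 1 / (p / (p - 1)) = 1" using assms by simp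
qed

lemma Lp_fun_integrable:
  assumes p: "1 < p" and f: "Lp_fun p f" shows "integrable torus f"
proof -
  have "Lp_fun (p / (p - 1)) (\<lambda>_. 1)"
    using p by (intro Lp_fun_bounded[where B = 1]) auto
  from Hoelder(1)[OF p conjugate_exponent[OF p] f this] show ?thesis by simp
qed

text \<open>Hoelder against the constant \<open>1\<close>, whose norm is at most \<open>1\<close>
  because the measure has total mass one.\<close>

lemma integral_abs_le_Lp_norm:
  assumes p: "1 < p" and f: "Lp_fun p f" shows "(LINT x|torus. \<bar>f x\<bar>) \<le> Lp_norm p f"
proof -
  have f': "Lp_fun p (\<lambda>x. \<bar>f x\<bar>)" using f by (auto simp: Lp_fun_def)
  have q: "Lp_fun (p / (p - 1)) (\<lambda>_. 1)" "Lp_norm (p / (p - 1)) (\<lambda>_. 1) \<le> 1"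
    using p by (auto intro!: Lp_fun_bounded[where B = 1] Lp_norm_bounded)
  have "(LINT x|torus. \<bar>f x\<bar>) \<le> \<bar>LINT x|torus. \<bar>f x\<bar> * 1\<bar>" by simp
  also have "\<dots> \<le> Lp_norm p (\<lambda>x. \<bar>f x\<bar>) * Lp_norm (p / (p - 1)) (\<lambda>_. 1)"
    by (rule Hoelder(2)[OF p conjugate_exponent[OF p] f' q(1)])
  also have "\<dots> \<le> Lp_norm p (\<lambda>x. \<bar>f x\<bar>)"
    by (rule mult_left_le[OF q(2) Lp_norm_nonneg])
  also have "\<dots> = Lp_norm p f" by (simp add: Lp_norm_def)
  finally show ?thesis .
qed

subsection \<open>Conjugate functions\<close>

text \<open>The mean value property, from Cauchy's formula at the centre. Continuity up to the
  circle suffices, which suits a power \<open>F\<^sup>p\<close> known to be defined on the closed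
  disc only.\<close>

lemma integral_torus_cis:
  fixes f :: "complex \<Rightarrow> complex"
  assumes cont: "continuous_on (cball 0 1) f" and hol: "f holomorphic_on ball 0 1"
  shows "integrable torus (\<lambda>x. f (cis x))" "(LINT x|torus. f (cis x)) = f 0"
proof -
  have c: "continuous_on UNIV (\<lambda>x. f (cis x))"
    by (rule continuous_on_compose2[OF cont]) (auto intro!: continuous_intros)
  have m: "(\<lambda>x. f (cis x)) \<in> borel_measurable borel"
    using c by (rule borel_measurable_continuous_onI)
  have si: "set_integrable lborel {0..2 * pi} (\<lambda>x. f (cis x))"
    using continuous_on_subset[OF c, of "{0..2 * pi}"] by (intro borel_integrable_atLeastAtMost') auto
  show "integrable torus (\<lambda>x. f (cis x))" using si m by (simp add: integrable_torus_iff)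
  have "((\<lambda>u. f u / (u - 0)) has_contour_integral (2 * of_real pi * \<i> * f 0)) (circlepath 0 1)"
    by (rule Cauchy_integral_circlepath[OF cont hol]) auto
  then have "((\<lambda>t. f (cis t) / cis t * \<i> * cis t) has_integral (2 * of_real pi * \<i> * f 0)) {0..2 * pi}"
    unfolding circlepath_def by (subst (asm) has_contour_integral_part_circlepath_iff) auto
  then have "((\<lambda>t. \<i> * f (cis t)) has_integral (\<i> * (2 * of_real pi * f 0))) {0..2 * pi}"
    by (rule has_integral_eq_rhs[OF has_integral_eq, rotated]) (auto simp: field_simps)
  from has_integral_mult_right[OF this, of "- \<i>"]
  have "((\<lambda>t. f (cis t)) has_integral (2 * of_real pi * f 0)) {0..2 * pi}"
    by (simp flip: mult.assoc)
  then have "(LBINT x:{0..2 * pi}. f (cis x)) = 2 * of_real pi * f 0"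
    using set_borel_integral_eq_integral(2)[OF si] by (simp add: integral_unique)
  then show "(LINT x|torus. f (cis x)) = f 0"
    using m by (simp add: integral_torus scaleR_conv_of_real)
qed

text \<open>
  M. Riesz's inequality: \<open>p\<theta>\<close> passes \<open>\<pi>/2\<close> before \<open>\<theta>\<close> does, so that close to the imaginary axis
  the term \<open>- B Re z\<^sup>p\<close> alone dominates \<open>|z|\<^sup>p\<close>.
\<close>

lemma abs_Im_powr_le:
  fixes p :: real
  assumes p: "1 < p" "p \<le> 2"
  obtains A B where "0 < A" "0 < B"
    "\<And>z. 0 < Re z \<Longrightarrow> \<bar>Im z\<bar> powr p \<le> A * Re z powr p - B * Re (exp (of_real p * Ln z))"
proof -
  \<comment> \<open>\<open>t\<close> is the midpoint of \<open>pi / (2 * p)\<close> and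
    \<open>pi / 2\<close>, so that \<open>p * t\<close> is already beyond \<open>pi / 2\<close>
    while \<open>cos t\<close> is still positive.\<close>
  define t where "t = pi * (p + 1) / (4 * p)"
  have "0 < pi * p" using p by simp
  then have t: "0 < t" "t < pi / 2" using p pi_gt_zero unfolding t_def
    by (simp_all add: field_simps add_pos_pos)
  have pt: "p * t = pi * (p + 1) / 4" using p by (simp add: t_def)
  have pt': "pi / 2 < p * t" "p * t < pi" using p pi_gt_zero unfolding pt
    by (auto simp: field_simps)
  define b where "b = - cos (p * t)"
  have b: "0 < b" using cos_monotone_0_pi[of "pi / 2" "p * t"] pt' by (simp add: b_def)
  \<comment> \<open>\<open>B\<close> makes \<open>- B * cos (p * \<theta>)\<close> at least
    \<open>1\<close> for angles beyond \<open>t\<close>; \<open>A\<close> makes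
    \<open>A * cos \<theta> powr p\<close> at least \<open>1 + B\<close> for angles up to
    \<open>t\<close>, which pays for the worst value of the other term.\<close>
  define B where "B = 1 / b"
  define A where "A = (1 + B) / cos t powr p"
  have ct: "0 < cos t" using t by (intro cos_gt_zero_pi) auto
  have B: "0 < B" using b by (simp add: B_def)
  have A: "0 < A" using B ct by (simp add: A_def)
  have angle: "\<bar>sin \<theta>\<bar> powr p \<le> A * cos \<theta> powr p - B * cos (p * \<theta>)" if \<theta>: "\<bar>\<theta>\<bar> < pi / 2" for \<theta>
  proof -
    have s1: "\<bar>sin \<theta>\<bar> powr p \<le> 1" using powr_mono2[of p "\<bar>sin \<theta>\<bar>" 1] p by simp
    have c: "0 < cos \<theta>" using \<theta> by (intro cos_gt_zero_pi) auto
    show ?thesis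
    proof (cases "\<bar>\<theta>\<bar> \<le> t")
      case True
      have "cos t \<le> cos \<bar>\<theta>\<bar>" using True t by (intro cos_monotone_0_pi_le) auto
      then have "cos t powr p \<le> cos \<theta> powr p" using ct p by (intro powr_mono2) (auto simp: cos_abs_real)
      then have "A * cos t powr p \<le> A * cos \<theta> powr p" using A by simp
      moreover have "A * cos t powr p = 1 + B" using ct by (simp add: A_def)
      moreover have "B * cos (p * \<theta>) \<le> B * 1" using B by (intro mult_left_mono) auto
      ultimately show ?thesis using s1 by simp
    next
      case False
      \<comment> \<open>Here \<open>p \<le> 2\<close> enters:
        \<open>p * \<bar>\<theta>\<bar>\<close> stays in the range where the cosine
        decreases.\<close>
      have "p * \<bar>\<theta>\<bar> \<le> pi"
        using mult_mono[of p 2 "\<bar>\<theta>\<bar>" "pi / 2"] p \<theta> by simp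
      moreover have "p * t \<le> p * \<bar>\<theta>\<bar>" using False p by simp
      moreover have "0 \<le> p * t" using pt' pi_gt_zero by linarith
      ultimately have "cos (p * \<bar>\<theta>\<bar>) \<le> cos (p * t)" by (intro cos_monotone_0_pi_le) auto
      moreover have "cos (p * \<bar>\<theta>\<bar>) = cos (p * \<theta>)" by (simp add: abs_if)
      ultimately have "cos (p * \<theta>) \<le> - b" by (simp add: b_def)
      then have "B * cos (p * \<theta>) \<le> B * (- b)" using B by (intro mult_left_mono) auto
      also have "\<dots> = - 1" using b by (simp add: B_def)
      finally show ?thesis using s1 A c by (smt (verit) mult_nonneg_nonneg powr_ge_zero)
    qed
  qed
  have "\<bar>Im z\<bar> powr p \<le> A * Re z powr p - B * Re (exp (of_real p * Ln z))" if z: "0 < Re z" for z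
  proof -
    have z0: "z \<noteq> 0" using z by auto
    define r where "r = exp (Re (Ln z))"
    define \<theta> where "\<theta> = Im (Ln z)"
    have r: "0 < r" by (simp add: r_def)
    have "z = exp (Ln z)" using z0 by simp
    then have zz: "Re z = r * cos \<theta>" "Im z = r * sin \<theta>"
      unfolding r_def \<theta>_def by (metis Re_exp, metis Im_exp)
    have th: "\<bar>\<theta>\<bar> < pi / 2" unfolding \<theta>_def using z Re_Ln_pos_lt[OF z0] by blast
    then have c: "0 < cos \<theta>" by (intro cos_gt_zero_pi) auto
    have e: "Re (exp (of_real p * Ln z)) = r powr p * cos (p * \<theta>)"
      by (simp add: Re_exp r_def \<theta>_def powr_def)
    have "\<bar>Im z\<bar> powr p = r powr p * \<bar>sin \<theta>\<bar> powr p"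
      using r by (simp add: zz abs_mult powr_mult)
    also have "\<dots> \<le> r powr p * (A * cos \<theta> powr p - B * cos (p * \<theta>))"
      using angle[OF th] by (intro mult_left_mono) auto
    also have "\<dots> = A * Re z powr p - B * Re (exp (of_real p * Ln z))"
      using r c by (simp add: zz e powr_mult algebra_simps)
    finally show ?thesis .
  qed
  with A B show thesis by (rule that)
qed

theorem conjugate_function_bound:
  fixes p :: real
  assumes p: "1 < p" "p \<le> 2"
  obtains A where "0 < A"
    "\<And>F \<epsilon>. F holomorphic_on UNIV \<Longrightarrow> 0 < \<epsilon> \<Longrightarrow> (\<And>x. \<epsilon> \<le> Re (F (cis x))) \<Longrightarrow> Im (F 0) = 0 \<Longrightarrow>
      (LINT x|torus. \<bar>Im (F (cis x))\<bar> powr p) \<le> A * (LINT x|torus. Re (F (cis x)) powr p)"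
proof -
  obtain A B where A: "0 < A" and B: "0 < B" and
    ineq: "\<And>z. 0 < Re z \<Longrightarrow> \<bar>Im z\<bar> powr p \<le> A * Re z powr p - B * Re (exp (of_real p * Ln z))"
    using abs_Im_powr_le[OF p] by metis
  have "(LINT x|torus. \<bar>Im (F (cis x))\<bar> powr p) \<le> A * (LINT x|torus. Re (F (cis x)) powr p)"
    if hol: "F holomorphic_on UNIV" and \<epsilon>: "0 < \<epsilon>" and pos: "\<And>x. \<epsilon> \<le> Re (F (cis x))" and Im0: "Im (F 0) = 0"
    for F \<epsilon>
  proof -
    have cF: "continuous_on S F" for S
      using holomorphic_on_imp_continuous_on[OF hol] continuous_on_subset by blast
    \<comment> \<open>The maximum principle for \<open>- F\<close> carries the lower bound from the
      circle into the disc. This keeps \<open>F\<close> off the branch cut of \<open>Ln\<close>, so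
      that the power is holomorphic.\<close>
    have Re_pos: "0 < Re (F z)" if z: "z \<in> cball 0 1" for z
    proof -
      have "Re (- F z) \<le> - \<epsilon>"
      proof (rule maximum_real_frontier[where S = "cball 0 1" and f = "\<lambda>z. - F z"])
        show "(\<lambda>z. - F z) holomorphic_on interior (cball 0 1)"
          using holomorphic_on_subset[OF hol] by (intro holomorphic_intros) auto
        show "continuous_on (closure (cball 0 1)) (\<lambda>z. - F z)"
          by (intro continuous_intros cF)
        show "Re (- F w) \<le> - \<epsilon>" if "w \<in> frontier (cball 0 1)" for w
        proof -
          have "w = cis (Arg w)" using that cis_Arg_unique[of w] rcis_cmod_Arg[of w]
            by (simp add: rcis_def)
          then show ?thesis using pos[of "Arg w"] by simp
        qed
      qed (use z in auto)
      then show ?thesis using \<epsilon> by simp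
    qed
    define G where "G = (\<lambda>z. exp (of_real p * Ln (F z)))"
    have nonneg_ne: "F z \<notin> \<real>\<^sub>\<le>\<^sub>0" if "z \<in> cball 0 1" for z
      using Re_pos[OF that] by (auto simp: complex_nonpos_Reals_iff)
    have contG: "continuous_on (cball 0 1) G"
      unfolding G_def by (intro continuous_intros cF) (use nonneg_ne in auto)
    have holG: "G holomorphic_on ball 0 1"
      unfolding G_def using holomorphic_on_subset[OF hol]
      by (intro holomorphic_intros) (use nonneg_ne in auto)
    note G = integral_torus_cis[OF contG holG]
    have cont: "continuous_on UNIV (\<lambda>x. F (cis x))"
      by (rule continuous_on_compose2[OF cF]) (auto intro!: continuous_intros)
    have cont_int: "integrable torus h" if "continuous_on UNIV h" for h :: "real \<Rightarrow> real"
      using that borel_measurable_continuous_onI[OF that]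
      by (auto simp: integrable_torus_iff intro!: borel_integrable_atLeastAtMost' intro: continuous_on_subset)
    have Rpos: "0 < Re (F (cis x))" for x using Re_pos[of "cis x"] by simp
    have I1: "integrable torus (\<lambda>x. \<bar>Im (F (cis x))\<bar> powr p)"
      using p by (intro cont_int continuous_on_powr' continuous_intros cont) auto
    have I2: "integrable torus (\<lambda>x. Re (F (cis x)) powr p)"
      by (intro cont_int continuous_on_powr continuous_intros cont) (use Rpos in \<open>auto simp: less_imp_neq[symmetric]\<close>)
    have I3: "integrable torus (\<lambda>x. Re (G (cis x)))"
      using G(1) by (rule integrable_Re)
    have "(LINT x|torus. \<bar>Im (F (cis x))\<bar> powr p)
        \<le> (LINT x|torus. A * Re (F (cis x)) powr p - B * Re (G (cis x)))"
      using ineq[OF Rpos] I1 I2 I3 by (intro integral_mono) (auto simp: G_def)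
    also have "\<dots> = A * (LINT x|torus. Re (F (cis x)) powr p) - B * Re (G 0)"
      using I2 I3 G by (simp add: integral_Re[symmetric])
    also have "Re (G 0) \<ge> 0"
    proof -
      have "F 0 = of_real (Re (F 0))" using Im0 by (simp add: complex_eq_iff)
      moreover have "0 < Re (F 0)" by (rule Re_pos) simp
      ultimately have "Ln (F 0) = of_real (ln (Re (F 0)))" by (metis Ln_of_real)
      then show ?thesis by (simp add: G_def Re_exp)
    qed
    then have "A * (LINT x|torus. Re (F (cis x)) powr p) - B * Re (G 0) \<le> A * (LINT x|torus. Re (F (cis x)) powr p)"
      using B by simp
    finally show ?thesis .
  qed
  with A show thesis by (rule that)
qed

subsection \<open>Convolution with trigonometric kernels\<close>

text \<open>Unlike in \<open>torus_conv\<close>, the shift sits in the kernel, so that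
  \<open>g\<close> enters only through its values on one period and may be multiplied by nonperiodic
  factors. For periodic functions a reflection identifies the two convolutions.\<close>

definition kconv :: "(real \<Rightarrow> real) \<Rightarrow> (real \<Rightarrow> real) \<Rightarrow> real \<Rightarrow> real" where
  "kconv k g x = (LINT y|torus. k (x - y) * g y)"

definition bounded_kernel :: "(real \<Rightarrow> real) \<Rightarrow> bool" where
  "bounded_kernel k \<longleftrightarrow> k \<in> borel_measurable borel \<and> (\<exists>B. \<forall>t. \<bar>k t\<bar> \<le> B)"

lemma bounded_kernelI: "k \<in> borel_measurable borel \<Longrightarrow> (\<And>t. \<bar>k t\<bar> \<le> B) \<Longrightarrow> bounded_kernel k"
  by (auto simp: bounded_kernel_def)

lemma bounded_kernel_measurable [measurable_dest]: "bounded_kernel k \<Longrightarrow> k \<in> borel_measurable borel"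
  by (simp add: bounded_kernel_def)

lemma bounded_kernel_const: "bounded_kernel (\<lambda>t. c)"
  and bounded_kernel_cos: "bounded_kernel (\<lambda>t. cos (a * t))"
  and bounded_kernel_sin: "bounded_kernel (\<lambda>t. sin (a * t))"
  by (rule bounded_kernelI[where B = "\<bar>c\<bar>"] bounded_kernelI[where B = 1]; simp)+

lemma bounded_kernel_add:
  assumes "bounded_kernel k" "bounded_kernel l"
  shows "bounded_kernel (\<lambda>t. k t + l t)"
proof -
  obtain B C where "\<And>t. \<bar>k t\<bar> \<le> B" "\<And>t. \<bar>l t\<bar> \<le> C"
    using assms by (auto simp: bounded_kernel_def)
  then have "\<bar>k t + l t\<bar> \<le> B + C" for t
    by (intro order_trans[OF abs_triangle_ineq] add_mono)
  then show ?thesis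
    by (rule bounded_kernelI[rotated]) (use assms in measurable)
qed

lemma bounded_kernel_mult:
  assumes "bounded_kernel k" "bounded_kernel l"
  shows "bounded_kernel (\<lambda>t. k t * l t)"
proof -
  obtain B C where BC: "\<And>t. \<bar>k t\<bar> \<le> B" "\<And>t. \<bar>l t\<bar> \<le> C"
    using assms by (auto simp: bounded_kernel_def)
  have "0 \<le> B" using BC(1)[of 0] by simp
  then have "\<bar>k t * l t\<bar> \<le> B * C" for t
    unfolding abs_mult using BC by (intro mult_mono) auto
  then show ?thesis
    by (rule bounded_kernelI[rotated]) (use assms in measurable)
qed

lemma bounded_kernel_sum:
  "(\<And>i. i \<in> I \<Longrightarrow> bounded_kernel (k i)) \<Longrightarrow> bounded_kernel (\<lambda>t. \<Sum>i\<in>I. k i t)"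
  by (induction I rule: infinite_finite_induct) (simp_all add: bounded_kernel_const bounded_kernel_add)

lemma bounded_kernel_cmult: "bounded_kernel k \<Longrightarrow> bounded_kernel (\<lambda>t. c * k t)"
  by (intro bounded_kernel_mult bounded_kernel_const)

lemmas bounded_kernel_intros = bounded_kernel_const bounded_kernel_cos bounded_kernel_sin
  bounded_kernel_add bounded_kernel_sum bounded_kernel_cmult

lemma integrable_kconv:
  assumes "bounded_kernel k" "integrable torus g"
  shows "integrable torus (\<lambda>y. k (x - y) * g y)"
proof -
  obtain B where B: "\<And>t. \<bar>k t\<bar> \<le> B" using assms(1) by (auto simp: bounded_kernel_def)
  note [measurable] = bounded_kernel_measurable[OF assms(1)]
  show ?thesis
    by (rule integrable_torus_bounded_mult[OF assms(2) _ B]) measurable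
qed

lemma kconv_measurable [measurable]:
  assumes "bounded_kernel k" "integrable torus g"
  shows "kconv k g \<in> borel_measurable borel"
proof -
  note [measurable] = bounded_kernel_measurable[OF assms(1)] borel_measurable_integrable[OF assms(2)]
  show ?thesis unfolding kconv_def by measurable
qed

lemma kconv_abs_le:
  assumes k: "\<And>t. \<bar>k t\<bar> \<le> B" and g: "integrable torus g"
  shows "\<bar>kconv k g x\<bar> \<le> B * (LINT y|torus. \<bar>g y\<bar>)"
proof (cases "integrable torus (\<lambda>y. k (x - y) * g y)")
  case True
  have "\<bar>kconv k g x\<bar> \<le> (LINT y|torus. \<bar>k (x - y) * g y\<bar>)"
    unfolding kconv_def by (rule integral_abs_bound)
  also have "\<dots> \<le> (LINT y|torus. B * \<bar>g y\<bar>)"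
    using integrable_abs[OF True] g k by (intro integral_mono) (auto simp: abs_mult intro!: mult_right_mono)
  finally show ?thesis by simp
next
  \<comment> \<open>The integral then has the default value \<open>0\<close>, and the bound holds
    trivially.\<close>
  case False
  have "0 \<le> B" using k[of 0] by simp
  then show ?thesis using False by (simp add: kconv_def not_integrable_integral_eq)
qed

lemma Lp_fun_kconv:
  assumes "0 \<le> p" "bounded_kernel k" "integrable torus g"
  shows "Lp_fun p (kconv k g)"
proof -
  obtain B where "\<And>t. \<bar>k t\<bar> \<le> B" using assms(2) by (auto simp: bounded_kernel_def)
  from kconv_abs_le[OF this assms(3)] assms show ?thesis
    by (intro Lp_fun_bounded) (auto intro: kconv_measurable)
qed

lemma kconv_add:
  assumes "bounded_kernel k" "bounded_kernel l" "integrable torus g"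
  shows "kconv (\<lambda>t. k t + l t) g x = kconv k g x + kconv l g x"
  using integrable_kconv[OF assms(1,3)] integrable_kconv[OF assms(2,3)]
  by (simp add: kconv_def distrib_right)

lemma kconv_cmult: "kconv (\<lambda>t. c * k t) g x = c * kconv k g x"
  by (simp add: kconv_def mult.assoc)

lemma kconv_sum:
  assumes "\<And>i. i \<in> I \<Longrightarrow> bounded_kernel (k i)" "integrable torus g"
  shows "kconv (\<lambda>t. \<Sum>i\<in>I. k i t) g x = (\<Sum>i\<in>I. kconv (k i) g x)"
  using integrable_kconv[OF assms(1) assms(2)]
  by (simp add: kconv_def sum_distrib_right)

lemma kconv_diff_right:
  assumes "bounded_kernel k" "integrable torus g" "integrable torus h"
  shows "kconv k (\<lambda>y. g y - h y) x = kconv k g x - kconv k h x"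
  using integrable_kconv[OF assms(1,2)] integrable_kconv[OF assms(1,3)]
  by (simp add: kconv_def right_diff_distrib)

section \<open>Fourier coefficients, Dirichlet and Fejer kernels\<close>

definition fourier_cos :: "real \<Rightarrow> (real \<Rightarrow> real) \<Rightarrow> real" where
  "fourier_cos a g = (LINT y|torus. cos (a * y) * g y)"

definition fourier_sin :: "real \<Rightarrow> (real \<Rightarrow> real) \<Rightarrow> real" where
  "fourier_sin a g = (LINT y|torus. sin (a * y) * g y)"

lemma integrable_cos_sin_mult:
  assumes "integrable torus g"
  shows "integrable torus (\<lambda>y. cos (a * y) * g y)" "integrable torus (\<lambda>y. sin (a * y) * g y)"
  by (rule integrable_torus_bounded_mult[OF assms, where B = 1]; simp)+

lemma kconv_cos:
  assumes "integrable torus g"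
  shows "kconv (\<lambda>t. cos (a * t)) g x = cos (a * x) * fourier_cos a g + sin (a * x) * fourier_sin a g"
proof -
  have "kconv (\<lambda>t. cos (a * t)) g x =
      (LINT y|torus. cos (a * x) * (cos (a * y) * g y) + sin (a * x) * (sin (a * y) * g y))"
    unfolding kconv_def by (simp add: right_diff_distrib cos_diff algebra_simps)
  then show ?thesis
    using integrable_cos_sin_mult[OF assms, of "a"] by (simp add: fourier_cos_def fourier_sin_def)
qed

lemma kconv_sin:
  assumes "integrable torus g"
  shows "kconv (\<lambda>t. sin (a * t)) g x = sin (a * x) * fourier_cos a g - cos (a * x) * fourier_sin a g"
proof -
  have "kconv (\<lambda>t. sin (a * t)) g x =
      (LINT y|torus. sin (a * x) * (cos (a * y) * g y) - cos (a * x) * (sin (a * y) * g y))"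
    unfolding kconv_def by (simp add: right_diff_distrib sin_diff algebra_simps)
  then show ?thesis
    using integrable_cos_sin_mult[OF assms, of "a"] by (simp add: fourier_cos_def fourier_sin_def)
qed

lemma integral_cos_sin:
  assumes "1 \<le> k"
  shows "(LINT x|torus. cos (real k * x)) = 0" "(LINT x|torus. sin (real k * x)) = 0"
proof -
  have "continuous_on (cball 0 1) (\<lambda>z::complex. z ^ k)" "(\<lambda>z::complex. z ^ k) holomorphic_on ball 0 1"
    by (auto intro!: continuous_intros holomorphic_intros)
  note z = integral_torus_cis[OF this]
  have "integrable torus (\<lambda>x. cis (real k * x))" "(LINT x|torus. cis (real k * x)) = 0"
    using z assms by (simp_all add: Complex.DeMoivre)
  then show "(LINT x|torus. cos (real k * x)) = 0" "(LINT x|torus. sin (real k * x)) = 0"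
    using integral_Re[of torus "\<lambda>x. cis (real k * x)"] integral_Im[of torus "\<lambda>x. cis (real k * x)"] by simp_all
qed

lemma integrable_cos_sin: "integrable torus (\<lambda>x. cos (a * x))" "integrable torus (\<lambda>x. sin (a * x))"
  by (auto intro!: integrable_torus_bounded[where B = 1])

definition dirichlet :: "nat \<Rightarrow> real \<Rightarrow> real" where
  "dirichlet N t = 1 + 2 * (\<Sum>k = 1..N. cos (real k * t))"

text \<open>The multiplier \<open>- \<i> * sgn k\<close> cut off at \<open>N\<close>: convolution
  with it gives the harmonic conjugate of the partial sum.\<close>

definition conj_dirichlet :: "nat \<Rightarrow> real \<Rightarrow> real" where
  "conj_dirichlet N t = 2 * (\<Sum>k = 1..N. sin (real k * t))"

definition fejer :: "nat \<Rightarrow> real \<Rightarrow> real" where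
  "fejer n t = 1 / real n * (\<Sum>j<n. dirichlet j t)"

definition conj_fejer :: "nat \<Rightarrow> real \<Rightarrow> real" where
  "conj_fejer n t = 1 / real n * (\<Sum>j<n. conj_dirichlet j t)"

lemma bounded_kernel_dirichlet: "bounded_kernel (dirichlet N)"
  and bounded_kernel_conj_dirichlet: "bounded_kernel (conj_dirichlet N)"
  unfolding dirichlet_def conj_dirichlet_def by (intro bounded_kernel_intros)+

lemma bounded_kernel_fejer: "bounded_kernel (fejer n)"
  and bounded_kernel_conj_fejer: "bounded_kernel (conj_fejer n)"
  unfolding fejer_def conj_fejer_def
  by (intro bounded_kernel_intros bounded_kernel_dirichlet bounded_kernel_conj_dirichlet)+

lemma kconv_dirichlet:
  assumes "integrable torus g"
  shows "kconv (dirichlet N) g x =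
    (LINT y|torus. g y) + 2 * (\<Sum>k = 1..N. kconv (\<lambda>t. cos (real k * t)) g x)"
proof -
  have "kconv (dirichlet N) g x = kconv (\<lambda>t. 1) g x + kconv (\<lambda>t. 2 * (\<Sum>k = 1..N. cos (real k * t))) g x"
    unfolding dirichlet_def using assms by (intro kconv_add bounded_kernel_intros)
  also have "kconv (\<lambda>t. 2 * (\<Sum>k = 1..N. cos (real k * t))) g x = 2 * (\<Sum>k = 1..N. kconv (\<lambda>t. cos (real k * t)) g x)"
    unfolding kconv_cmult using assms by (subst kconv_sum) (auto intro!: bounded_kernel_intros)
  finally show ?thesis by (simp add: kconv_def)
qed

lemma kconv_conj_dirichlet:
  assumes "integrable torus g"
  shows "kconv (conj_dirichlet N) g x = 2 * (\<Sum>k = 1..N. kconv (\<lambda>t. sin (real k * t)) g x)"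
  unfolding conj_dirichlet_def kconv_cmult using assms
  by (subst kconv_sum) (auto intro!: bounded_kernel_intros)

lemma kconv_fejer:
  assumes "integrable torus g"
  shows "kconv (fejer n) g x = 1 / real n * (\<Sum>j<n. kconv (dirichlet j) g x)"
  unfolding fejer_def kconv_cmult using assms
  by (subst kconv_sum) (auto intro!: bounded_kernel_dirichlet)

lemma kconv_conj_fejer:
  assumes "integrable torus g"
  shows "kconv (conj_fejer n) g x = 1 / real n * (\<Sum>j<n. kconv (conj_dirichlet j) g x)"
  unfolding conj_fejer_def kconv_cmult using assms
  by (subst kconv_sum) (auto intro!: bounded_kernel_conj_dirichlet)

text \<open>The convolution is a finite trigonometric sum, so the double integral is computed
  termwise and every frequency except \<open>0\<close> drops out. This takes the place of
  Fubini.\<close>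

lemma integral_kconv_dirichlet:
  assumes g: "integrable torus g"
  shows "(LINT x|torus. kconv (dirichlet N) g x) = (LINT x|torus. g x)"
    and "integrable torus (kconv (dirichlet N) g)"
proof -
  have i: "integrable torus (\<lambda>x. kconv (\<lambda>t. cos (real k * t)) g x)" for k
    unfolding kconv_cos[OF g] using integrable_cos_sin by simp
  have z: "(LINT x|torus. kconv (\<lambda>t. cos (real k * t)) g x) = 0" if "1 \<le> k" for k
    unfolding kconv_cos[OF g] using integrable_cos_sin integral_cos_sin[OF that] by simp
  have "(LINT x|torus. (\<Sum>k = 1..N. kconv (\<lambda>t. cos (real k * t)) g x)) = 0"
    using i z by simp
  then show "(LINT x|torus. kconv (dirichlet N) g x) = (LINT x|torus. g x)"
    unfolding kconv_dirichlet[OF g] using i by simp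
  show "integrable torus (kconv (dirichlet N) g)"
    unfolding kconv_dirichlet[OF g, abs_def] using i by simp
qed

lemma integral_kconv_fejer:
  assumes g: "integrable torus g" and n: "1 \<le> n"
  shows "(LINT x|torus. kconv (fejer n) g x) = (LINT x|torus. g x)"
    and "integrable torus (kconv (fejer n) g)"
  using integral_kconv_dirichlet[OF g] n by (simp_all add: kconv_fejer[OF g, abs_def])

lemma kconv_fejer_1: "1 \<le> n \<Longrightarrow> kconv (fejer n) (\<lambda>_. 1) x = 1"
proof -
  assume n: "1 \<le> n"
  have 1: "integrable torus (\<lambda>_. 1 :: real)" by simp
  have "kconv (\<lambda>t. cos (real k * t)) (\<lambda>_. 1) x = 0" if "1 \<le> k" for k
    using integral_cos_sin[OF that] by (simp add: kconv_cos fourier_cos_def fourier_sin_def)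
  then have "kconv (dirichlet j) (\<lambda>_. 1) x = 1" for j
    unfolding kconv_dirichlet[OF 1] by simp
  then show ?thesis unfolding kconv_fejer[OF 1] using n by simp
qed

text \<open>Both sides are the squared modulus of the sum of \<open>cis (real j * t)\<close> over
  \<open>j < n\<close>; passing from \<open>n\<close> to \<open>n + 1\<close> adds
  \<open>dirichlet n t\<close>. Positivity of the Fejer kernel follows without its closed
  form.\<close>

lemma sum_dirichlet:
  "(\<Sum>j<n. dirichlet j t) = (\<Sum>j<n. cos (real j * t))\<^sup>2 + (\<Sum>j<n. sin (real j * t))\<^sup>2"
proof (induction n)
  case (Suc n)
  have "(\<Sum>j<n. cos (real j * t)) * cos (real n * t) + (\<Sum>j<n. sin (real j * t)) * sin (real n * t)
      = (\<Sum>j<n. cos (real (n - j) * t))"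
    unfolding sum_distrib_right sum.distrib[symmetric]
    by (rule sum.cong) (auto simp: of_nat_diff left_diff_distrib cos_diff)
  also have "\<dots> = (\<Sum>k = 1..n. cos (real k * t))"
    by (rule sum.reindex_bij_witness[where i = "\<lambda>k. n - k" and j = "\<lambda>j. n - j"]) auto
  finally have "dirichlet n t = 1 + 2 * ((\<Sum>j<n. cos (real j * t)) * cos (real n * t)
      + (\<Sum>j<n. sin (real j * t)) * sin (real n * t))"
    by (simp add: dirichlet_def)
  moreover have "1 = (cos (real n * t))\<^sup>2 + (sin (real n * t))\<^sup>2" by simp
  ultimately show ?case
    using Suc by (simp add: power2_sum)
qed simp

lemma fejer_nonneg: "0 \<le> fejer n t"
  by (simp add: fejer_def sum_dirichlet)

lemma kconv_fejer_nonneg: "(\<And>y. 0 \<le> g y) \<Longrightarrow> 0 \<le> kconv (fejer n) g x"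
  unfolding kconv_def by (simp add: fejer_nonneg)

text \<open>The Fejer kernel is a probability weight, so Jensen's inequality bounds the power of the
  mean by the mean of the power, pointwise; integration over \<open>x\<close> preserves the
  total.\<close>

theorem Lp_norm_kconv_fejer:
  assumes p: "1 < p" and n: "1 \<le> n" and g: "Lp_fun p g"
  shows "Lp_norm p (kconv (fejer n) g) \<le> Lp_norm p g"
proof -
  note [measurable] = Lp_funD[OF g] bounded_kernel_measurable[OF bounded_kernel_fejer[of n]]
  have gi: "integrable torus g" by (rule Lp_fun_integrable[OF p g])
  have gp: "integrable torus (\<lambda>y. \<bar>g y\<bar> powr p)" using g by (simp add: Lp_fun_def)
  have pw: "\<bar>kconv (fejer n) g x\<bar> powr p \<le> kconv (fejer n) (\<lambda>y. \<bar>g y\<bar> powr p) x" for x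
  proof -
    \<comment> \<open>The tangent is taken at the mean \<open>s\<close> itself. Averaged against the
      Fejer weight it reads \<open>p * s powr p\<close> at most the mean of the powers plus
      \<open>(p - 1) * s powr p\<close>, which is Jensen's inequality.\<close>
    define s where "s = kconv (fejer n) (\<lambda>y. \<bar>g y\<bar>) x"
    have s0: "0 \<le> s" unfolding s_def by (rule kconv_fejer_nonneg) simp
    note I = integrable_kconv[OF bounded_kernel_fejer, of _ n x]
    have "\<bar>kconv (fejer n) g x\<bar> \<le> s"
      unfolding kconv_def s_def
      by (rule order_trans[OF integral_abs_bound]) (simp add: abs_mult fejer_nonneg)
    then have "\<bar>kconv (fejer n) g x\<bar> powr p \<le> s powr p" using p by (intro powr_mono2) auto
    moreover have "p * (s * s powr (p - 1)) \<le> kconv (fejer n) (\<lambda>y. \<bar>g y\<bar> powr p) x + (p - 1) * s powr p"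
    proof -
      have "p * (s * s powr (p - 1)) = (LINT y|torus. p * ((fejer n (x - y) * \<bar>g y\<bar>) * s powr (p - 1)))"
        unfolding s_def kconv_def by simp
      also have "\<dots> \<le> (LINT y|torus. fejer n (x - y) * \<bar>g y\<bar> powr p + fejer n (x - y) * 1 * ((p - 1) * s powr p))"
      proof (rule integral_mono)
        show "integrable torus (\<lambda>y. p * ((fejer n (x - y) * \<bar>g y\<bar>) * s powr (p - 1)))"
          using I[of "\<lambda>y. \<bar>g y\<bar>"] gi by simp
        show "integrable torus (\<lambda>y. fejer n (x - y) * \<bar>g y\<bar> powr p + fejer n (x - y) * 1 * ((p - 1) * s powr p))"
          using I[OF gp] I[of "\<lambda>_. 1"] by simp
        show "p * ((fejer n (x - y) * \<bar>g y\<bar>) * s powr (p - 1))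
            \<le> fejer n (x - y) * \<bar>g y\<bar> powr p + fejer n (x - y) * 1 * ((p - 1) * s powr p)" for y
          using mult_left_mono[OF powr_tangent[OF p s0, of "\<bar>g y\<bar>"] fejer_nonneg[of n "x - y"]]
          by (simp add: algebra_simps)
      qed
      also have "\<dots> = kconv (fejer n) (\<lambda>y. \<bar>g y\<bar> powr p) x + kconv (fejer n) (\<lambda>_. 1) x * ((p - 1) * s powr p)"
        using I[OF gp] I[of "\<lambda>_. 1"] by (simp add: kconv_def)
      finally show ?thesis by (simp add: kconv_fejer_1[OF n])
    qed
    moreover have "s * s powr (p - 1) = s powr p" using s0 by (rule powr_mult_self)
    ultimately show ?thesis by (simp add: left_diff_distrib)
  qed
  have m: "kconv (fejer n) g \<in> borel_measurable borel"
    by (rule kconv_measurable[OF bounded_kernel_fejer gi])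
  have "(LINT x|torus. \<bar>kconv (fejer n) g x\<bar> powr p) \<le> (LINT x|torus. kconv (fejer n) (\<lambda>y. \<bar>g y\<bar> powr p) x)"
  proof (rule integral_mono)
    show "integrable torus (\<lambda>x. \<bar>kconv (fejer n) g x\<bar> powr p)"
      using Lp_fun_kconv[OF _ bounded_kernel_fejer gi, of p n] p by (simp add: Lp_fun_def)
    show "integrable torus (kconv (fejer n) (\<lambda>y. \<bar>g y\<bar> powr p))"
      by (rule integral_kconv_fejer[OF gp n])
  qed (rule pw)
  also have "\<dots> = (LINT y|torus. \<bar>g y\<bar> powr p)"
    by (rule integral_kconv_fejer[OF gp n])
  finally show ?thesis
    using p m Lp_funD[OF g] by (simp add: Lp_norm_le_iff Lp_norm_powr)
qed

section \<open>The inequality of M. Riesz for conjugate means and for partial sums\<close>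

text \<open>Fejer means are used because they preserve positivity, which partial sums do not: for
  \<open>u \<ge> 0\<close> the real part of \<open>F\<close> is then bounded below on the circle.
  General \<open>u\<close> is a difference of nonnegative functions, at the cost of a factor
  \<open>2\<close>.\<close>

theorem conj_fejer_bound:
  fixes p :: real
  assumes p: "1 < p" "p \<le> 2"
  obtains A where "0 < A"
    "\<And>n u. 1 \<le> n \<Longrightarrow> Lp_fun p u \<Longrightarrow> Lp_norm p (kconv (conj_fejer n) u) \<le> A * Lp_norm p u"
proof -
  obtain A0 where A0: "0 < A0" and
    bound: "\<And>F \<epsilon>. F holomorphic_on UNIV \<Longrightarrow> 0 < \<epsilon> \<Longrightarrow> (\<And>x. \<epsilon> \<le> Re (F (cis x))) \<Longrightarrow> Im (F 0) = 0 \<Longrightarrow>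
      (LINT x|torus. \<bar>Im (F (cis x))\<bar> powr p) \<le> A0 * (LINT x|torus. Re (F (cis x)) powr p)"
    using conjugate_function_bound[OF p] by metis
  define A where "A = A0 powr (1 / p)"
  have A: "0 < A" using A0 by (simp add: A_def)
  have nonneg: "Lp_norm p (kconv (conj_fejer n) u) \<le> A * Lp_norm p u"
    if n: "1 \<le> n" and u: "Lp_fun p u" and u0: "\<And>y. 0 \<le> u y" for n u
  proof (rule field_le_epsilon)
    fix e :: real assume e: "0 < e"
    \<comment> \<open>A Fejer mean may vanish, so a constant is added to keep the real part
      positive; its cost \<open>A * \<epsilon>\<close> is the arbitrary \<open>e\<close>.\<close>
    define \<epsilon> where "\<epsilon> = e / A"
    have \<epsilon>: "0 < \<epsilon>" using e A by (simp add: \<epsilon>_def)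
    have ui: "integrable torus u" by (rule Lp_fun_integrable[OF p(1) u])
    \<comment> \<open>\<open>c k\<close> is the complex Fourier coefficient of \<open>u\<close>.
      Doubling the positive frequencies makes the real part of \<open>F (cis x) - \<epsilon>\<close>
      the Fejer mean and its imaginary part the conjugate mean, while \<open>F 0\<close> is
      \<open>\<epsilon>\<close> plus the mean of \<open>u\<close>, hence real.\<close>
    define c where "c = (\<lambda>k::nat. Complex (fourier_cos k u) (- fourier_sin k u))"
    define D where "D = (\<lambda>j z. c 0 + 2 * (\<Sum>k = 1..j. c k * z ^ k))"
    define F where "F = (\<lambda>z. of_real \<epsilon> + of_real (1 / real n) * (\<Sum>j<n. D j z))"
    have hol: "F holomorphic_on UNIV" unfolding F_def D_def by (intro holomorphic_intros)
    have c: "Re (c k * cis x ^ k) = kconv (\<lambda>t. cos (real k * t)) u x"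
      "Im (c k * cis x ^ k) = kconv (\<lambda>t. sin (real k * t)) u x" for k x
      unfolding c_def kconv_cos[OF ui] kconv_sin[OF ui] Complex.DeMoivre by (simp_all add: mult.commute)
    have c0: "c 0 = of_real (LINT y|torus. u y)"
      by (simp add: c_def fourier_cos_def fourier_sin_def complex_eq_iff)
    have two: "Re (2 * z) = 2 * Re z" "Im (2 * z) = 2 * Im z" for z :: complex by simp_all
    have D: "Re (D j (cis x)) = kconv (dirichlet j) u x"
        "Im (D j (cis x)) = kconv (conj_dirichlet j) u x" for j x
      unfolding D_def c0 kconv_dirichlet[OF ui] kconv_conj_dirichlet[OF ui]
      by (simp_all add: c two del: times_complex.simps)
    have F: "Re (F (cis x)) = kconv (fejer n) u x + \<epsilon>"
        "Im (F (cis x)) = kconv (conj_fejer n) u x" for x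
      unfolding F_def kconv_fejer[OF ui] kconv_conj_fejer[OF ui]
      by (simp_all add: D)
    have F0: "Im (F 0) = 0"
      unfolding F_def D_def c0 by (simp add: sum.neutral power_0_left)
    have pos: "0 \<le> kconv (fejer n) u x" for x by (rule kconv_fejer_nonneg[OF u0])
    have Lf: "Lp_fun p (kconv (fejer n) u)" "Lp_fun p (kconv (conj_fejer n) u)"
      using p ui by (auto intro!: Lp_fun_kconv bounded_kernel_fejer bounded_kernel_conj_fejer)
    have Le: "Lp_fun p (\<lambda>_. \<epsilon>)" using p \<epsilon> by (intro Lp_fun_bounded[where B = \<epsilon>]) auto
    note Ls = Lp_fun_add[OF p(1) Lf(1) Le]
    have "(LINT x|torus. \<bar>Im (F (cis x))\<bar> powr p) \<le> A0 * (LINT x|torus. Re (F (cis x)) powr p)"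
      using hol \<epsilon> _ F0 by (rule bound) (use pos in \<open>simp add: F\<close>)
    also have "(LINT x|torus. Re (F (cis x)) powr p) = (LINT x|torus. \<bar>kconv (fejer n) u x + \<epsilon>\<bar> powr p)"
      using pos \<epsilon> by (simp add: F abs_of_nonneg add_nonneg_nonneg)
    also have "\<dots> = Lp_norm p (\<lambda>x. kconv (fejer n) u x + \<epsilon>) powr p"
      using p Lp_funD[OF Ls] by (simp add: Lp_norm_powr)
    also have "A0 * \<dots> = (A * Lp_norm p (\<lambda>x. kconv (fejer n) u x + \<epsilon>)) powr p"
      using A0 p by (simp add: A_def powr_mult powr_powr)
    finally have "Lp_norm p (kconv (conj_fejer n) u) \<le> A * Lp_norm p (\<lambda>x. kconv (fejer n) u x + \<epsilon>)"
      using p A Lp_funD[OF Lf(2)] by (simp add: Lp_norm_le_iff F)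
    also have "\<dots> \<le> A * (Lp_norm p u + \<epsilon>)"
    proof (rule mult_left_mono)
      have "Lp_norm p (\<lambda>x. kconv (fejer n) u x + \<epsilon>) \<le> Lp_norm p (kconv (fejer n) u) + Lp_norm p (\<lambda>_. \<epsilon>)"
        by (rule Lp_norm_triangle[OF p(1) Lf(1) Le])
      also have "\<dots> \<le> Lp_norm p u + \<epsilon>"
        using p \<epsilon> by (intro add_mono Lp_norm_kconv_fejer[OF p(1) n u] Lp_norm_bounded) auto
      finally show "Lp_norm p (\<lambda>x. kconv (fejer n) u x + \<epsilon>) \<le> Lp_norm p u + \<epsilon>" .
    qed (use A in simp)
    also have "\<dots> = A * Lp_norm p u + e" using A by (simp add: \<epsilon>_def distrib_left)
    finally show "Lp_norm p (kconv (conj_fejer n) u) \<le> A * Lp_norm p u + e" .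
  qed
  have "Lp_norm p (kconv (conj_fejer n) u) \<le> 2 * A * Lp_norm p u"
    if n: "1 \<le> n" and u: "Lp_fun p u" for n u
  proof -
    have p0: "0 \<le> p" "0 < p" using p by auto
    note [measurable] = Lp_funD[OF u]
    let ?v = "\<lambda>y. max (u y) 0" and ?w = "\<lambda>y. max (- u y) 0"
    have m: "?v \<in> borel_measurable borel" "?w \<in> borel_measurable borel" by measurable
    have v: "Lp_fun p ?v" by (rule Lp_fun_le[OF p0(1) u m(1)]) auto
    have w: "Lp_fun p ?w" by (rule Lp_fun_le[OF p0(1) u m(2)]) auto
    note vi = Lp_fun_integrable[OF p(1) v] and wi = Lp_fun_integrable[OF p(1) w]
    have vle: "Lp_norm p ?v \<le> Lp_norm p u" by (rule Lp_norm_mono[OF p0(2) u m(1)]) auto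
    have wle: "Lp_norm p ?w \<le> Lp_norm p u" by (rule Lp_norm_mono[OF p0(2) u m(2)]) auto
    have "u = (\<lambda>y. ?v y - ?w y)" by auto
    then have "kconv (conj_fejer n) u x = kconv (conj_fejer n) ?v x - kconv (conj_fejer n) ?w x" for x
      using kconv_diff_right[OF bounded_kernel_conj_fejer vi wi] by metis
    then have "Lp_norm p (kconv (conj_fejer n) u) =
        Lp_norm p (\<lambda>x. kconv (conj_fejer n) ?v x - kconv (conj_fejer n) ?w x)"
      by presburger
    also have "\<dots> \<le> Lp_norm p (kconv (conj_fejer n) ?v) + Lp_norm p (kconv (conj_fejer n) ?w)"
      by (intro Lp_norm_diff_triangle p Lp_fun_kconv bounded_kernel_conj_fejer vi wi p0)
    also have "\<dots> \<le> A * Lp_norm p ?v + A * Lp_norm p ?w"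
      by (intro add_mono nonneg n v w) auto
    also have "\<dots> \<le> A * Lp_norm p u + A * Lp_norm p u"
      using A by (intro add_mono mult_left_mono vle wle) auto
    finally show ?thesis by simp
  qed
  moreover have "0 < 2 * A" using A by simp
  ultimately show thesis using that by blast
qed

text \<open>The term \<open>h k\<close> occurs in the inner sums with
  \<open>j = k, ..., n - 1\<close>, that is \<open>n - k\<close> times; averages of Dirichlet
  kernels get their triangular weights this way.\<close>

lemma sum_double_triangle:
  fixes h :: "nat \<Rightarrow> real"
  shows "(\<Sum>j<n. \<Sum>k = 1..j. h k) = (\<Sum>k = 1..<n. real (n - k) * h k)"
proof (induction n)
  case (Suc n)
  have "(\<Sum>k = 1..<Suc n. real (Suc n - k) * h k) = (\<Sum>k = 1..<Suc n. real (n - k) * h k + h k)"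
    by (intro sum.cong) (auto simp: Suc_diff_le algebra_simps)
  also have "\<dots> = (\<Sum>k = 1..<n. real (n - k) * h k) + (\<Sum>k = 1..n. h k)"
    unfolding sum.distrib by (cases n) (auto simp: atLeastLessThanSuc_atLeastAtMost)
  finally show ?case using Suc by simp
qed simp

text \<open>
  Multiplying by \<open>sin Nt\<close> moves the jump of the conjugate multiplier from \<open>0\<close> to \<open>\<plusminus>N\<close>, which
  turns bounds for conjugate functions into bounds for partial sums.
\<close>

lemma dirichlet_modulation:
  assumes N: "1 \<le> N"
  shows "dirichlet N t = fejer (2 * N) t + sin (real N * t) * conj_fejer N t + cos (real N * t)"
proof -
  define c where "c = (\<lambda>k. cos (real k * t))"
  have split: "{1..<2 * N} = {1..<N} \<union> {N} \<union> {N<..<2 * N}" using N by auto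
  have "real (2 * N) * fejer (2 * N) t = 2 * real N + 2 * (\<Sum>k = 1..<2 * N. real (2 * N - k) * c k)"
    using N sum_double_triangle[of c "2 * N"]
    by (simp add: fejer_def dirichlet_def sum.distrib c_def flip: sum_distrib_left)
  also have "(\<Sum>k = 1..<2 * N. real (2 * N - k) * c k)
     = (\<Sum>k = 1..<N. real (2 * N - k) * c k) + real N * c N + (\<Sum>k\<in>{N<..<2 * N}. real (2 * N - k) * c k)"
    unfolding split by (subst sum.union_disjoint; auto)+
  finally have fej: "real N * fejer (2 * N) t = real N + (\<Sum>k = 1..<N. real (2 * N - k) * c k) + real N * c N
     + (\<Sum>k\<in>{N<..<2 * N}. real (2 * N - k) * c k)"
    by simp
  have "real N * conj_fejer N t = 2 * (\<Sum>k = 1..<N. real (N - k) * sin (real k * t))"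
    using N sum_double_triangle[of "\<lambda>k. sin (real k * t)" N]
    by (simp add: conj_fejer_def conj_dirichlet_def flip: sum_distrib_left)
  then have "real N * (sin (real N * t) * conj_fejer N t)
      = sin (real N * t) * (2 * (\<Sum>k = 1..<N. real (N - k) * sin (real k * t)))"
    by (metis mult.left_commute)
  also have "\<dots> = (\<Sum>k = 1..<N. real (N - k) * (2 * (sin (real k * t) * sin (real N * t))))"
    unfolding sum_distrib_left by (intro sum.cong) auto
  also have "\<dots> = (\<Sum>k = 1..<N. real (N - k) * c (N - k)) - (\<Sum>k = 1..<N. real (N - k) * c (N + k))"
    unfolding sum_subtractf[symmetric]
    by (intro sum.cong) (auto simp: c_def of_nat_diff left_diff_distrib distrib_right cos_diff cos_add algebra_simps)
  also have "(\<Sum>k = 1..<N. real (N - k) * c (N - k)) = (\<Sum>k = 1..<N. real k * c k)"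
    by (rule sum.reindex_bij_witness[where i = "\<lambda>k. N - k" and j = "\<lambda>k. N - k"]) auto
  also have "(\<Sum>k = 1..<N. real (N - k) * c (N + k)) = (\<Sum>k\<in>{N<..<2 * N}. real (2 * N - k) * c k)"
    by (rule sum.reindex_bij_witness[where i = "\<lambda>k. k - N" and j = "\<lambda>k. k + N"]) (auto simp: add.commute)
  \<comment> \<open>Above \<open>N\<close> the triangle of \<open>fejer (2 * N)\<close> and the
    modulated conjugate kernel cancel; below \<open>N\<close> their slopes cancel and leave the
    constant \<open>2 * N\<close>; at \<open>N\<close> the Fejer kernel supplies half of the weight
    and the extra cosine the other half.\<close>
  finally have "real N * (fejer (2 * N) t + sin (real N * t) * conj_fejer N t + c N)
      = real N + ((\<Sum>k = 1..<N. real (2 * N - k) * c k) + (\<Sum>k = 1..<N. real k * c k)) + 2 * real N * c N"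
    using fej by (simp add: distrib_left)
  also have "(\<Sum>k = 1..<N. real (2 * N - k) * c k) + (\<Sum>k = 1..<N. real k * c k) = 2 * real N * (\<Sum>k = 1..<N. c k)"
    unfolding sum.distrib[symmetric] sum_distrib_left
    by (intro sum.cong) (auto simp: of_nat_diff algebra_simps)
  also have "real N + 2 * real N * (\<Sum>k = 1..<N. c k) + 2 * real N * c N = real N * (1 + 2 * (\<Sum>k = 1..N. c k))"
  proof -
    have "{1..N} = insert N {1..<N}" using N by auto
    then show ?thesis by (simp add: algebra_simps)
  qed
  finally show ?thesis using N by (simp add: dirichlet_def c_def)
qed

text \<open>The addition theorem splits \<open>sin (a * (x - y))\<close> into products. Modulating
  the kernel thus amounts to multiplying \<open>g\<close> before and the result after the
  convolution by factors of modulus at most \<open>1\<close>, which cost nothing in norm.\<close>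

lemma kconv_modulation:
  assumes k: "bounded_kernel k" and g: "integrable torus g"
  shows "kconv (\<lambda>t. sin (a * t) * k t) g x =
    sin (a * x) * kconv k (\<lambda>y. cos (a * y) * g y) x - cos (a * x) * kconv k (\<lambda>y. sin (a * y) * g y) x"
proof -
  note I = integrable_kconv[OF k integrable_cos_sin_mult(1)[OF g, of a], of x]
    integrable_kconv[OF k integrable_cos_sin_mult(2)[OF g, of a], of x]
  have "kconv (\<lambda>t. sin (a * t) * k t) g x =
    (LINT y|torus. sin (a * x) * (k (x - y) * (cos (a * y) * g y)) - cos (a * x) * (k (x - y) * (sin (a * y) * g y)))"
    unfolding kconv_def by (simp add: right_diff_distrib sin_diff algebra_simps)
  then show ?thesis using I by (simp add: kconv_def)
qed

text \<open>Modulation writes the partial sum as a Fejer mean, two modulated conjugate means and one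
  cosine term, with norms at most \<open>1\<close>, \<open>A\<close>, \<open>A\<close> and
  \<open>1\<close> times that of \<open>g\<close>; none of these depends on \<open>N\<close>. The
  case \<open>N = 0\<close> is a plain mean.\<close>

lemma dirichlet_bound_le_2:
  fixes p :: real
  assumes p: "1 < p" "p \<le> 2"
  obtains A where "0 < A"
    "\<And>N g. Lp_fun p g \<Longrightarrow> Lp_norm p (kconv (dirichlet N) g) \<le> A * Lp_norm p g"
proof -
  obtain A where A: "0 < A" and conj: "\<And>n u. 1 \<le> n \<Longrightarrow> Lp_fun p u \<Longrightarrow> Lp_norm p (kconv (conj_fejer n) u) \<le> A * Lp_norm p u"
    using conj_fejer_bound[OF p] by metis
  have p0: "0 \<le> p" "0 < p" using p by auto
  have bdd: "Lp_norm p (kconv k g) \<le> Lp_norm p g"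
    if k: "bounded_kernel k" "\<And>t. \<bar>k t\<bar> \<le> 1" and g: "Lp_fun p g" for k g
  proof -
    note gi = Lp_fun_integrable[OF p(1) g]
    have "Lp_norm p (kconv k g) \<le> (LINT x|torus. \<bar>g x\<bar>)"
      using kconv_abs_le[OF k(2) gi] kconv_measurable[OF k(1) gi] p by (intro Lp_norm_bounded) auto
    also have "\<dots> \<le> Lp_norm p g" by (rule integral_abs_le_Lp_norm[OF p(1) g])
    finally show ?thesis .
  qed
  have "Lp_norm p (kconv (dirichlet N) g) \<le> (2 + 2 * A) * Lp_norm p g" if g: "Lp_fun p g" for N g
  proof (cases "1 \<le> N")
    case False
    then have "dirichlet N = (\<lambda>t. 1)" by (auto simp: dirichlet_def fun_eq_iff)
    then have "Lp_norm p (kconv (dirichlet N) g) \<le> 1 * Lp_norm p g"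
      using bdd[OF bounded_kernel_const[of 1] _ g] by simp
    also have "\<dots> \<le> (2 + 2 * A) * Lp_norm p g" using A by (intro mult_right_mono) auto
    finally show ?thesis .
  next
    case N: True
    note gi = Lp_fun_integrable[OF p(1) g]
    note [measurable] = Lp_funD[OF g]
    let ?gc = "\<lambda>y. cos (real N * y) * g y" and ?gs = "\<lambda>y. sin (real N * y) * g y"
    have abs_le: "\<bar>cos a * b\<bar> \<le> \<bar>b\<bar>" "\<bar>sin a * b\<bar> \<le> \<bar>b\<bar>" for a b :: real
      by (simp_all add: abs_mult mult_left_le_one_le)
    have gc: "Lp_fun p ?gc" "Lp_norm p ?gc \<le> Lp_norm p g"
      by (rule Lp_fun_le[OF p0(1) g] Lp_norm_mono[OF p0(2) g]; simp add: abs_le)+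
    have gs: "Lp_fun p ?gs" "Lp_norm p ?gs \<le> Lp_norm p g"
      by (rule Lp_fun_le[OF p0(1) g] Lp_norm_mono[OF p0(2) g]; simp add: abs_le)+
    define U where "U = kconv (fejer (2 * N)) g"
    define V where "V = (\<lambda>x. sin (real N * x) * kconv (conj_fejer N) ?gc x)"
    define W where "W = (\<lambda>x. cos (real N * x) * kconv (conj_fejer N) ?gs x)"
    define X where "X = kconv (\<lambda>t. cos (real N * t)) g"
    note bk = bounded_kernel_mult[OF bounded_kernel_sin[of "real N"] bounded_kernel_conj_fejer[of N]]
    have "kconv (dirichlet N) g x = U x + (V x - W x) + X x" for x
      unfolding dirichlet_modulation[OF N, abs_def] U_def V_def W_def X_def
      using gi kconv_modulation[OF bounded_kernel_conj_fejer gi, of "real N" N x]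
      by (simp add: kconv_add bounded_kernel_intros bounded_kernel_fejer bk)
    then have eq: "kconv (dirichlet N) g = (\<lambda>x. U x + (V x - W x) + X x)" by blast
    have LU: "Lp_fun p U" and LX: "Lp_fun p X"
      unfolding U_def X_def using p0 gi
      by (auto intro!: Lp_fun_kconv bounded_kernel_fejer bounded_kernel_cos)
    have Lc: "Lp_fun p (kconv (conj_fejer N) ?gc)" and Ls: "Lp_fun p (kconv (conj_fejer N) ?gs)"
      by (intro Lp_fun_kconv bounded_kernel_conj_fejer p0 Lp_fun_integrable[OF p(1)] gc gs)+
    note [measurable] = Lp_funD[OF Lc] Lp_funD[OF Ls]
    have Vm: "V \<in> borel_measurable borel" and Wm: "W \<in> borel_measurable borel"
      unfolding V_def W_def by measurable
    have Vle: "\<bar>V x\<bar> \<le> \<bar>kconv (conj_fejer N) ?gc x\<bar>" and Wle: "\<bar>W x\<bar> \<le> \<bar>kconv (conj_fejer N) ?gs x\<bar>" for x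
      unfolding V_def W_def by (simp_all add: abs_le)
    have LV: "Lp_fun p V" and LW: "Lp_fun p W"
      by (rule Lp_fun_le[OF p0(1) Lc Vm Vle], rule Lp_fun_le[OF p0(1) Ls Wm Wle])
    have "Lp_norm p V \<le> A * Lp_norm p ?gc" "Lp_norm p W \<le> A * Lp_norm p ?gs"
      by (rule order_trans[OF Lp_norm_mono[OF p0(2) Lc Vm Vle] conj[OF N gc(1)]],
          rule order_trans[OF Lp_norm_mono[OF p0(2) Ls Wm Wle] conj[OF N gs(1)]])
    then have nV: "Lp_norm p V \<le> A * Lp_norm p g" and nW: "Lp_norm p W \<le> A * Lp_norm p g"
      using mult_left_mono[OF gc(2), of A] mult_left_mono[OF gs(2), of A] A by linarith+
    have nU: "Lp_norm p U \<le> Lp_norm p g"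
      unfolding U_def using N by (intro Lp_norm_kconv_fejer[OF p(1) _ g]) auto
    have nX: "Lp_norm p X \<le> Lp_norm p g"
      unfolding X_def by (intro bdd bounded_kernel_cos g) simp
    note LVW = Lp_fun_diff[OF p(1) LV LW]
    have "Lp_norm p (kconv (dirichlet N) g) \<le> Lp_norm p (\<lambda>x. U x + (V x - W x)) + Lp_norm p X"
      unfolding eq by (rule Lp_norm_triangle[OF p(1) Lp_fun_add[OF p(1) LU LVW] LX])
    also have "\<dots> \<le> (Lp_norm p U + (Lp_norm p V + Lp_norm p W)) + Lp_norm p X"
      using Lp_norm_triangle[OF p(1) LU LVW] Lp_norm_diff_triangle[OF p(1) LV LW] by simp
    finally show ?thesis using nU nV nW nX by (simp add: algebra_simps)
  qed
  moreover have "0 < 2 + 2 * A" using A by simp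
  ultimately show thesis using that by blast
qed

text \<open>The kernel is even, so both sides are the same symmetric bilinear form in the Fourier
  coefficients of \<open>g\<close> and \<open>h\<close>.\<close>

lemma kconv_dirichlet_symmetric:
  assumes g: "integrable torus g" and h: "integrable torus h"
  shows "(LINT x|torus. kconv (dirichlet N) g x * h x) = (LINT x|torus. g x * kconv (dirichlet N) h x)"
proof -
  have expand: "(LINT x|torus. kconv (dirichlet N) g x * h x) =
    (LINT y|torus. g y) * (LINT y|torus. h y) +
     2 * (\<Sum>k = 1..N. fourier_cos k g * fourier_cos k h + fourier_sin k g * fourier_sin k h)"
    if g: "integrable torus g" and h: "integrable torus h" for g h :: "real \<Rightarrow> real"
  proof -
    note I = integrable_cos_sin_mult[OF h]
    have "(LINT x|torus. kconv (dirichlet N) g x * h x) =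
      (LINT x|torus. (LINT y|torus. g y) * h x +
        2 * (\<Sum>k = 1..N. fourier_cos k g * (cos (real k * x) * h x) + fourier_sin k g * (sin (real k * x) * h x)))"
      unfolding kconv_dirichlet[OF g] kconv_cos[OF g]
      by (intro Bochner_Integration.integral_cong)
        (auto simp: distrib_left distrib_right sum_distrib_right sum_distrib_left mult_ac intro!: sum.cong)
    then show ?thesis using I h by (simp add: fourier_cos_def fourier_sin_def)
  qed
  show ?thesis
    using expand[OF g h] expand[OF h g] by (simp add: mult.commute)
qed

text \<open>For \<open>p > 2\<close> the symmetry of the convolution moves the kernel onto a
  function in the conjugate space, whose exponent \<open>q\<close> is below \<open>2\<close>; the
  constant for \<open>q\<close> serves for \<open>p\<close>.\<close>

theorem dirichlet_bound:
  fixes p :: real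
  assumes p: "1 < p"
  obtains A where "0 < A"
    "\<And>N g. Lp_fun p g \<Longrightarrow> Lp_norm p (kconv (dirichlet N) g) \<le> A * Lp_norm p g"
proof (cases "p \<le> 2")
  case True
  from dirichlet_bound_le_2[OF p True] that show thesis by metis
next
  case False
  define q where "q = p / (p - 1)"
  have q: "1 < q" "q \<le> 2" and pq: "1 / p + 1 / q = 1"
    using conjugate_exponent[OF p] False by (auto simp: q_def field_simps)
  have qp: "(p - 1) * q = p" using p by (simp add: q_def)
  obtain A where A: "0 < A" and bound: "\<And>N g. Lp_fun q g \<Longrightarrow> Lp_norm q (kconv (dirichlet N) g) \<le> A * Lp_norm q g"
    using dirichlet_bound_le_2[OF q] by metis
  have "Lp_norm p (kconv (dirichlet N) g) \<le> A * Lp_norm p g" if g: "Lp_fun p g" for N g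
  proof -
    note gi = Lp_fun_integrable[OF p g]
    define w where "w = kconv (dirichlet N) g"
    have wm [measurable]: "w \<in> borel_measurable borel"
      unfolding w_def by (rule kconv_measurable[OF bounded_kernel_dirichlet gi])
    obtain B where "\<And>t. \<bar>dirichlet N t\<bar> \<le> B"
      using bounded_kernel_dirichlet[of N] by (auto simp: bounded_kernel_def)
    from kconv_abs_le[where k = "dirichlet N", OF this gi] obtain C where C: "\<And>x. \<bar>w x\<bar> \<le> C"
      unfolding w_def by blast
    \<comment> \<open>The extremal function in Hoelder's inequality for \<open>w\<close>: both
      \<open>w * h\<close> and \<open>\<bar>h\<bar> powr q\<close> equal
      \<open>\<bar>w\<bar> powr p\<close>. For fixed \<open>N\<close> the function \<open>w\<close>
      is bounded, which places \<open>h\<close> in the conjugate space.\<close>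
    define h where "h = (\<lambda>x. sgn (w x) * \<bar>w x\<bar> powr (p - 1))"
    have hm: "h \<in> borel_measurable borel" unfolding h_def by measurable
    have habs: "\<bar>h x\<bar> = \<bar>w x\<bar> powr (p - 1)" for x
      by (simp add: h_def abs_mult sgn_if)
    have hb: "\<bar>h x\<bar> \<le> C powr (p - 1)" for x
      unfolding habs using C p by (intro powr_mono2) auto
    have h: "Lp_fun q h" using q by (intro Lp_fun_bounded[OF _ hm hb]) auto
    note hi = Lp_fun_integrable[OF q(1) h]
    have wh: "w x * h x = \<bar>w x\<bar> powr p" for x
    proof -
      have "w x * sgn (w x) = \<bar>w x\<bar>" by (simp add: sgn_if)
      then have "w x * h x = \<bar>w x\<bar> * \<bar>w x\<bar> powr (p - 1)"
        unfolding h_def by (simp only: mult.assoc[symmetric])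
      then show ?thesis by (simp add: powr_mult_self)
    qed
    have hq: "Lp_norm q h = Lp_norm p w powr (p - 1)"
    proof -
      have "Lp_norm q h = (LINT x|torus. \<bar>w x\<bar> powr p) powr (1 / q)"
        using hm by (simp add: Lp_norm_torus habs powr_powr qp)
      also have "\<dots> = Lp_norm p w powr (p / q)"
        using p by (simp add: Lp_norm_powr[symmetric] powr_powr)
      also have "p / q = p - 1" using p by (simp add: q_def)
      finally show ?thesis .
    qed
    have "Lp_norm p w powr p = (LINT x|torus. w x * h x)"
      using p by (simp add: wh Lp_norm_powr)
    also have "\<dots> = (LINT x|torus. g x * kconv (dirichlet N) h x)"
      unfolding w_def by (rule kconv_dirichlet_symmetric[OF gi hi])
    also have "\<dots> \<le> Lp_norm p g * Lp_norm q (kconv (dirichlet N) h)"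
      using q by (intro order_trans[OF abs_ge_self Hoelder(2)[OF p q(1) pq g]] Lp_fun_kconv
          bounded_kernel_dirichlet hi) auto
    also have "\<dots> \<le> Lp_norm p g * (A * Lp_norm q h)"
      by (intro mult_left_mono bound h) simp
    finally have *: "Lp_norm p w powr p \<le> A * Lp_norm p g * Lp_norm p w powr (p - 1)"
      by (simp add: hq mult_ac)
    show ?thesis
    proof (cases "Lp_norm p w = 0")
      case True
      then show ?thesis using A by (simp add: w_def)
    next
      case False
      then have pos: "0 < Lp_norm p w powr (p - 1)" by simp
      have "Lp_norm p w * Lp_norm p w powr (p - 1) \<le> A * Lp_norm p g * Lp_norm p w powr (p - 1)"
        using * by (simp add: powr_mult_self)
      then show ?thesis using pos by (simp add: w_def)
    qed
  qed
  with A show thesis by (rule that)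
qed

subsection \<open>Cosine series\<close>

text \<open>The lower boundary term pairs \<open>d m\<close> with \<open>\<mu> (Suc m)\<close>, so
  the first omitted coefficient governs the tail estimates.\<close>

lemma abel_summation:
  fixes \<mu> d :: "nat \<Rightarrow> real"
  assumes "m < n"
  shows "(\<Sum>k\<in>{m<..n}. \<mu> k * (d k - d (k - 1))) =
    \<mu> n * d n - \<mu> (Suc m) * d m + (\<Sum>k\<in>{m<..<n}. (\<mu> k - \<mu> (Suc k)) * d k)"
proof -
  obtain j where n: "n = Suc (m + j)" using assms less_iff_Suc_add by auto
  show ?thesis unfolding n
  proof (induction j)
    case 0
    have "{m<..Suc m} = {Suc m}" "{m<..<Suc m} = {}" by auto
    then show ?case by (simp add: algebra_simps)
  next
    case (Suc j)
    have "{m<..Suc (m + Suc j)} = insert (Suc (m + Suc j)) {m<..Suc (m + j)}"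
      "{m<..<Suc (m + Suc j)} = insert (Suc (m + j)) {m<..<Suc (m + j)}" by auto
    with Suc show ?case by (simp add: algebra_simps)
  qed
qed

abbreviation cos_conv :: "nat \<Rightarrow> (real \<Rightarrow> real) \<Rightarrow> real \<Rightarrow> real" where
  "cos_conv k \<equiv> kconv (\<lambda>t. cos (real k * t))"

text \<open>Each \<open>2 * cos_conv k g\<close> is a difference of consecutive partial sums. Abel
  summation leaves weights \<open>\<mu> n\<close>, \<open>\<mu> (Suc m)\<close> and the decrements
  of \<open>\<mu>\<close>, all nonnegative; they telescope to \<open>2 * \<mu> (Suc m)\<close>,
  whatever the length of the block.\<close>

lemma cos_block_bound:
  fixes p :: real and \<mu> :: "nat \<Rightarrow> real"
  assumes p: "1 < p" and g: "Lp_fun p g"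
    and A: "\<And>N. Lp_norm p (kconv (dirichlet N) g) \<le> B"
    and \<mu>0: "\<And>k. m < k \<Longrightarrow> 0 \<le> \<mu> k" and \<mu>: "\<And>k. m < k \<Longrightarrow> \<mu> (Suc k) \<le> \<mu> k"
  shows "Lp_norm p (\<lambda>x. \<Sum>k\<in>{m<..n}. \<mu> k * (2 * cos_conv k g x)) \<le> 2 * B * \<mu> (Suc m)"
proof (cases "m < n")
  case True
  note gi = Lp_fun_integrable[OF p g]
  have B: "0 \<le> B" using order_trans[OF Lp_norm_nonneg A] .
  define d where "d = (\<lambda>k. kconv (dirichlet k) g)"
  have Ld: "Lp_fun p (d k)" for k
    unfolding d_def using p by (intro Lp_fun_kconv bounded_kernel_dirichlet gi) auto
  have Lcd: "Lp_fun p (\<lambda>x. c * d k x)" for c k by (rule Lp_fun_cmult[OF Ld])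
  have ncd: "Lp_norm p (\<lambda>x. c * d k x) \<le> \<bar>c\<bar> * B" for c k
    using p Lp_norm_cmult[OF _ Ld, of c k] A[of k] by (simp add: d_def mult_left_mono)
  have "2 * cos_conv k g x = d k x - d (k - 1) x" if "0 < k" for k x
  proof -
    have "{1..k} = insert k {1..k - 1}" using that by auto
    then show ?thesis using that by (simp add: d_def kconv_dirichlet[OF gi] distrib_left)
  qed
  then have "(\<Sum>k\<in>{m<..n}. \<mu> k * (2 * cos_conv k g x)) = (\<Sum>k\<in>{m<..n}. \<mu> k * (d k x - d (k - 1) x))" for x
    by (intro sum.cong) auto
  then have eq: "(\<Sum>k\<in>{m<..n}. \<mu> k * (2 * cos_conv k g x)) =
    (\<mu> n * d n x - \<mu> (Suc m) * d m x) + (\<Sum>k\<in>{m<..<n}. (\<mu> k - \<mu> (Suc k)) * d k x)" for x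
    using abel_summation[OF True, of \<mu> "\<lambda>k. d k x"] by simp
  have "Lp_norm p (\<lambda>x. \<Sum>k\<in>{m<..n}. \<mu> k * (2 * cos_conv k g x)) \<le>
      Lp_norm p (\<lambda>x. \<mu> n * d n x - \<mu> (Suc m) * d m x) +
      Lp_norm p (\<lambda>x. \<Sum>k\<in>{m<..<n}. (\<mu> k - \<mu> (Suc k)) * d k x)"
    unfolding eq by (intro Lp_norm_triangle p Lp_fun_diff Lp_fun_sum Lcd) auto
  also have "\<dots> \<le> (\<mu> n * B + \<mu> (Suc m) * B) + (\<Sum>k\<in>{m<..<n}. (\<mu> k - \<mu> (Suc k)) * B)"
  proof (intro add_mono)
    show "Lp_norm p (\<lambda>x. \<mu> n * d n x - \<mu> (Suc m) * d m x) \<le> \<mu> n * B + \<mu> (Suc m) * B"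
      using Lp_norm_diff_triangle[OF p Lcd Lcd, of "\<mu> n" n "\<mu> (Suc m)" m]
        ncd[of "\<mu> n" n] ncd[of "\<mu> (Suc m)" m] \<mu>0[OF True] \<mu>0[of "Suc m"] by simp
    have "Lp_norm p (\<lambda>x. \<Sum>k\<in>{m<..<n}. (\<mu> k - \<mu> (Suc k)) * d k x) \<le>
        (\<Sum>k\<in>{m<..<n}. Lp_norm p (\<lambda>x. (\<mu> k - \<mu> (Suc k)) * d k x))"
      by (intro Lp_norm_sum p Lcd) auto
    also have "\<dots> \<le> (\<Sum>k\<in>{m<..<n}. (\<mu> k - \<mu> (Suc k)) * B)"
    proof (rule sum_mono)
      fix k assume "k \<in> {m<..<n}"
      then have "\<bar>\<mu> k - \<mu> (Suc k)\<bar> = \<mu> k - \<mu> (Suc k)" using \<mu>[of k] by simp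
      then show "Lp_norm p (\<lambda>x. (\<mu> k - \<mu> (Suc k)) * d k x) \<le> (\<mu> k - \<mu> (Suc k)) * B"
        using ncd[of "\<mu> k - \<mu> (Suc k)" k] by simp
    qed
    finally show "Lp_norm p (\<lambda>x. \<Sum>k\<in>{m<..<n}. (\<mu> k - \<mu> (Suc k)) * d k x) \<le> (\<Sum>k\<in>{m<..<n}. (\<mu> k - \<mu> (Suc k)) * B)" .
  qed
  also have "(\<Sum>k\<in>{m<..<n}. (\<mu> k - \<mu> (Suc k)) * B) = (\<mu> (Suc m) - \<mu> n) * B"
  proof -
    have "{m<..<n} = {Suc m..<n}" by auto
    then show ?thesis
      using sum_Suc_diff'[of "Suc m" n "\<lambda>k. - \<mu> k"] True by (simp flip: sum_distrib_right)
  qed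
  finally show ?thesis by (simp add: algebra_simps)
next
  case False
  have "0 \<le> B" using order_trans[OF Lp_norm_nonneg A] .
  then have "0 \<le> 2 * B * \<mu> (Suc m)" using \<mu>0[of "Suc m"] by simp
  moreover have "Lp_norm p (\<lambda>x. 0) \<le> 0" using p by (intro Lp_norm_bounded) auto
  ultimately show ?thesis using False by simp
qed

definition cos_poly :: "nat \<Rightarrow> (nat \<Rightarrow> real) \<Rightarrow> real \<Rightarrow> real" where
  "cos_poly n a t = a 0 + 2 * (\<Sum>k = 1..n. a k * cos (real k * t))"

text \<open>\<open>cos_series a\<close> is \<open>\<Sum>\<^sub>k a\<^sub>|\<^sub>k\<^sub>| e\<^sup>i\<^sup>k\<^sup>x\<close>, with the two-sided sum folded onto \<open>k \<ge> 1\<close>.\<close>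

definition cos_series :: "(nat \<Rightarrow> real) \<Rightarrow> real \<Rightarrow> real" where
  "cos_series a t = a 0 + 2 * (\<Sum>k. a (Suc k) * cos (real (Suc k) * t))"

definition cos_tail :: "nat \<Rightarrow> (nat \<Rightarrow> real) \<Rightarrow> real" where
  "cos_tail n a = 2 * (\<Sum>k. \<bar>a (Suc (k + n))\<bar>)"

lemma cos_tail_tendsto_0:
  assumes "summable (\<lambda>k. \<bar>a k\<bar>)"
  shows "(\<lambda>n. cos_tail n a) \<longlonglongrightarrow> 0"
proof -
  have "summable (\<lambda>k. \<bar>a (Suc k)\<bar>)" using assms by (subst summable_Suc_iff)
  from suminf_exist_split2[OF this] have "(\<lambda>n. \<Sum>k. \<bar>a (Suc (k + n))\<bar>) \<longlonglongrightarrow> 0" by simp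
  from tendsto_mult_left[OF this, of 2] show ?thesis by (simp add: cos_tail_def)
qed

lemma cos_series_minus_cos_poly:
  assumes "summable (\<lambda>k. \<bar>a k\<bar>)"
  shows "\<bar>cos_series a t - cos_poly n a t\<bar> \<le> cos_tail n a"
proof -
  let ?h = "\<lambda>k. a (Suc k) * cos (real (Suc k) * t)"
  have sa: "summable (\<lambda>k. \<bar>a (Suc (k + n))\<bar>)" for n
    using assms summable_iff_shift[of "\<lambda>k. \<bar>a k\<bar>" "Suc n"] by simp
  have le: "\<bar>?h k\<bar> \<le> \<bar>a (Suc k)\<bar>" for k by (simp add: abs_mult mult_right_le_one_le)
  have sh: "summable ?h"
    by (rule summable_comparison_test'[OF sa[of 0]]) (use le in simp)
  have "(\<Sum>k = 1..n. a k * cos (real k * t)) = (\<Sum>k<n. ?h k)"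
    by (rule sum.reindex_bij_witness[where i = Suc and j = "\<lambda>k. k - 1"]) auto
  then have "cos_series a t - cos_poly n a t = 2 * (\<Sum>k. ?h (k + n))"
    unfolding cos_series_def cos_poly_def using suminf_minus_initial_segment[OF sh, of n] by simp
  also have "\<bar>\<dots>\<bar> = 2 * \<bar>\<Sum>k. ?h (k + n)\<bar>" by (simp add: abs_mult)
  also have "\<dots> \<le> 2 * (\<Sum>k. \<bar>a (Suc (k + n))\<bar>)"
  proof -
    have le': "\<bar>?h (k + n)\<bar> \<le> \<bar>a (Suc (k + n))\<bar>" for k by (rule le)
    have sh': "summable (\<lambda>k. \<bar>?h (k + n)\<bar>)"
      by (rule summable_comparison_test'[OF sa[of n], of 0]) (use le' in simp)
    have "\<bar>\<Sum>k. ?h (k + n)\<bar> \<le> (\<Sum>k. \<bar>?h (k + n)\<bar>)"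
      by (rule summable_rabs[OF sh'])
    also have "\<dots> \<le> (\<Sum>k. \<bar>a (Suc (k + n))\<bar>)"
      by (rule suminf_le[OF le' sh' sa])
    finally show ?thesis by simp
  qed
  finally show ?thesis by (simp add: cos_tail_def)
qed

lemma cos_poly_tendsto:
  assumes "summable (\<lambda>k. \<bar>a k\<bar>)"
  shows "(\<lambda>n. cos_poly n a t) \<longlonglongrightarrow> cos_series a t"
proof -
  have "(\<lambda>n. cos_poly n a t - cos_series a t) \<longlonglongrightarrow> 0"
    by (rule Lim_null_comparison[OF _ cos_tail_tendsto_0[OF assms]])
      (use cos_series_minus_cos_poly[OF assms] in \<open>simp add: abs_minus_commute\<close>)
  then show ?thesis by (simp add: LIM_zero_iff)
qed

lemma bounded_kernel_cos_poly: "bounded_kernel (cos_poly n a)"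
  unfolding cos_poly_def by (intro bounded_kernel_intros)

lemma cos_poly_abs_le:
  shows "\<bar>cos_poly n a t\<bar> \<le> \<bar>a 0\<bar> + 2 * (\<Sum>k = 1..n. \<bar>a k\<bar>)"
proof -
  have "\<bar>\<Sum>k = 1..n. a k * cos (real k * t)\<bar> \<le> (\<Sum>k = 1..n. \<bar>a k\<bar>)"
    by (rule order_trans[OF sum_abs]) (intro sum_mono, simp add: abs_mult mult_right_le_one_le)
  then show ?thesis unfolding cos_poly_def by linarith
qed

lemma bounded_kernel_cos_series:
  assumes "summable (\<lambda>k. \<bar>a k\<bar>)"
  shows "bounded_kernel (cos_series a)"
proof (rule bounded_kernelI)
  show "cos_series a \<in> borel_measurable borel"
    by (rule borel_measurable_LIMSEQ_real[OF cos_poly_tendsto[OF assms]])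
      (rule bounded_kernel_measurable[OF bounded_kernel_cos_poly])
  show "\<bar>cos_series a t\<bar> \<le> \<bar>a 0\<bar> + cos_tail 0 a" for t
    using cos_series_minus_cos_poly[OF assms, of t 0] by (simp add: cos_poly_def)
qed

lemma kconv_cos_poly:
  assumes "integrable torus g"
  shows "kconv (cos_poly n a) g x = a 0 * (LINT y|torus. g y) + (\<Sum>k = 1..n. a k * (2 * cos_conv k g x))"
proof -
  have "kconv (cos_poly n a) g x = kconv (\<lambda>t. a 0) g x + kconv (\<lambda>t. 2 * (\<Sum>k = 1..n. a k * cos (real k * t))) g x"
    unfolding cos_poly_def using assms by (intro kconv_add bounded_kernel_intros)
  also have "kconv (\<lambda>t. 2 * (\<Sum>k = 1..n. a k * cos (real k * t))) g x = 2 * (\<Sum>k = 1..n. a k * cos_conv k g x)"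
    unfolding kconv_cmult using assms
    by (subst kconv_sum) (auto intro!: bounded_kernel_intros simp: kconv_cmult)
  finally show ?thesis by (simp add: kconv_def sum_distrib_left mult_ac)
qed

lemma kconv_cos_series_approx:
  assumes "summable (\<lambda>k. \<bar>a k\<bar>)" "integrable torus g"
  shows "\<bar>kconv (cos_series a) g x - kconv (cos_poly n a) g x\<bar> \<le> cos_tail n a * (LINT y|torus. \<bar>g y\<bar>)"
proof -
  have "kconv (cos_series a) g x - kconv (cos_poly n a) g x = kconv (\<lambda>t. cos_series a t - cos_poly n a t) g x"
    using kconv_add[OF bounded_kernel_cos_series[OF assms(1)] bounded_kernel_cmult[OF bounded_kernel_cos_poly, of "-1" n a] assms(2)]
      kconv_cmult[of "-1" "cos_poly n a" g x] by simp
  then show ?thesis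
    using kconv_abs_le[OF cos_series_minus_cos_poly[OF assms(1)] assms(2)] by simp
qed

text \<open>The block bound does not depend on the upper end \<open>n\<close>, and absolute
  summability makes the truncation error uniformly small, so \<open>n\<close> can tend to
  infinity.\<close>

theorem cos_series_tail_bound:
  fixes p :: real and \<mu> :: "nat \<Rightarrow> real"
  assumes p: "1 < p" and g: "Lp_fun p g"
    and A: "\<And>N. Lp_norm p (kconv (dirichlet N) g) \<le> B"
    and \<mu>0: "\<And>k. m < k \<Longrightarrow> 0 \<le> \<mu> k" and \<mu>: "\<And>k. m < k \<Longrightarrow> \<mu> (Suc k) \<le> \<mu> k"
    and sum: "summable (\<lambda>k. \<bar>\<mu> k\<bar>)"
  shows "Lp_norm p (\<lambda>x. kconv (cos_series \<mu>) g x - kconv (cos_poly m \<mu>) g x) \<le> 2 * B * \<mu> (Suc m)"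
proof -
  note gi = Lp_fun_integrable[OF p g]
  have p0: "0 \<le> p" "0 < p" using p by auto
  define T where "T = kconv (cos_series \<mu>) g"
  define P where "P = (\<lambda>n. kconv (cos_poly n \<mu>) g)"
  have LT: "Lp_fun p T" unfolding T_def by (intro Lp_fun_kconv p0 bounded_kernel_cos_series sum gi)
  have LP: "Lp_fun p (P n)" for n unfolding P_def by (intro Lp_fun_kconv p0 bounded_kernel_cos_poly gi)
  have le: "Lp_norm p (\<lambda>x. T x - P m x) \<le> cos_tail n \<mu> * (LINT y|torus. \<bar>g y\<bar>) + 2 * B * \<mu> (Suc m)" if "m \<le> n" for n
  proof -
    note [measurable] = Lp_funD[OF LT] Lp_funD[OF LP]
    have *: "P n x - P m x = (\<Sum>k\<in>{m<..n}. \<mu> k * (2 * cos_conv k g x))" for x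
    proof -
      have "{1..n} = {1..m} \<union> {m<..n}" using that by auto
      then show ?thesis unfolding P_def kconv_cos_poly[OF gi] by (simp add: sum.union_disjoint ivl_disj_int)
    qed
    have "Lp_norm p (\<lambda>x. T x - P m x) = Lp_norm p (\<lambda>x. (T x - P n x) + (P n x - P m x))" by simp
    also have "\<dots> \<le> Lp_norm p (\<lambda>x. T x - P n x) + Lp_norm p (\<lambda>x. P n x - P m x)"
      by (intro Lp_norm_triangle p Lp_fun_diff LT LP)
    also have "Lp_norm p (\<lambda>x. T x - P n x) \<le> cos_tail n \<mu> * (LINT y|torus. \<bar>g y\<bar>)"
      unfolding T_def P_def using kconv_cos_series_approx[OF sum gi] p0(2) Lp_funD[OF LT] Lp_funD[OF LP]
      by (intro Lp_norm_bounded) (auto simp: T_def P_def)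
    also have "Lp_norm p (\<lambda>x. P n x - P m x) \<le> 2 * B * \<mu> (Suc m)"
      unfolding * by (rule cos_block_bound[where \<mu> = \<mu>, OF p g A \<mu>0 \<mu>])
    finally show ?thesis by simp
  qed
  have "(\<lambda>n. cos_tail n \<mu> * (LINT y|torus. \<bar>g y\<bar>) + 2 * B * \<mu> (Suc m)) \<longlonglongrightarrow> 0 * (LINT y|torus. \<bar>g y\<bar>) + 2 * B * \<mu> (Suc m)"
    by (intro tendsto_intros cos_tail_tendsto_0 sum)
  then have "Lp_norm p (\<lambda>x. T x - P m x) \<le> 0 * (LINT y|torus. \<bar>g y\<bar>) + 2 * B * \<mu> (Suc m)"
    by (rule LIMSEQ_le_const) (use le in blast)
  then show ?thesis by (simp add: T_def P_def)
qed

subsection \<open>Periodic functions\<close>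

lemma periodic_plus_int:
  fixes f :: "real \<Rightarrow> 'a"
  assumes "\<And>x. f (x + 2 * pi) = f x"
  shows "f (x + of_int n * (2 * pi)) = f x"
proof -
  interpret periodic_fun_simple f "2 * pi" by standard (rule assms)
  show ?thesis by (rule plus_of_int)
qed

text \<open>A shift by whole periods moves \<open>c\<close> to some \<open>r\<close> in the first
  period; the part of the window beyond \<open>2 * pi\<close> is shifted back to the front.
  Half-open intervals make the cutting exact.\<close>

lemma nn_integral_period:
  fixes F :: "real \<Rightarrow> ennreal"
  assumes [measurable]: "F \<in> borel_measurable borel" and per: "\<And>x. F (x + 2 * pi) = F x"
  shows "(\<integral>\<^sup>+x\<in>{c..<c + 2 * pi}. F x \<partial>lborel) = (\<integral>\<^sup>+x\<in>{0..<2 * pi}. F x \<partial>lborel)"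
proof -
  have shift: "(\<integral>\<^sup>+x\<in>{u + of_int n * (2 * pi)..<v + of_int n * (2 * pi)}. F x \<partial>lborel) = (\<integral>\<^sup>+x\<in>{u..<v}. F x \<partial>lborel)"
    for u v n
    by (subst nn_integral_real_affine[where c = 1 and t = "of_int n * (2 * pi)"])
      (auto simp: add.commute[of "of_int n * (2 * pi)"] periodic_plus_int[where f = F, OF per] intro!: nn_integral_cong split: split_indicator)
  define n where "n = \<lfloor>c / (2 * pi)\<rfloor>"
  define r where "r = c - of_int n * (2 * pi)"
  have r: "0 \<le> r" "r < 2 * pi"
    using floor_divide_lower[of "2 * pi" c] floor_divide_upper[of "2 * pi" c] pi_gt_zero
    by (simp_all add: r_def n_def distrib_right)
  have add: "(\<integral>\<^sup>+x\<in>{u..<w}. F x \<partial>lborel) = (\<integral>\<^sup>+x\<in>{u..<v}. F x \<partial>lborel) + (\<integral>\<^sup>+x\<in>{v..<w}. F x \<partial>lborel)"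
    if "u \<le> v" "v \<le> w" for u v w
    by (subst nn_integral_add[symmetric]) (use that in \<open>auto intro!: nn_integral_cong split: split_indicator\<close>)
  have "(\<integral>\<^sup>+x\<in>{c..<c + 2 * pi}. F x \<partial>lborel) = (\<integral>\<^sup>+x\<in>{r..<r + 2 * pi}. F x \<partial>lborel)"
    using shift[of r n "r + 2 * pi"] by (simp add: r_def algebra_simps)
  also have "\<dots> = (\<integral>\<^sup>+x\<in>{r..<2 * pi}. F x \<partial>lborel) + (\<integral>\<^sup>+x\<in>{2 * pi..<r + 2 * pi}. F x \<partial>lborel)"
    using r by (intro add) auto
  also have "(\<integral>\<^sup>+x\<in>{2 * pi..<r + 2 * pi}. F x \<partial>lborel) = (\<integral>\<^sup>+x\<in>{0..<r}. F x \<partial>lborel)"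
    using shift[of 0 1 r] by simp
  also have "(\<integral>\<^sup>+x\<in>{r..<2 * pi}. F x \<partial>lborel) + (\<integral>\<^sup>+x\<in>{0..<r}. F x \<partial>lborel) = (\<integral>\<^sup>+x\<in>{0..<2 * pi}. F x \<partial>lborel)"
    using r by (subst add.commute, intro add[symmetric]) auto
  finally show ?thesis .
qed

lemma nn_integral_torus_reflect:
  fixes F :: "real \<Rightarrow> ennreal"
  assumes [measurable]: "F \<in> borel_measurable borel" and per: "\<And>x. F (x + 2 * pi) = F x"
  shows "(\<integral>\<^sup>+y. F (a - y) \<partial>torus) = (\<integral>\<^sup>+y. F y \<partial>torus)"
proof -
  have half_open: "(\<integral>\<^sup>+x\<in>{0..2 * pi}. G x \<partial>lborel) = (\<integral>\<^sup>+x\<in>{0..<2 * pi}. G x \<partial>lborel)" for G :: "real \<Rightarrow> ennreal"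
    by (rule nn_integral_cong_AE, use AE_lborel_singleton[of "2 * pi"] in eventually_elim)
      (auto split: split_indicator)
  have "(\<integral>\<^sup>+y\<in>{0..2 * pi}. F (a - y) \<partial>lborel) = (\<integral>\<^sup>+x\<in>{a - 2 * pi..a}. F x \<partial>lborel)"
    by (subst (2) nn_integral_real_affine[where c = "-1" and t = a])
      (auto intro!: nn_integral_cong split: split_indicator)
  also have "\<dots> = (\<integral>\<^sup>+x\<in>{a - 2 * pi..<a - 2 * pi + 2 * pi}. F x \<partial>lborel)"
    by (rule nn_integral_cong_AE, use AE_lborel_singleton[of a] in eventually_elim)
      (auto split: split_indicator)
  also have "\<dots> = (\<integral>\<^sup>+x\<in>{0..2 * pi}. F x \<partial>lborel)"
    unfolding half_open by (rule nn_integral_period[OF assms])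
  finally show ?thesis by (simp add: nn_integral_torus)
qed

text \<open>Equality is proved for the image measures on one period, so integrable and nonintegrable
  \<open>G\<close> are treated alike.\<close>

lemma integral_torus_reflect:
  fixes G :: "real \<Rightarrow> real"
  assumes [measurable]: "G \<in> borel_measurable borel" and per: "\<And>x. G (x + 2 * pi) = G x"
  shows "(LINT y|torus. G (a - y)) = (LINT y|torus. G y)"
proof -
  \<comment> \<open>\<open>\<tau>\<close> reduces modulo \<open>2 * pi\<close>. Composed with it,
    every indicator becomes periodic, and the version for nonnegative functions applies.\<close>
  define \<tau> where "\<tau> = (\<lambda>x::real. x + of_int (- \<lfloor>x / (2 * pi)\<rfloor>) * (2 * pi))"
  have \<tau>m [measurable]: "\<tau> \<in> borel_measurable borel" unfolding \<tau>_def by measurable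
  have \<tau>per: "\<tau> (x + 2 * pi) = \<tau> x" for x
    by (simp add: \<tau>_def add_divide_distrib algebra_simps)
  have G\<tau>: "G (\<tau> x) = G x" for x unfolding \<tau>_def by (rule periodic_plus_int[where f = G, OF per])
  have eq: "distr torus borel (\<lambda>y. \<tau> (a - y)) = distr torus borel \<tau>"
  proof (rule measure_eqI)
    fix A assume "A \<in> sets (distr torus borel (\<lambda>y. \<tau> (a - y)))"
    then have [measurable]: "A \<in> sets borel" by simp
    have "emeasure (distr torus borel (\<lambda>y. \<tau> (a - y))) A = (\<integral>\<^sup>+y. indicator A (\<tau> (a - y)) \<partial>torus)"
      by (subst nn_integral_indicator[symmetric], simp, subst nn_integral_distr) auto
    also have "\<dots> = (\<integral>\<^sup>+y. indicator A (\<tau> y) \<partial>torus)"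
      by (rule nn_integral_torus_reflect) (auto simp: \<tau>per)
    also have "\<dots> = emeasure (distr torus borel \<tau>) A"
      by (subst nn_integral_indicator[symmetric], simp, subst nn_integral_distr) auto
    finally show "emeasure (distr torus borel (\<lambda>y. \<tau> (a - y))) A = emeasure (distr torus borel \<tau>) A" .
  qed simp
  have 1: "(LINT x|distr torus borel (\<lambda>y. \<tau> (a - y)). G x) = (LINT y|torus. G (a - y))"
    "(LINT x|distr torus borel \<tau>. G x) = (LINT y|torus. G y)"
    by (subst integral_distr; simp add: G\<tau>)+
  show "(LINT y|torus. G (a - y)) = (LINT y|torus. G y)"
    using 1 eq by simp
qed

lemma AE_torus_reflect:
  assumes [measurable]: "Measurable.pred borel P" and per: "\<And>x. P (x + 2 * pi) = P x"
    and ae: "AE x in torus. P x"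
  shows "AE x in torus. P (a - x)"
proof -
  have "(\<integral>\<^sup>+y. indicator {x. \<not> P x} (a - y) \<partial>torus) = (\<integral>\<^sup>+y. indicator {x. \<not> P x} y \<partial>torus)"
    by (rule nn_integral_torus_reflect) (auto simp: per indicator_def)
  also have "\<dots> = 0"
    using ae by (subst nn_integral_0_iff_AE) (auto simp: indicator_def)
  finally show ?thesis
    by (subst (asm) nn_integral_0_iff_AE) (auto simp: indicator_def)
qed

text \<open>Two reflections compose to a translation.\<close>

lemma AE_torus_shift:
  assumes P [measurable]: "Measurable.pred borel P" and per: "\<And>x. P (x + 2 * pi) = P x"
    and ae: "AE x in torus. P x"
  shows "AE x in torus. P (x - s)"
proof -
  have "P (- (x + 2 * pi)) = P (- x)" for x
    using per[of "- x - 2 * pi"] by simp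
  moreover have "AE x in torus. P (- x)"
    using AE_torus_reflect[OF assms, of 0] by simp
  ultimately have "AE x in torus. P (- (s - x))"
    by (intro AE_torus_reflect) auto
  then show ?thesis by simp
qed

lemma torus_conv_eq_integral:
  assumes [measurable]: "f \<in> borel_measurable borel" "g \<in> borel_measurable borel"
  shows "torus_conv f g x = (LINT y|torus. f y * g (x - y))"
  by (simp add: torus_conv_def integral_torus field_simps)

text \<open>The substitution of \<open>x - y\<close> for \<open>y\<close>; periodicity of both
  factors makes it a reflection of the torus.\<close>

lemma torus_conv_eq_kconv:
  assumes [measurable]: "f \<in> borel_measurable borel" "g \<in> borel_measurable borel"
    and "\<And>x. f (x + 2 * pi) = f x" "\<And>x. g (x + 2 * pi) = g x"
  shows "torus_conv f g x = kconv f g x"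
proof -
  have "f (x - (y + 2 * pi)) = f (x - y)" for y
    using assms(3)[of "x - y - 2 * pi"] by (simp add: algebra_simps)
  then have "(LINT y|torus. f (x - (x - y)) * g (x - y)) = (LINT y|torus. f (x - y) * g y)"
    using assms(4) by (intro integral_torus_reflect) auto
  then show ?thesis by (simp add: torus_conv_eq_integral kconv_def)
qed

subsection \<open>Uniqueness of Fourier series\<close>

text \<open>Differentiation preserves the class: a linear \<open>f\<close> composed with
  \<open>cis\<close> has derivative \<open>f (\<i> * cis x)\<close>, linear in \<open>cis x\<close>
  again, and sums and products follow by the usual rules.\<close>

lemma real_polynomial_function_cis_deriv:
  fixes p :: "complex \<Rightarrow> real"
  assumes "real_polynomial_function p"
  obtains q where "real_polynomial_function q"
    "\<And>x. ((\<lambda>x. p (cis x)) has_field_derivative q (cis x)) (at x)"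
proof -
  have "\<exists>q. real_polynomial_function q \<and> (\<forall>x. ((\<lambda>x. p (cis x)) has_field_derivative q (cis x)) (at x))"
    using assms
  proof (induction rule: real_polynomial_function.induct)
    case (linear f)
    note f = linear
    interpret bounded_linear f by (rule f)
    have "bounded_linear (\<lambda>z. f (\<i> * z))"
      by (rule bounded_linear_compose[OF f bounded_linear_mult_right])
    moreover have "((\<lambda>x. f (cis x)) has_vector_derivative f (\<i> * cis x)) (at x)" for x
    proof -
      have "(cis has_vector_derivative \<i> * cis x) (at x)"
        using has_derivative_cis[OF has_derivative_ident, of x UNIV]
        by (simp add: has_vector_derivative_def)
      then show ?thesis by (rule has_vector_derivative)
    qed
    ultimately show ?case
      by (auto simp: has_real_derivative_iff_has_vector_derivative)
  next
    case (const c)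
    show ?case by (rule exI[of _ "\<lambda>_. 0"]) auto
  next
    case (add f g)
    then obtain f' g' where "real_polynomial_function f'" "real_polynomial_function g'"
      "\<And>x. ((\<lambda>x. f (cis x)) has_field_derivative f' (cis x)) (at x)"
      "\<And>x. ((\<lambda>x. g (cis x)) has_field_derivative g' (cis x)) (at x)" by blast
    then show ?case
      by (intro exI[of _ "\<lambda>z. f' z + g' z"]) (auto intro!: derivative_intros)
  next
    case (mult f g)
    then obtain f' g' where "real_polynomial_function f'" "real_polynomial_function g'"
      "\<And>x. ((\<lambda>x. f (cis x)) has_field_derivative f' (cis x)) (at x)"
      "\<And>x. ((\<lambda>x. g (cis x)) has_field_derivative g' (cis x)) (at x)" by blast
    with mult show ?case
      by (intro exI[of _ "\<lambda>z. f' z * g z + g' z * f z"]) (auto intro!: DERIV_mult)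
  qed
  then show thesis using that by blast
qed

text \<open>Iterated derivatives stay polynomial in \<open>cis x\<close>. These are the test
  functions fed to the distributional hypothesis, rich enough for Stone-Weierstrass.\<close>

lemma torus_test_function_polynomial:
  fixes p :: "complex \<Rightarrow> real"
  assumes "real_polynomial_function p"
  shows "torus_test_function (\<lambda>x. p (cis x))"
proof -
  have iter: "\<exists>q. real_polynomial_function q \<and> (deriv ^^ n) (\<lambda>x. p (cis x)) = (\<lambda>x. q (cis x))" for n
  proof (induction n)
    case 0
    then show ?case using assms by auto
  next
    case (Suc n)
    then obtain q where q: "real_polynomial_function q" "(deriv ^^ n) (\<lambda>x. p (cis x)) = (\<lambda>x. q (cis x))" by blast
    obtain q' where "real_polynomial_function q'"
      "\<And>x. ((\<lambda>x. q (cis x)) has_field_derivative q' (cis x)) (at x)"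
      using real_polynomial_function_cis_deriv[OF q(1)] by blast
    then show ?case using q(2) by (auto intro!: exI[of _ q'] DERIV_imp_deriv)
  qed
  have diff: "(deriv ^^ n) (\<lambda>x. p (cis x)) field_differentiable at x" for n x
  proof -
    obtain q where q: "real_polynomial_function q" "(deriv ^^ n) (\<lambda>x. p (cis x)) = (\<lambda>x. q (cis x))"
      using iter by blast
    obtain q' where "((\<lambda>x. q (cis x)) has_field_derivative q' (cis x)) (at x)"
      using real_polynomial_function_cis_deriv[OF q(1)] by blast
    then show ?thesis unfolding q(2) by (auto simp: field_differentiable_def)
  qed
  have "cis (x + 2 * pi) = cis x" for x by (simp add: complex_eq_iff)
  then have per: "p (cis (x + 2 * pi)) = p (cis x)" for x by simp
  show ?thesis unfolding torus_test_function_def by (intro conjI allI per diff)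
qed

lemma integral_continuous_cis_eq_0:
  fixes H :: "complex \<Rightarrow> real"
  assumes \<psi>: "integrable torus \<psi>"
    and orth: "\<And>p :: complex \<Rightarrow> real. real_polynomial_function p \<Longrightarrow> (LINT x|torus. p (cis x) * \<psi> x) = 0"
    and H: "continuous_on (sphere 0 1) H"
  shows "(LINT x|torus. H (cis x) * \<psi> x) = 0"
proof (rule ccontr)
  assume ne: "(LINT x|torus. H (cis x) * \<psi> x) \<noteq> 0"
  \<comment> \<open>Small enough that the approximation error stays below the supposedly nonzero
    integral; the summand \<open>1\<close> keeps the denominator positive.\<close>
  define e where "e = \<bar>LINT x|torus. H (cis x) * \<psi> x\<bar> / (2 * ((LINT x|torus. \<bar>\<psi> x\<bar>) + 1))"
  have pos: "0 \<le> (LINT x|torus. \<bar>\<psi> x\<bar>)" by simp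
  have e: "0 < e" using ne pos by (simp add: e_def add_nonneg_pos)
  obtain p where p: "real_polynomial_function p" and pH: "\<And>z. z \<in> sphere 0 1 \<Longrightarrow> \<bar>H z - p z\<bar> < e"
    using Stone_Weierstrass_real_polynomial_function[OF compact_sphere H e] by metis
  have cont: "continuous_on UNIV (\<lambda>x. K (cis x))" if "continuous_on (sphere 0 1) K" for K :: "complex \<Rightarrow> real"
    by (rule continuous_on_compose2[OF that]) (auto intro!: continuous_intros)
  have contp: "continuous_on (sphere 0 1) p"
    using continuous_on_polymonial_function[of p] p by (simp add: real_polynomial_function_eq)
  have int: "integrable torus (\<lambda>x. K (cis x) * \<psi> x)" if K: "continuous_on (sphere 0 1) K" for K :: "complex \<Rightarrow> real"
  proof -
    have "bounded (K ` sphere 0 1)" by (intro compact_imp_bounded compact_continuous_image K compact_sphere)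
    then obtain B where "\<forall>z\<in>sphere 0 1. norm (K z) \<le> B" unfolding bounded_iff by blast
    then have "\<bar>K (cis x)\<bar> \<le> B" for x by simp
    then show ?thesis
      by (intro integrable_torus_bounded_mult[OF \<psi>] borel_measurable_continuous_onI cont K)
  qed
  have "\<bar>LINT x|torus. H (cis x) * \<psi> x\<bar> = \<bar>LINT x|torus. (H (cis x) - p (cis x)) * \<psi> x\<bar>"
    using int[OF H] int[OF contp] orth[OF p] by (simp add: left_diff_distrib)
  also have "\<dots> \<le> (LINT x|torus. \<bar>(H (cis x) - p (cis x)) * \<psi> x\<bar>)" by (rule integral_abs_bound)
  also have "\<dots> \<le> (LINT x|torus. e * \<bar>\<psi> x\<bar>)"
  proof (rule integral_mono)
    show "integrable torus (\<lambda>x. \<bar>(H (cis x) - p (cis x)) * \<psi> x\<bar>)"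
      using int[OF H] int[OF contp] by (simp add: left_diff_distrib)
    show "\<bar>(H (cis x) - p (cis x)) * \<psi> x\<bar> \<le> e * \<bar>\<psi> x\<bar>" for x
      using pH[of "cis x"] by (auto simp: abs_mult intro!: mult_right_mono)
  qed (use \<psi> in simp)
  also have "\<dots> = e * (LINT x|torus. \<bar>\<psi> x\<bar>)" by simp
  also have "\<dots> < 2 * e * ((LINT x|torus. \<bar>\<psi> x\<bar>) + 1)"
  proof -
    have "0 \<le> e * (LINT x|torus. \<bar>\<psi> x\<bar>)" using e pos by (intro mult_nonneg_nonneg) auto
    then show ?thesis using e by (simp add: distrib_left add_nonneg_pos)
  qed
  also have "\<dots> = \<bar>LINT x|torus. H (cis x) * \<psi> x\<bar>"
  proof -
    have "2 * ((LINT x|torus. \<bar>\<psi> x\<bar>) + 1) \<noteq> 0" using add_nonneg_pos[OF pos zero_less_one] by (intro no_zero_divisors) auto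
    from nonzero_eq_divide_eq[OF this] e_def show ?thesis by (simp only: mult_ac)
  qed
  finally show False by simp
qed

text \<open>An arc is a superlevel set of the cosine; the bound on \<open>\<bar>y\<bar>\<close>
  excludes the next periodic copy of the arc.\<close>

lemma cos_less_cos_arc:
  fixes y r :: real
  assumes "0 < r" "r \<le> pi" "\<bar>y\<bar> \<le> 2 * pi - r"
  shows "cos r < cos y \<longleftrightarrow> \<bar>y\<bar> < r"
proof (cases "\<bar>y\<bar> \<le> pi")
  case True
  have "cos y = cos \<bar>y\<bar>" by (simp add: abs_if)
  moreover have "cos r < cos \<bar>y\<bar> \<longleftrightarrow> \<bar>y\<bar> < r"
    using cos_mono_less_eq[of r "\<bar>y\<bar>"] True assms by auto
  ultimately show ?thesis by simp
next
  case False
  have "cos y = cos (2 * pi - \<bar>y\<bar>)" by (simp add: abs_if cos_diff)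
  also have "\<dots> \<le> cos r" using False assms by (intro cos_monotone_0_pi_le) auto
  finally show ?thesis using False assms by auto
qed

lemma AE_torus_Ioo: "AE x in torus. x \<in> {0<..<2 * pi}"
proof -
  have "AE x in lborel. 0 < ennreal (indicator {0..2 * pi} x / (2 * pi)) \<longrightarrow> x \<in> {0<..<2 * pi}"
    using AE_lborel_singleton[of 0] AE_lborel_singleton[of "2 * pi"]
    by eventually_elim (auto split: split_indicator)
  then show ?thesis
    unfolding torus_def by (subst AE_density) auto
qed

text \<open>The indicator of the arc is a bounded pointwise limit of continuous functions on the
  circle, for which the integral vanishes already.\<close>

lemma integral_arc_eq_0:
  assumes \<psi>: "integrable torus \<psi>"
    and orth: "\<And>p :: complex \<Rightarrow> real. real_polynomial_function p \<Longrightarrow> (LINT x|torus. p (cis x) * \<psi> x) = 0"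
    and ab: "0 \<le> a" "a < b" "b \<le> 2 * pi"
  shows "(LINT x|torus. indicator {a<..<b} x * \<psi> x) = 0"
proof -
  define c where "c = (a + b) / 2"
  define r where "r = (b - a) / 2"
  have r: "0 < r" "r \<le> pi" using ab by (auto simp: r_def)
  \<comment> \<open>Ever steeper ramps in \<open>cos (x - c) - cos r\<close>, where \<open>c\<close>
    and \<open>r\<close> are centre and radius of the arc; at \<open>z = cis x\<close> the real part
    is \<open>cos (x - c)\<close>.\<close>
  define H where "H = (\<lambda>n z. min 1 (max 0 (real n * (Re (z * cis (- c)) - cos r))))"
  have H0: "(LINT x|torus. H n (cis x) * \<psi> x) = 0" for n
    unfolding H_def by (rule integral_continuous_cis_eq_0[OF \<psi> orth]) (auto intro!: continuous_intros)
  have Hc: "H n (cis x) = min 1 (max 0 (real n * (cos (x - c) - cos r)))" for n x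
    by (simp add: H_def cos_diff)
  have [measurable]: "\<psi> \<in> borel_measurable borel" using borel_measurable_integrable[OF \<psi>] by simp
  have lim: "(\<lambda>n. H n (cis x)) \<longlonglongrightarrow> (if cos r < cos (x - c) then 1 else 0)" for x
  proof (cases "cos r < cos (x - c)")
    case True
    then obtain N where N: "1 / (cos (x - c) - cos r) < real N" using reals_Archimedean2 by blast
    have "H n (cis x) = 1" if "N \<le> n" for n
    proof -
      have "1 / (cos (x - c) - cos r) \<le> real n" using N that by linarith
      then have "1 \<le> real n * (cos (x - c) - cos r)" using True by (simp add: field_simps)
      then show ?thesis by (simp add: Hc)
    qed
    then have "eventually (\<lambda>n. H n (cis x) = 1) sequentially" by (auto simp: eventually_sequentially)
    then show ?thesis using True by (simp add: tendsto_eventually)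
  next
    case False
    then have "real n * (cos (x - c) - cos r) \<le> 0" for n by (simp add: mult_nonneg_nonpos)
    then have "H n (cis x) = 0" for n by (simp add: Hc max_absorb1)
    then show ?thesis using False by simp
  qed
  have "(\<lambda>n. LINT x|torus. H n (cis x) * \<psi> x) \<longlonglongrightarrow> (LINT x|torus. (if cos r < cos (x - c) then 1 else 0) * \<psi> x)"
  proof (rule integral_dominated_convergence[where w = "\<lambda>x. \<bar>\<psi> x\<bar>"])
    show "AE x in torus. (\<lambda>n. H n (cis x) * \<psi> x) \<longlonglongrightarrow> (if cos r < cos (x - c) then 1 else 0) * \<psi> x"
      by (intro AE_I2 tendsto_intros lim)
    show "AE x in torus. norm (H n (cis x) * \<psi> x) \<le> \<bar>\<psi> x\<bar>" for n
      by (intro AE_I2) (auto simp: abs_mult H_def intro!: mult_left_le_one_le)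
    show "(\<lambda>x. H n (cis x) * \<psi> x) \<in> borel_measurable torus" for n unfolding Hc by measurable
  qed (use \<psi> in auto)
  then have "(LINT x|torus. (if cos r < cos (x - c) then 1 else 0) * \<psi> x) = 0"
    using H0 LIMSEQ_unique[of "\<lambda>n. 0::real"] by simp
  moreover have "(LINT x|torus. (if cos r < cos (x - c) then 1 else 0) * \<psi> x) = (LINT x|torus. indicator {a<..<b} x * \<psi> x)"
  proof (rule integral_cong_AE)
    have arc: "(if cos r < cos (x - c) then 1 else 0) = (indicator {a<..<b} x :: real)" if "x \<in> {0..2 * pi}" for x
    proof -
      have "\<bar>x - c\<bar> \<le> 2 * pi - r" using that ab by (auto simp: c_def r_def abs_le_iff field_simps)
      then have "cos r < cos (x - c) \<longleftrightarrow> \<bar>x - c\<bar> < r" by (rule cos_less_cos_arc[OF r])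
      also have "\<dots> \<longleftrightarrow> x \<in> {a<..<b}" by (auto simp: c_def r_def abs_less_iff field_simps)
      finally show ?thesis by (simp add: indicator_def)
    qed
    show "AE x in torus. (if cos r < cos (x - c) then 1 else 0) * \<psi> x = indicator {a<..<b} x * \<psi> x"
      using AE_torus_Ioo by eventually_elim (subst arc, auto)
  qed auto
  ultimately show ?thesis by simp
qed

text \<open>The positive and negative parts of \<open>\<psi>\<close> are densities of finite
  measures that agree on all rays, hence everywhere. Equal densities force the two parts to
  coincide, and they are never positive at the same point.\<close>

theorem trigonometric_uniqueness:
  assumes \<psi>: "integrable torus \<psi>"
    and orth: "\<And>p :: complex \<Rightarrow> real. real_polynomial_function p \<Longrightarrow> (LINT x|torus. p (cis x) * \<psi> x) = 0"
  shows "AE x in torus. \<psi> x = 0"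
proof -
  have m [measurable]: "\<psi> \<in> borel_measurable borel" using borel_measurable_integrable[OF \<psi>] by simp
  have ray: "(LINT x|torus. indicator {t<..} x * \<psi> x) = 0" for t
  proof -
    define s where "s = max 0 t"
    have "(LINT x|torus. indicator {t<..} x * \<psi> x) = (LINT x|torus. indicator {s<..<2 * pi} x * \<psi> x)"
    proof (rule integral_cong_AE)
      show "AE x in torus. indicator {t<..} x * \<psi> x = indicator {s<..<2 * pi} x * \<psi> x"
        using AE_torus_Ioo by eventually_elim (auto simp: s_def split: split_indicator)
    qed auto
    also have "\<dots> = 0"
      using integral_arc_eq_0[OF \<psi> orth, of s "2 * pi"]
      by (cases "s < 2 * pi") (auto simp: s_def)
    finally show ?thesis .
  qed
  let ?P = "density torus (\<lambda>x. ennreal (max 0 (\<psi> x)))" and ?N = "density torus (\<lambda>x. ennreal (max 0 (- \<psi> x)))"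
  have em: "emeasure (density torus (\<lambda>x. ennreal (h x))) {t<..} = ennreal (LINT x|torus. indicator {t<..} x * h x)"
    if h: "integrable torus h" "\<And>x. 0 \<le> h x" for h t
  proof -
    have [measurable]: "h \<in> borel_measurable borel" using borel_measurable_integrable[OF h(1)] by simp
    have "emeasure (density torus (\<lambda>x. ennreal (h x))) {t<..} = (\<integral>\<^sup>+x. ennreal (indicator {t<..} x * h x) \<partial>torus)"
      by (subst emeasure_density) (auto intro!: nn_integral_cong split: split_indicator)
    also have "\<dots> = ennreal (LINT x|torus. indicator {t<..} x * h x)"
      using h by (intro nn_integral_eq_integral integrable_torus_bounded_mult[OF h(1), where B = 1]) (auto simp: indicator_def)
    finally show ?thesis .
  qed
  have ip: "integrable torus (\<lambda>x. max 0 (\<psi> x))" "integrable torus (\<lambda>x. max 0 (- \<psi> x))"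
    using \<psi> by (auto intro!: integrable_max)
  have ii: "integrable torus (\<lambda>x. indicator {t<..} x * h x)" if "integrable torus h" for h :: "real \<Rightarrow> real" and t
    by (rule integrable_torus_bounded_mult[OF that, where B = 1]) (auto simp: indicator_def)
  have "?P = ?N"
  proof (rule measure_eqI_lessThan)
    fix t
    show "emeasure ?P {t<..} < \<infinity>" by (subst em[OF ip(1)]) auto
    have "(LINT x|torus. indicator {t<..} x * max 0 (\<psi> x)) - (LINT x|torus. indicator {t<..} x * max 0 (- \<psi> x))
        = (LINT x|torus. indicator {t<..} x * \<psi> x)"
      unfolding Bochner_Integration.integral_diff[OF ii[OF ip(1)] ii[OF ip(2)], symmetric]
      by (intro Bochner_Integration.integral_cong) (auto simp: max_def split: split_indicator)
    then show "emeasure ?P {t<..} = emeasure ?N {t<..}"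
      by (simp add: em[OF ip(1)] em[OF ip(2)] ray)
  qed auto
  then have "AE x in torus. ennreal (max 0 (\<psi> x)) = ennreal (max 0 (- \<psi> x))"
    by (subst (asm) torus.density_unique_iff) auto
  then show ?thesis
    by eventually_elim (auto simp: max_def split: if_splits)
qed

section \<open>From the distributional series to its pointwise sum\<close>

lemma sum_int_symmetric:
  fixes h :: "int \<Rightarrow> 'a::comm_semiring_1"
  shows "(\<Sum>k = - int n..int n. h k) = h 0 + (\<Sum>k = 1..n. h (int k) + h (- int k))"
proof (induction n)
  case (Suc n)
  have "{- int (Suc n)..int (Suc n)} = insert (int (Suc n)) (insert (- int (Suc n)) {- int n..int n})"
    by auto
  then show ?case using Suc by (simp add: algebra_simps)
qed simp

lemma exponential_sum_eq_cos_poly: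
  assumes even: "\<And>k. a (- k) = a k"
  shows "(\<Sum>k = - int n..int n. of_real (a k) * cis (of_int k * x)) = of_real (cos_poly n (\<lambda>k. a (int k)) x)"
proof -
  have "of_real (a (int k)) * cis (of_int (int k) * x) + of_real (a (- int k)) * cis (of_int (- int k) * x)
      = of_real (2 * (a (int k) * cos (real k * x)))" for k
    by (simp add: even complex_eq_iff)
  then show ?thesis
    unfolding sum_int_symmetric cos_poly_def by (simp add: sum_distrib_left)
qed

text \<open>Paired with a trigonometric polynomial, the partial sums tend to the pairing with
  \<open>\<phi>\<close> by hypothesis and to that with the cosine series by dominated convergence,
  so the difference is orthogonal to all such polynomials.\<close>

theorem fourier_series_eq_cos_series:
  fixes a :: "int \<Rightarrow> real"
  assumes even: "\<And>k. a (- k) = a k" and sum: "summable (\<lambda>k. \<bar>a (int k)\<bar>)"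
    and \<phi>: "integrable torus \<phi>" and fs: "distributional_fourier_series a \<phi>"
  shows "AE x in torus. \<phi> x = cos_series (\<lambda>k. a (int k)) x"
proof -
  let ?a = "\<lambda>k. a (int k)"
  have [measurable]: "\<phi> \<in> borel_measurable borel" "cos_series ?a \<in> borel_measurable borel"
      "cos_poly n ?a \<in> borel_measurable borel" for n
    using borel_measurable_integrable[OF \<phi>] bounded_kernel_measurable[OF bounded_kernel_cos_series[OF sum]]
      bounded_kernel_measurable[OF bounded_kernel_cos_poly] by simp_all
  obtain B where B: "\<And>t. \<bar>cos_series ?a t\<bar> \<le> B"
    using bounded_kernel_cos_series[OF sum] by (auto simp: bounded_kernel_def)
  \<comment> \<open>A common bound for all tails makes \<open>B + D\<close> bound every partial sum,
    as the dominating function requires.\<close>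
  obtain D where D: "\<And>n. cos_tail n ?a \<le> D"
  proof -
    have "Bseq (\<lambda>n. cos_tail n ?a)"
      using cos_tail_tendsto_0[OF sum] by (intro convergent_imp_Bseq convergentI)
    then obtain K where "\<And>n. norm (cos_tail n ?a) \<le> K" by (auto simp: Bseq_def)
    then have "\<bar>cos_tail n ?a\<bar> \<le> K" for n by simp
    then show thesis by (intro that[of K]) (auto dest: abs_le_D1)
  qed
  have ci: "integrable torus (cos_series ?a)"
    by (rule integrable_torus_bounded[OF _ B]) measurable
  have "AE x in torus. \<phi> x - cos_series ?a x = 0"
  proof (rule trigonometric_uniqueness)
    show "integrable torus (\<lambda>x. \<phi> x - cos_series ?a x)" using \<phi> ci by simp
    fix p :: "complex \<Rightarrow> real" assume p: "real_polynomial_function p"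
    define h where "h = (\<lambda>x. p (cis x))"
    have contp: "continuous_on (sphere 0 1) p"
      using continuous_on_polymonial_function[of p] p by (simp add: real_polynomial_function_eq)
    have hm [measurable]: "h \<in> borel_measurable borel"
      unfolding h_def
      by (intro borel_measurable_continuous_onI continuous_on_compose2[OF contp]) (auto intro!: continuous_intros)
    have "bounded (p ` sphere 0 1)" by (intro compact_imp_bounded compact_continuous_image contp compact_sphere)
    then obtain C where "\<forall>z\<in>sphere 0 1. norm (p z) \<le> C" unfolding bounded_iff by blast
    then have C: "\<bar>h x\<bar> \<le> C" for x by (simp add: h_def)
    have hi: "integrable torus h" by (rule integrable_torus_bounded[OF hm C])
    have "(\<lambda>n. LBINT x:{0..2 * pi}. (\<Sum>k = - int n..int n. of_real (a k) * cis (of_int k * x)) * of_real (h x))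
        \<longlonglongrightarrow> complex_of_real (LBINT x:{0..2 * pi}. \<phi> x * h x)"
      using fs torus_test_function_polynomial[OF p] unfolding distributional_fourier_series_def h_def by blast
    then have "(\<lambda>n. LBINT x:{0..2 * pi}. cos_poly n ?a x * h x) \<longlonglongrightarrow> (LBINT x:{0..2 * pi}. \<phi> x * h x)"
      unfolding exponential_sum_eq_cos_poly[of a, OF even] of_real_mult[symmetric] set_integral_complex_of_real
      by (simp only: tendsto_of_real_iff)
    from tendsto_scaleR[OF tendsto_const this, of "inverse (2 * pi)"]
    have "(\<lambda>n. LINT x|torus. cos_poly n ?a x * h x) \<longlonglongrightarrow> (LINT x|torus. \<phi> x * h x)"
      by (simp add: integral_torus)
    moreover have "(\<lambda>n. LINT x|torus. cos_poly n ?a x * h x) \<longlonglongrightarrow> (LINT x|torus. cos_series ?a x * h x)"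
    proof (rule integral_dominated_convergence[where w = "\<lambda>x. (B + D) * \<bar>h x\<bar>"])
      show "AE x in torus. (\<lambda>n. cos_poly n ?a x * h x) \<longlonglongrightarrow> cos_series ?a x * h x"
        by (intro AE_I2 tendsto_intros cos_poly_tendsto sum)
      show "integrable torus (\<lambda>x. (B + D) * \<bar>h x\<bar>)"
        using hi by simp
      have "\<bar>cos_poly n ?a x\<bar> \<le> B + D" for n x
        using cos_series_minus_cos_poly[OF sum, of x n] B[of x] D[of n] by linarith
      then show "AE x in torus. norm (cos_poly n ?a x * h x) \<le> (B + D) * \<bar>h x\<bar>" for n
        by (intro AE_I2) (simp add: abs_mult mult_right_mono)
    qed measurable
    ultimately have "(LINT x|torus. \<phi> x * h x) = (LINT x|torus. cos_series ?a x * h x)"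
      by (rule LIMSEQ_unique)
    moreover have "integrable torus (\<lambda>x. h x * \<phi> x)" "integrable torus (\<lambda>x. h x * cos_series ?a x)"
      by (rule integrable_torus_bounded_mult[OF \<phi> hm C] integrable_torus_bounded_mult[OF ci hm C])+
    ultimately show "(LINT x|torus. p (cis x) * (\<phi> x - cos_series ?a x)) = 0"
      by (simp add: h_def right_diff_distrib mult.commute)
  qed
  then show ?thesis by simp
qed

lemma cos_poly_periodic: "cos_poly n a (x + 2 * pi) = cos_poly n a x"
proof -
  have "cos (real k * (x + 2 * pi)) = cos (real k * x)" for k
    using cos.plus_of_nat[of "real k * x" k] by (simp add: algebra_simps)
  then show ?thesis by (simp add: cos_poly_def)
qed

lemma cos_series_periodic: "cos_series a (x + 2 * pi) = cos_series a x"
proof -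
  have "cos (real k * (x + 2 * pi)) = cos (real k * x)" for k
    using cos.plus_of_nat[of "real k * x" k] by (simp add: algebra_simps)
  then show ?thesis unfolding cos_series_def by presburger
qed

subsection \<open>Sampling\<close>

text \<open>A geometric sum whose ratio is a root of unity of order dividing
  \<open>2 * m + 1\<close>, different from \<open>1\<close> because its angle lies strictly between
  \<open>0\<close> and \<open>2 * pi\<close>.\<close>

lemma sum_cis_mesh:
  assumes r: "1 \<le> r" "r \<le> 2 * m"
  shows "(\<Sum>l = 0..2 * m. cis (real r * (mesh m * real l))) = 0"
proof -
  define t where "t = real r * mesh m"
  have N: "real (Suc (2 * m)) * mesh m = 2 * pi"
    by (simp add: mesh_def field_simps)
  have t: "0 < t" "t < 2 * pi"
  proof -
    have "mesh m > 0" by (simp add: mesh_def add_pos_nonneg)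
    then show "0 < t" using r by (simp add: t_def)
    have "t < real (Suc (2 * m)) * mesh m" unfolding t_def using r \<open>mesh m > 0\<close>
      by (intro mult_strict_right_mono) auto
    then show "t < 2 * pi" using N by simp
  qed
  have "cis t \<noteq> 1"
  proof
    assume "cis t = 1"
    then have "cos t = 1" by (metis cis.simps(1) one_complex.simps(1))
    moreover have "cos t = 1 - 2 * (sin (t / 2))\<^sup>2"
      using cos_double_sin[of "t / 2"] by simp
    moreover have "0 < sin (t / 2)" using t by (intro sin_gt_zero) auto
    ultimately show False by simp
  qed
  moreover have "cis t ^ Suc (2 * m) = 1"
  proof -
    have "real (Suc (2 * m)) * t = 2 * pi * real r" using N by (simp add: t_def)
    then have "cis t ^ Suc (2 * m) = cis (2 * pi * real r)" by (simp only: Complex.DeMoivre)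
    also have "\<dots> = 1" by (rule cis_multiple_2pi) simp
    finally show ?thesis .
  qed
  moreover have "(\<Sum>l = 0..2 * m. cis (real r * (mesh m * real l))) = (\<Sum>l<Suc (2 * m). cis t ^ l)"
    unfolding lessThan_Suc_atMost atMost_atLeast0 by (intro sum.cong) (simp_all add: Complex.DeMoivre t_def mult_ac)
  ultimately show ?thesis by (simp only: sum_gp_strict) simp
qed

lemma sum_cos_sin_mesh:
  assumes r: "1 \<le> r" "r \<le> 2 * m"
  shows "(\<Sum>l = 0..2 * m. cos (real r * (mesh m * real l))) = 0"
    and "(\<Sum>l = 0..2 * m. sin (real r * (mesh m * real l))) = 0"
  using arg_cong[OF sum_cis_mesh[OF r], of Re] arg_cong[OF sum_cis_mesh[OF r], of Im] by simp_all

text \<open>Products become sums of the frequencies \<open>j + k\<close> and \<open>j - k\<close>,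
  of modulus at most \<open>2 * m\<close> and so below the number of nodes; only frequency
  \<open>0\<close> survives.\<close>

lemma mesh_orthogonality:
  fixes m :: nat
  defines "c \<equiv> \<lambda>j l. cos (real j * (mesh m * real l))" and "s \<equiv> \<lambda>j l. sin (real j * (mesh m * real l))"
  assumes j: "j \<le> m" and k: "k \<le> m"
  shows "(\<Sum>l = 0..2 * m. c j l * c k l) = (if j = k then (2 * real m + 1) / (if j = 0 then 1 else 2) else 0)"
    and "(\<Sum>l = 0..2 * m. s j l * s k l) = (if j = k \<and> j \<noteq> 0 then (2 * real m + 1) / 2 else 0)"
    and "(\<Sum>l = 0..2 * m. s j l * c k l) = 0"
proof -
  define C where "C = (\<lambda>r::real. \<Sum>l = 0..2 * m. cos (r * (mesh m * real l)))"
  define S where "S = (\<lambda>r::real. \<Sum>l = 0..2 * m. sin (r * (mesh m * real l)))"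
  have C_minus: "C (- r) = C r" and S_minus: "S (- r) = - S r" for r by (simp_all add: C_def S_def sum_negf)
  have CN: "C (real r) = (if r = 0 then 2 * real m + 1 else 0)" and SN: "S (real r) = 0" if "r \<le> 2 * m" for r
    using sum_cos_sin_mesh[of r m] that by (cases "r = 0"; simp add: C_def S_def)+
  have plus: "C (real j + real k) = (if j = 0 \<and> k = 0 then 2 * real m + 1 else 0)" "S (real j + real k) = 0"
    using CN[of "j + k"] SN[of "j + k"] j k by auto
  have "C (real j - real k) = (if j = k then 2 * real m + 1 else 0) \<and> S (real j - real k) = 0"
  proof (cases "k \<le> j")
    case True
    then have "real j - real k = real (j - k)" by (rule of_nat_diff[symmetric])
    then show ?thesis using CN[of "j - k"] SN[of "j - k"] True j by simp
  next
    case False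
    then have "real j - real k = - real (k - j)" using of_nat_diff[of j k, where ?'a = real] by simp
    then have "C (real j - real k) = C (real (k - j))" "S (real j - real k) = - S (real (k - j))"
      by (simp_all only: C_minus S_minus)
    then show ?thesis using CN[of "k - j"] SN[of "k - j"] False k by simp
  qed
  then have minus: "C (real j - real k) = (if j = k then 2 * real m + 1 else 0)" "S (real j - real k) = 0"
    by blast+
  have "(\<Sum>l = 0..2 * m. c j l * c k l) = (C (real j - real k) + C (real j + real k)) / 2"
    unfolding C_def c_def sum.distrib[symmetric] sum_divide_distrib
    by (intro sum.cong) (auto simp: left_diff_distrib distrib_right cos_diff cos_add)
  then show "(\<Sum>l = 0..2 * m. c j l * c k l) = (if j = k then (2 * real m + 1) / (if j = 0 then 1 else 2) else 0)"
    unfolding plus minus by (cases "j = k"; cases "k = 0"; simp)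
  have "(\<Sum>l = 0..2 * m. s j l * s k l) = (C (real j - real k) - C (real j + real k)) / 2"
    unfolding C_def s_def sum_subtractf[symmetric] sum_divide_distrib
    by (intro sum.cong) (auto simp: left_diff_distrib distrib_right cos_diff cos_add)
  then show "(\<Sum>l = 0..2 * m. s j l * s k l) = (if j = k \<and> j \<noteq> 0 then (2 * real m + 1) / 2 else 0)"
    unfolding plus minus by (cases "j = k"; cases "k = 0"; simp)
  have "(\<Sum>l = 0..2 * m. s j l * c k l) = (S (real j + real k) + S (real j - real k)) / 2"
    unfolding S_def s_def c_def sum.distrib[symmetric] sum_divide_distrib
    by (intro sum.cong) (auto simp: left_diff_distrib distrib_right sin_diff sin_add)
  then show "(\<Sum>l = 0..2 * m. s j l * c k l) = 0" by (simp add: plus minus)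
qed

lemma cos_poly_alt: "cos_poly n a t = (\<Sum>k\<le>n. (if k = 0 then 1 else 2) * a k * cos (real k * t))"
proof -
  have "{..n} = insert 0 {1..n}" by auto
  moreover have "(\<Sum>k = 1..n. 2 * a k * cos (real k * t)) = (\<Sum>k = 1..n. (if k = 0 then 1 else 2) * a k * cos (real k * t))"
    by (intro sum.cong) auto
  ultimately show ?thesis by (simp add: cos_poly_def sum_distrib_left mult.assoc)
qed

lemma kconv_cos_poly_alt:
  assumes "integrable torus g"
  shows "kconv (cos_poly n a) g x = (\<Sum>k\<le>n. (if k = 0 then 1 else 2) * a k *
    (cos (real k * x) * fourier_cos (real k) g + sin (real k * x) * fourier_sin (real k) g))"
  unfolding cos_poly_alt[abs_def] kconv_cos[OF assms, symmetric]
  by (subst kconv_sum) (auto intro!: bounded_kernel_intros assms simp: kconv_cmult)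

text \<open>With both degrees at most \<open>m\<close> there is no aliasing: averaging over the
  nodes keeps equal frequencies only, as integration does, so the multipliers \<open>w\<close> and
  \<open>b\<close> multiply.\<close>

theorem sampling_identity:
  assumes g: "integrable torus g"
  shows "1 / (2 * real m + 1) * (\<Sum>l = 0..2 * m. kconv (cos_poly m w) g (mesh m * real l) * cos_poly m b (x - mesh m * real l))
    = kconv (cos_poly m (\<lambda>k. b k * w k)) g x"
proof -
  \<comment> \<open>The weight of a frequency folded onto \<open>k \<ge> 0\<close>. Discrete
    orthogonality contributes \<open>1 / e k\<close>, which removes one of the two weights of the
    product.\<close>
  define e where "e = (\<lambda>k::nat. if k = 0 then 1 else 2 :: real)"
  define A where "A = (\<lambda>k::nat. fourier_cos (real k) g)"
  define B where "B = (\<lambda>k::nat. fourier_sin (real k) g)"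
  define c where "c = (\<lambda>j l. cos (real j * (mesh m * real l)))"
  define s where "s = (\<lambda>j l. sin (real j * (mesh m * real l)))"
  have avg: "(\<Sum>l = 0..2 * m. (c j l * A j + s j l * B j) * cos (real k * (x - mesh m * real l)))
      = (if j = k then (2 * real m + 1) / e k * (cos (real k * x) * A k + sin (real k * x) * B k) else 0)"
    if jk: "j \<le> m" "k \<le> m" for j k
  proof -
    have "(\<Sum>l = 0..2 * m. (c j l * A j + s j l * B j) * cos (real k * (x - mesh m * real l)))
      = (\<Sum>l = 0..2 * m. cos (real k * x) * A j * (c j l * c k l) + sin (real k * x) * A j * (s k l * c j l)
          + cos (real k * x) * B j * (s j l * c k l) + sin (real k * x) * B j * (s j l * s k l))"
      by (intro sum.cong) (auto simp: right_diff_distrib cos_diff c_def s_def algebra_simps)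
    also have "\<dots> = cos (real k * x) * A j * (\<Sum>l = 0..2 * m. c j l * c k l)
        + sin (real k * x) * A j * (\<Sum>l = 0..2 * m. s k l * c j l)
        + cos (real k * x) * B j * (\<Sum>l = 0..2 * m. s j l * c k l)
        + sin (real k * x) * B j * (\<Sum>l = 0..2 * m. s j l * s k l)"
      by (simp add: sum.distrib sum_distrib_left)
    also have "(\<Sum>l = 0..2 * m. c j l * c k l) = (if j = k then (2 * real m + 1) / (if j = 0 then 1 else 2) else 0)"
      unfolding c_def by (rule mesh_orthogonality(1)[OF jk])
    also have "(\<Sum>l = 0..2 * m. s k l * c j l) = 0"
      unfolding c_def s_def by (rule mesh_orthogonality(3)[OF jk(2,1)])
    also have "(\<Sum>l = 0..2 * m. s j l * c k l) = 0"
      unfolding c_def s_def by (rule mesh_orthogonality(3)[OF jk])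
    also have "(\<Sum>l = 0..2 * m. s j l * s k l) = (if j = k \<and> j \<noteq> 0 then (2 * real m + 1) / 2 else 0)"
      unfolding s_def by (rule mesh_orthogonality(2)[OF jk])
    also have "cos (real k * x) * A j * (if j = k then (2 * real m + 1) / (if j = 0 then 1 else 2) else 0)
        + sin (real k * x) * A j * 0 + cos (real k * x) * B j * 0
        + sin (real k * x) * B j * (if j = k \<and> j \<noteq> 0 then (2 * real m + 1) / 2 else 0)
      = (if j = k then (2 * real m + 1) / e k * (cos (real k * x) * A k + sin (real k * x) * B k) else 0)"
      by (auto simp: e_def field_simps)
    finally show ?thesis .
  qed
  have "(\<Sum>l = 0..2 * m. kconv (cos_poly m w) g (mesh m * real l) * cos_poly m b (x - mesh m * real l))
      = (\<Sum>l = 0..2 * m. \<Sum>j\<le>m. \<Sum>k\<le>m. e j * w j * (e k * b k) *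
          ((c j l * A j + s j l * B j) * cos (real k * (x - mesh m * real l))))"
    unfolding kconv_cos_poly_alt[OF g] cos_poly_alt sum_product
    by (intro sum.cong) (auto simp: e_def c_def s_def A_def B_def mult_ac)
  also have "\<dots> = (\<Sum>j\<le>m. \<Sum>k\<le>m. e j * w j * (e k * b k) *
      (\<Sum>l = 0..2 * m. (c j l * A j + s j l * B j) * cos (real k * (x - mesh m * real l))))"
    unfolding sum_distrib_left by (rule trans[OF sum.swap sum.cong[OF refl sum.swap]])
  also have "\<dots> = (\<Sum>j\<le>m. \<Sum>k\<le>m. if j = k then e j * w j * (e k * b k) *
      ((2 * real m + 1) / e k * (cos (real k * x) * A k + sin (real k * x) * B k)) else 0)"
    by (intro sum.cong) (auto simp: avg)
  also have "\<dots> = (\<Sum>j\<le>m. (2 * real m + 1) * (e j * (b j * w j) * (cos (real j * x) * A j + sin (real j * x) * B j)))"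
    by (intro sum.cong refl) (auto simp: e_def algebra_simps)
  also have "\<dots> = (2 * real m + 1) * kconv (cos_poly m (\<lambda>k. b k * w k)) g x"
    unfolding kconv_cos_poly_alt[OF g] sum_distrib_left by (simp add: e_def A_def B_def)
  finally show ?thesis by simp
qed

text \<open>Only the frequencies of \<open>b\<close> above \<open>m\<close> cause an error. Each
  node contributes at most a uniform bound for the sampled convolution times
  \<open>cos_tail m b\<close>, and the number of nodes cancels against the prefactor.\<close>

theorem sampling_error:
  assumes g: "integrable torus g" and b: "summable (\<lambda>k. \<bar>b k\<bar>)"
  shows "\<bar>1 / (2 * real m + 1) * (\<Sum>l = 0..2 * m. kconv (cos_poly m w) g (mesh m * real l) * cos_series b (x - mesh m * real l))
     - kconv (cos_poly m (\<lambda>k. b k * w k)) g x\<bar>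
    \<le> (\<bar>w 0\<bar> + 2 * (\<Sum>k = 1..m. \<bar>w k\<bar>)) * cos_tail m b * (LINT y|torus. \<bar>g y\<bar>)"
proof -
  let ?v = "\<lambda>l. kconv (cos_poly m w) g (mesh m * real l)"
  let ?W = "(\<bar>w 0\<bar> + 2 * (\<Sum>k = 1..m. \<bar>w k\<bar>)) * (LINT y|torus. \<bar>g y\<bar>)"
  have v: "\<bar>?v l\<bar> \<le> ?W" for l
    by (rule kconv_abs_le[OF cos_poly_abs_le g])
  have W0: "0 \<le> ?W" using v[of 0] by linarith
  define S where "S = (\<Sum>l = 0..2 * m. ?v l * (cos_series b (x - mesh m * real l) - cos_poly m b (x - mesh m * real l)))"
  have "1 / (2 * real m + 1) * (\<Sum>l = 0..2 * m. ?v l * cos_series b (x - mesh m * real l))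
     - kconv (cos_poly m (\<lambda>k. b k * w k)) g x = 1 / (2 * real m + 1) * S"
    unfolding sampling_identity[OF g, symmetric] right_diff_distrib[symmetric] sum_subtractf[symmetric] S_def by simp
  moreover have "\<bar>S\<bar> \<le> (2 * real m + 1) * (?W * cos_tail m b)"
  proof -
    have "\<bar>S\<bar> \<le> (\<Sum>l = 0..2 * m. ?W * cos_tail m b)"
      unfolding S_def
    proof (rule order_trans[OF sum_abs sum_mono])
      show "\<bar>?v l * (cos_series b (x - mesh m * real l) - cos_poly m b (x - mesh m * real l))\<bar> \<le> ?W * cos_tail m b" for l
        unfolding abs_mult by (intro mult_mono v cos_series_minus_cos_poly b W0) simp
    qed
    then show ?thesis by (simp add: add.commute)
  qed
  moreover have "\<bar>1 / (2 * real m + 1) * S\<bar> = \<bar>S\<bar> / (2 * real m + 1)" by (simp add: abs_mult)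
  ultimately show ?thesis by (simp add: pos_divide_le_eq mult_ac)
qed

subsection \<open>The coefficient sequences\<close>

lemma summable_linear_mult_geometric:
  fixes q c :: real
  assumes q: "0 \<le> q" "q < 1"
  shows "summable (\<lambda>k. (c + 2 * real k) * q ^ k)"
proof -
  have "summable (\<lambda>k. of_nat (Suc k) * q ^ k)"
    using geometric_deriv_sums[of q] q by (auto intro: sums_summable)
  then have "summable (\<lambda>k. 2 * (of_nat (Suc k) * q ^ k) + (c - 2) * q ^ k)"
    using q by (intro summable_add summable_mult summable_geometric) auto
  then show ?thesis by (simp add: algebra_simps)
qed

text \<open>Cut the indices from \<open>m\<close> on into blocks of length \<open>m\<close>: by
  monotonicity each block is at most \<open>m\<close> times its first term, a multiple of
  \<open>m\<close>.\<close>

lemma summable_subsequence_multiples: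
  fixes h :: "nat \<Rightarrow> real"
  assumes m: "1 \<le> m" and nonneg: "\<And>k. 1 \<le> k \<Longrightarrow> 0 \<le> h k"
    and dec: "\<And>j k. 1 \<le> j \<Longrightarrow> j \<le> k \<Longrightarrow> h k \<le> h j"
    and sum: "summable (\<lambda>k. h (m * Suc k))"
  shows "summable h"
proof -
  have "summable (\<lambda>k. h (k + m))"
  proof (rule summableI_nonneg_bounded)
    show "0 \<le> h (k + m)" for k using m by (intro nonneg) simp
    fix n
    have "(\<Sum>k<n. h (k + m)) \<le> (\<Sum>k<n * m. h (k + m))"
      using m nonneg by (intro sum_mono2) auto
    also have "\<dots> = (\<Sum>j<n. \<Sum>k\<in>{j * m..<j * m + m}. h (k + m))"
      by (rule sum.nat_group[symmetric])
    also have "\<dots> \<le> (\<Sum>j<n. \<Sum>k\<in>{j * m..<j * m + m}. h (m * Suc j))"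
      using m by (intro sum_mono dec) (auto simp: mult.commute)
    also have "\<dots> = real m * (\<Sum>j<n. h (m * Suc j))"
      by (simp add: sum_distrib_left)
    also have "\<dots> \<le> real m * (\<Sum>j. h (m * Suc j))"
      using m nonneg by (intro mult_left_mono sum_le_suminf[OF sum]) auto
    finally show "(\<Sum>k<n. h (k + m)) \<le> real m * (\<Sum>j. h (m * Suc j))" .
  qed
  then show ?thesis by (rule summable_iff_shift[THEN iffD1])
qed

text \<open>
  Here \<open>w\<^sub>k = \<beta>\<^sub>k / \<lambda>\<^sub>k\<close> and \<open>\<mu>\<^sub>k = 1 / \<lambda>\<^sub>k\<close>, so that \<open>\<mu>\<^sub>k / w\<^sub>k = 1 / \<beta>\<^sub>k\<close>. The doubly exponential growth of \<open>w\<close>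
  makes \<open>w\<^sub>j / w\<^sub>k\<close> for \<open>j < k\<close> at most \<open>exp (- \<rho> 2\<^sup>k\<^sup>-\<^sup>1)\<close>, which absorbs the crude factor \<open>2m + 1\<close>.
\<close>

lemma doubly_exponential_tail:
  fixes w \<mu> :: "nat \<Rightarrow> real"
  assumes w_pos: "\<And>k. 1 \<le> k \<Longrightarrow> 0 < w k"
    and ln_pos: "\<And>k. 1 \<le> k \<Longrightarrow> 0 < ln (w k) / 2 ^ k"
    and mono: "mono_on {1..} (\<lambda>k. ln (w k) / 2 ^ k)"
    and \<mu>_pos: "\<And>k. 1 \<le> k \<Longrightarrow> 0 < \<mu> k"
    and \<mu>_dec: "\<And>j k. 1 \<le> j \<Longrightarrow> j \<le> k \<Longrightarrow> \<mu> k \<le> \<mu> j"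
  shows "summable (\<lambda>k. \<bar>\<mu> k / w k\<bar>)"
    and "\<exists>C\<ge>0. \<forall>m\<ge>1. (\<bar>w 0\<bar> + 2 * (\<Sum>k = 1..m. \<bar>w k\<bar>)) * cos_tail m (\<lambda>k. \<mu> k / w k) \<le> C * \<mu> m"
proof -
  define \<rho> where "\<rho> = (\<lambda>k. ln (w k) / 2 ^ k)"
  define q where "q = exp (- \<rho> 1)"
  have \<rho>1: "0 < \<rho> 1" using ln_pos[of 1] by (simp add: \<rho>_def)
  have q: "0 < q" "q < 1" using \<rho>1 by (auto simp: q_def)
  have \<rho>_mono: "\<rho> j \<le> \<rho> k" if "1 \<le> j" "j \<le> k" for j k
    using mono that by (auto simp: mono_on_def \<rho>_def)
  have w: "w k = exp (2 ^ k * \<rho> k)" if "1 \<le> k" for k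
    using w_pos[OF that] by (simp add: \<rho>_def)
  have \<rho>_pos: "0 < \<rho> k" if "1 \<le> k" for k using ln_pos[OF that] by (simp add: \<rho>_def)
  \<comment> \<open>Since \<open>j < k\<close>, the exponent of the quotient is at most
    \<open>- (2 ^ (k - 1) * \<rho> k)\<close>. The geometric bound, from
    \<open>k \<le> 2 ^ (k - 1)\<close> and \<open>\<rho> 1 \<le> \<rho> k\<close>, is all that is
    required.\<close>
  have key: "w j * (1 / w k) \<le> q ^ k" if jk: "1 \<le> j" "j < k" for j k
  proof -
    obtain i where k: "k = Suc i" using jk by (cases k) auto
    have "2 ^ j * \<rho> j \<le> 2 ^ i * \<rho> k"
      using jk k \<rho>_mono[of j k] \<rho>_pos[of j] by (intro mult_mono power_increasing) auto
    then have "2 ^ j * \<rho> j - 2 ^ k * \<rho> k \<le> - (2 ^ i * \<rho> k)" by (simp add: k mult.commute)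
    also have "\<dots> \<le> - (real k * \<rho> 1)"
    proof -
      have "k \<le> 2 ^ i" unfolding k by (rule Suc_leI[OF less_exp])
      then have "real k \<le> 2 ^ i" using of_nat_le_iff[of k "2 ^ i", where ?'a = real] by simp
      then have "real k * \<rho> 1 \<le> 2 ^ i * \<rho> k"
        using \<rho>_mono[of 1 k] \<rho>1 jk by (intro mult_mono) auto
      then show ?thesis by simp
    qed
    finally have "exp (2 ^ j * \<rho> j - 2 ^ k * \<rho> k) \<le> exp (- (real k * \<rho> 1))" by simp
    moreover have "exp (- (real k * \<rho> 1)) = q ^ k"
      by (simp add: q_def exp_of_nat_mult[symmetric])
    ultimately show ?thesis using jk w[of j] w[of k] by (simp add: exp_diff)
  qed
  have w1: "1 \<le> w k" if "1 \<le> k" for k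
    using w[OF that] \<rho>_pos[OF that] by simp
  have w_mono: "w j \<le> w k" if "1 \<le> j" "j \<le> k" for j k
    using that w[of j] w[of k] \<rho>_mono[of j k] \<rho>_pos[of j]
    by (simp add: mult_mono power_increasing)
  \<comment> \<open>The linear factor is the crude count
    \<open>W m \<le> (\<bar>w 0\<bar> + 2 * real m) * w m\<close>, enlarged from \<open>m\<close> to
    \<open>k\<close>. As \<open>e\<close> does not involve \<open>m\<close>, its full sum bounds all
    tails and \<open>2 * suminf e\<close> is a constant for every \<open>m\<close>.\<close>
  define e where "e = (\<lambda>k. (\<bar>w 0\<bar> + 2 * real k) * q ^ k)"
  have e: "summable e" unfolding e_def using q by (intro summable_linear_mult_geometric) auto
  have e0: "0 \<le> e k" for k using q by (simp add: e_def)
  define W where "W = (\<lambda>m. \<bar>w 0\<bar> + 2 * (\<Sum>k = 1..m. \<bar>w k\<bar>))"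
  have W0: "0 \<le> W m" for m by (simp add: W_def sum_nonneg)
  have W: "W m * \<bar>\<mu> k / w k\<bar> \<le> \<mu> m * e k" if mk: "1 \<le> m" "m < k" for m k
  proof -
    have "(\<Sum>j = 1..m. \<bar>w j\<bar>) \<le> (\<Sum>j = 1..m. w m)"
      using w_mono[of _ m] w_pos by (intro sum_mono) (auto simp: abs_of_pos)
    then have "W m \<le> \<bar>w 0\<bar> * w m + 2 * (real m * w m)"
      using mult_left_mono[OF w1[OF mk(1)], of "\<bar>w 0\<bar>"] by (simp add: W_def)
    also have "\<dots> = (\<bar>w 0\<bar> + 2 * real m) * w m" by (simp add: algebra_simps)
    also have "\<dots> \<le> (\<bar>w 0\<bar> + 2 * real k) * w m"
      using mk w_pos[OF mk(1)] by (intro mult_right_mono) auto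
    finally have 1: "W m \<le> (\<bar>w 0\<bar> + 2 * real k) * w m" .
    have pk: "0 < \<mu> k" "0 < w k" using mk by (auto intro: \<mu>_pos w_pos)
    have "W m * \<bar>\<mu> k / w k\<bar> \<le> ((\<bar>w 0\<bar> + 2 * real k) * w m) * (\<mu> k / w k)"
      using 1 pk order_trans[OF W0 1] by (intro mult_mono) auto
    also have "\<dots> = \<mu> k * ((\<bar>w 0\<bar> + 2 * real k) * (w m * (1 / w k)))" by simp
    also have "\<dots> \<le> \<mu> m * ((\<bar>w 0\<bar> + 2 * real k) * q ^ k)"
      using \<mu>_dec[of m k] mk pk w_pos[OF mk(1)] \<mu>_pos[OF mk(1)] key[OF mk]
      by (intro mult_mono mult_left_mono mult_nonneg_nonneg) auto
    finally show ?thesis by (simp add: e_def)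
  qed
  have W1: "1 \<le> W 1" using w1[of 1] by (simp add: W_def)
  \<comment> \<open>The estimate with \<open>m = 1\<close> holds for indices above \<open>1\<close>,
    hence the shift by \<open>2\<close>.\<close>
  have "summable (\<lambda>k. \<bar>\<mu> (k + 2) / w (k + 2)\<bar>)"
  proof (rule summable_comparison_test')
    show "summable (\<lambda>k. \<mu> 1 * e (k + 2))"
      using e by (intro summable_mult) (rule summable_iff_shift[THEN iffD2])
    fix k
    have "1 * \<bar>\<mu> (k + 2) / w (k + 2)\<bar> \<le> W 1 * \<bar>\<mu> (k + 2) / w (k + 2)\<bar>"
      using W1 by (intro mult_right_mono) auto
    also have "\<dots> \<le> \<mu> 1 * e (k + 2)" by (rule W) auto
    finally show "norm \<bar>\<mu> (k + 2) / w (k + 2)\<bar> \<le> \<mu> 1 * e (k + 2)" by simp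
  qed
  then show b: "summable (\<lambda>k. \<bar>\<mu> k / w k\<bar>)" by (rule summable_iff_shift[THEN iffD1])
  have "W m * cos_tail m (\<lambda>k. \<mu> k / w k) \<le> 2 * suminf e * \<mu> m" if m: "1 \<le> m" for m
  proof -
    have sb: "summable (\<lambda>k. \<bar>\<mu> (Suc (k + m)) / w (Suc (k + m))\<bar>)"
      using summable_iff_shift[of "\<lambda>k. \<bar>\<mu> k / w k\<bar>" "Suc m"] b by simp
    have se: "summable (\<lambda>k. e (Suc (k + m)))"
      using summable_iff_shift[of e "Suc m"] e by simp
    have "W m * (\<Sum>k. \<bar>\<mu> (Suc (k + m)) / w (Suc (k + m))\<bar>) = (\<Sum>k. W m * \<bar>\<mu> (Suc (k + m)) / w (Suc (k + m))\<bar>)"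
      by (rule suminf_mult[OF sb, symmetric])
    also have "\<dots> \<le> (\<Sum>k. \<mu> m * e (Suc (k + m)))"
      using m by (intro suminf_le W summable_mult sb se) auto
    also have "\<dots> = \<mu> m * (\<Sum>k. e (Suc (k + m)))" by (rule suminf_mult[OF se])
    also have "\<dots> \<le> \<mu> m * suminf e"
    proof -
      have "suminf e = (\<Sum>k. e (k + Suc m)) + (\<Sum>k<Suc m. e k)"
        by (rule suminf_split_initial_segment[OF e])
      moreover have "0 \<le> (\<Sum>k<Suc m. e k)" using e0 by (intro sum_nonneg) auto
      ultimately have "(\<Sum>k. e (Suc (k + m))) \<le> suminf e" by simp
      then show ?thesis using \<mu>_pos[OF m] by (intro mult_left_mono) auto
    qed
    finally show ?thesis by (simp add: cos_tail_def mult_ac)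
  qed
  moreover have "0 \<le> 2 * suminf e" using e e0 by (simp add: suminf_nonneg)
  ultimately show "\<exists>C\<ge>0. \<forall>m\<ge>1. (\<bar>w 0\<bar> + 2 * (\<Sum>k = 1..m. \<bar>w k\<bar>)) * cos_tail m (\<lambda>k. \<mu> k / w k) \<le> C * \<mu> m"
    unfolding W_def by blast
qed

subsection \<open>The approximation theorem\<close>

lemma Phi_density_props:
  assumes "f \<in> Phi_space \<phi> p"
  shows "Phi_density \<phi> p f \<in> Lp_torus p" "AE x in lborel. f x = torus_conv \<phi> (Phi_density \<phi> p f) x"
proof -
  have "\<exists>g. g \<in> Lp_torus p \<and> (AE x in lborel. f x = torus_conv \<phi> g x)"
    using assms by (auto simp: Phi_space_def)
  from someI_ex[OF this] show "Phi_density \<phi> p f \<in> Lp_torus p"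
    "AE x in lborel. f x = torus_conv \<phi> (Phi_density \<phi> p f) x"
    unfolding Phi_density_def by auto
qed

lemma Lp_torusD:
  assumes "f \<in> Lp_torus p"
  shows "f (x + 2 * pi) = f x" "f \<in> borel_measurable borel" "Lp_fun p f"
  using assms Lp_torus_Lp_fun[OF assms] by (auto simp: Lp_torus_def)

lemma H_kernel_eq_cos_poly:
  assumes "\<And>k. \<beta> k = \<beta> (- k)" "\<And>k. lam k = lam (- k)"
  shows "H_kernel lam \<beta> m = cos_poly m (\<lambda>k. \<beta> (int k) / lam (int k))"
proof
  fix x
  have "\<beta> (- k) / lam (- k) = \<beta> k / lam k" for k using assms by metis
  from exponential_sum_eq_cos_poly[of "\<lambda>k. \<beta> k / lam k", OF this]
  show "H_kernel lam \<beta> m x = cos_poly m (\<lambda>k. \<beta> (int k) / lam (int k)) x"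
    unfolding H_kernel_def by (simp only: Re_complex_of_real)
qed

lemma kconv_AE_zero:
  assumes "AE y in torus. g y = 0" shows "kconv k g x = 0"
proof -
  have "AE y in torus. k (x - y) * g y = 0" using assms by eventually_elim simp
  then show ?thesis unfolding kconv_def by (rule integral_eq_zero_AE)
qed

text \<open>As \<open>\<mu>\<close> decreases, finiteness over the multiples of \<open>m\<close>
  spreads to the whole sequence; the lower bound is the summand \<open>k = 0\<close>.\<close>

lemma multiples_sum_cases:
  fixes \<mu> :: "nat \<Rightarrow> real"
  assumes m: "1 \<le> m" and pos: "\<And>k. 1 \<le> k \<Longrightarrow> 0 < \<mu> k"
    and dec: "\<And>j k. 1 \<le> j \<Longrightarrow> j \<le> k \<Longrightarrow> \<mu> k \<le> \<mu> j"
  obtains "(\<Sum>k. ennreal (\<mu> (m * Suc k))) = top"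
    | "summable \<mu>" "ennreal (\<mu> m) \<le> (\<Sum>k. ennreal (\<mu> (m * Suc k)))"
proof (cases "(\<Sum>k. ennreal (\<mu> (m * Suc k))) = top")
  case False
  have nonneg: "0 \<le> \<mu> (m * Suc k)" for k using pos[of "m * Suc k"] m by simp
  have "summable (\<lambda>k. \<mu> (m * Suc k))"
    using summable_suminf_not_top[OF nonneg False] .
  from summable_subsequence_multiples[OF m less_imp_le[OF pos] dec this] have "summable \<mu>" by simp
  moreover have "ennreal (\<mu> m) \<le> (\<Sum>k. ennreal (\<mu> (m * Suc k)))"
    using sum_le_suminf[of "\<lambda>k. ennreal (\<mu> (m * Suc k))" "{0}"] by simp
  ultimately show thesis by (rule that(2))
qed (rule that(1))

theorem theorem2p10:
  fixes p p' :: real and lam \<beta> :: "int \<Rightarrow> real" and \<phi>_lam \<phi>_\<beta> :: "real \<Rightarrow> real"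
  assumes "1 < p" and "1 / p + 1 / p' = 1"
    and "\<And>k. lam k \<noteq> 0" and "\<And>k. \<beta> k \<noteq> 0"
    and "is_phi lam \<phi>_lam" and "\<phi>_lam \<in> Lp_torus p'"
    and "is_phi \<beta> \<phi>_\<beta>" and "\<phi>_\<beta> \<in> Lp_torus p"
    and "\<And>k. \<beta> k = \<beta> (- k)" and "\<And>k. lam k = lam (- k)"
    and "\<And>k::nat. 1 \<le> k \<Longrightarrow> 0 < \<beta> (int k) / lam (int k)"
    and "\<And>k::nat. 1 \<le> k \<Longrightarrow> 0 < ln (\<beta> (int k) / lam (int k)) / 2 ^ k"
    and "mono_on {1..} (\<lambda>k::nat. ln (\<beta> (int k) / lam (int k)) / 2 ^ k)"
    and "\<And>k::nat. 1 \<le> k \<Longrightarrow> 0 < lam (int k)"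
    and "mono_on {1..} (\<lambda>k::nat. lam (int k))"
  shows "\<exists>c::real. 0 < c \<and>
    (\<forall>f \<in> Phi_space \<phi>_lam p. \<forall>m::nat. 1 \<le> m \<longrightarrow>
       ennreal (Lp_norm p (\<lambda>x. f x - Q_op lam \<beta> \<phi>_lam \<phi>_\<beta> p m f x))
         \<le> ennreal c * ennreal (Phi_norm \<phi>_lam p f) * (\<Sum>k. ennreal (1 / lam (int (m * Suc k))))) \<and>
    (\<forall>m::nat. 1 \<le> m \<longrightarrow>
       M_approx (2 * m + 1) (Phi_ball \<phi>_lam p) \<phi>_\<beta> p
         \<le> ennreal c * (\<Sum>k. ennreal (1 / lam (int (m * Suc k)))))"
proof -
  note p = assms(1) and lam_ne = assms(3) and \<beta>_ne = assms(4) and \<beta>_even = assms(9) and lam_even = assms(10)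
    and lam_pos = assms(14) and lam_mono = assms(15)
  have p0: "0 < p" using p by simp
  have "0 < 1 / p" "1 / p < 1" using p by auto
  then have "0 < 1 / p'" "1 / p' < 1" using assms(2) by linarith+
  then have p': "1 < p'" by (simp add: zero_less_divide_iff divide_less_eq_1)
  define \<mu> where "\<mu> = (\<lambda>k::nat. 1 / lam (int k))"
  define w where "w = (\<lambda>k::nat. \<beta> (int k) / lam (int k))"
  define b where "b = (\<lambda>k::nat. 1 / \<beta> (int k))"
  have b_eq: "b = (\<lambda>k. \<mu> k / w k)"
    using lam_ne by (auto simp: b_def \<mu>_def w_def)
  \<comment> \<open>The cancellation behind \<open>Q_op\<close>: sampling contributes
    \<open>\<beta> / \<lambda>\<close>, translates of \<open>\<phi>_\<beta>\<close> contribute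
    \<open>1 / \<beta>\<close>, and together they reproduce the multiplier of
    \<open>\<phi>_lam\<close>.\<close>
  have bw: "(\<lambda>k. b k * w k) = \<mu>"
    using \<beta>_ne by (auto simp: b_def \<mu>_def w_def)
  have \<mu>_pos: "0 < \<mu> k" if "1 \<le> k" for k using lam_pos[OF that] by (simp add: \<mu>_def)
  have \<mu>_dec: "\<mu> k \<le> \<mu> j" if "1 \<le> j" "j \<le> k" for j k
  proof -
    have "lam (int j) \<le> lam (int k)" using mono_onD[OF lam_mono, of j k] that by simp
    then show ?thesis using lam_pos[of j] that by (simp add: \<mu>_def frac_le)
  qed
  have w: "1 \<le> k \<Longrightarrow> 0 < w k" "1 \<le> k \<Longrightarrow> 0 < ln (w k) / 2 ^ k" "mono_on {1..} (\<lambda>k. ln (w k) / 2 ^ k)" for k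
    unfolding w_def by (fact assms(11) assms(12) assms(13))+
  note tail = doubly_exponential_tail[of w \<mu>, OF w \<mu>_pos \<mu>_dec, folded b_eq]
  have b_sum: "summable (\<lambda>k. \<bar>b k\<bar>)" using tail(1) by (simp add: b_eq)
  obtain C where C: "0 \<le> C"
      "\<And>m. 1 \<le> m \<Longrightarrow> (\<bar>w 0\<bar> + 2 * (\<Sum>k = 1..m. \<bar>w k\<bar>)) * cos_tail m b \<le> C * \<mu> m"
    using tail(2) by blast
  obtain A where A: "0 < A" and dir: "\<And>N g. Lp_fun p g \<Longrightarrow> Lp_norm p (kconv (dirichlet N) g) \<le> A * Lp_norm p g"
    using dirichlet_bound[OF p] by metis
  \<comment> \<open>\<open>2 * A\<close> pays for the tail by Abel summation and the Riesz bound,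
    \<open>C\<close> for the aliasing error.\<close>
  define c where "c = 2 * A + C"
  have c: "0 < c" using A C by (simp add: c_def)

  note \<phi>l = Lp_torusD[OF assms(6)] and \<phi>b = Lp_torusD[OF assms(8)]
  have \<phi>l_int: "integrable torus \<phi>_lam" by (rule Lp_fun_integrable[OF p' \<phi>l(3)])
  have \<phi>b_int: "integrable torus \<phi>_\<beta>" by (rule Lp_fun_integrable[OF p \<phi>b(3)])
  have \<phi>b_ae: "AE x in torus. \<phi>_\<beta> x = cos_series b x"
    unfolding b_def using assms(7) b_sum \<beta>_even \<phi>b_int
    by (intro fourier_series_eq_cos_series[of "\<lambda>k. 1 / \<beta> k"]) (auto simp: is_phi_def b_def)
  have cs_meas [measurable]: "cos_series b \<in> borel_measurable borel"
    by (rule bounded_kernel_measurable[OF bounded_kernel_cos_series[OF b_sum]])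
  note [measurable] = \<phi>b(2)
  have \<phi>b_shift: "AE x in torus. \<phi>_\<beta> (x - s) = cos_series b (x - s)" for s
    by (rule AE_torus_shift[OF _ _ \<phi>b_ae]) (auto simp: \<phi>b(1) cos_series_periodic)

  have main: "ennreal (Lp_norm p (\<lambda>x. f x - Q_op lam \<beta> \<phi>_lam \<phi>_\<beta> p m f x))
         \<le> ennreal c * ennreal (Phi_norm \<phi>_lam p f) * (\<Sum>k. ennreal (\<mu> (m * Suc k)))"
    if f: "f \<in> Phi_space \<phi>_lam p" and m: "1 \<le> m" for f m
  proof -
    define g where "g = Phi_density \<phi>_lam p f"
    have g: "g (x + 2 * pi) = g x" "g \<in> borel_measurable borel" "Lp_fun p g" for x
      using Lp_torusD[OF Phi_density_props(1)[OF f]] by (auto simp: g_def)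
    have f_meas [measurable]: "f \<in> borel_measurable borel"
      using f by (auto simp: Phi_space_def Lp_torus_def)
    have gi: "integrable torus g" by (rule Lp_fun_integrable[OF p g(3)])
    have norm_f: "Phi_norm \<phi>_lam p f = Lp_norm p g" by (simp add: Phi_norm_def g_def)
    have f_ae: "AE x in torus. f x = kconv \<phi>_lam g x"
      using AE_lborel_imp_AE_torus[OF Phi_density_props(2)[OF f]]
        torus_conv_eq_kconv[OF \<phi>l(2) g(2) \<phi>l(1) g(1)] by (simp add: g_def)
    have V: "V_op lam \<beta> m g t = kconv (cos_poly m w) g t" for t
      unfolding V_op_def H_kernel_eq_cos_poly[of \<beta> lam, OF \<beta>_even lam_even] w_def
      by (intro torus_conv_eq_kconv bounded_kernel_measurable[OF bounded_kernel_cos_poly] g cos_poly_periodic)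
    define Q where "Q = Q_op lam \<beta> \<phi>_lam \<phi>_\<beta> p m f"
    have Q: "Q x = 1 / (2 * real m + 1) *
        (\<Sum>l = 0..2 * m. kconv (cos_poly m w) g (mesh m * real l) * \<phi>_\<beta> (x - mesh m * real l))" for x
      by (simp add: Q_def Q_op_def V g_def[symmetric])
    have Q_meas [measurable]: "Q \<in> borel_measurable borel"
      unfolding Q[abs_def] by measurable
    show ?thesis
    proof (rule multiples_sum_cases[OF m \<mu>_pos \<mu>_dec])
      assume infinite: "(\<Sum>k. ennreal (\<mu> (m * Suc k))) = top"
      show ?thesis
      proof (cases "Lp_norm p g = 0")
        \<comment> \<open>In \<open>ennreal\<close> the product of \<open>0\<close> and
          \<open>top\<close> is \<open>0\<close>, so here the left side has to vanish
          exactly.\<close>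
        case True
        then have g0: "AE y in torus. g y = 0" using Lp_norm_eq_0_AE[OF p0 g(3)] by simp
        have "AE x in torus. f x - Q x = 0"
          using f_ae by eventually_elim (simp add: Q kconv_AE_zero[OF g0])
        then have "Lp_norm p (\<lambda>x. f x - Q x) = 0" by (intro Lp_norm_AE_zero p0) auto
        then show ?thesis by (simp add: Q_def)
      next
        case False
        then have "0 < c * Lp_norm p g" using c Lp_norm_nonneg[of p g] by (simp add: less_le)
        then have "ennreal c * ennreal (Lp_norm p g) \<noteq> 0"
          using c by (simp add: ennreal_mult[symmetric] ennreal_eq_0_iff)
        then show ?thesis unfolding infinite norm_f ennreal_mult_top by simp
      qed
    next
      assume \<mu>_sum: "summable \<mu>" and first: "ennreal (\<mu> m) \<le> (\<Sum>k. ennreal (\<mu> (m * Suc k)))"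
      \<comment> \<open>The sign of \<open>\<mu> 0\<close> is unknown, so absolute values are
        compared from index \<open>1\<close> on.\<close>
      have \<mu>_abs: "summable (\<lambda>k. \<bar>\<mu> k\<bar>)"
      proof -
        have "summable (\<lambda>k. \<bar>\<mu> (k + 1)\<bar>)"
          using summable_ignore_initial_segment[OF \<mu>_sum, of 1] \<mu>_pos by (simp add: abs_of_pos)
        then show ?thesis by (rule summable_iff_shift[THEN iffD1])
      qed
      have \<phi>l_ae: "AE x in torus. \<phi>_lam x = cos_series \<mu> x"
        unfolding \<mu>_def using assms(5) \<mu>_abs lam_even \<phi>l_int
        by (intro fourier_series_eq_cos_series[of "\<lambda>k. 1 / lam k"]) (auto simp: is_phi_def \<mu>_def)
      note cs\<mu> = bounded_kernel_cos_series[OF \<mu>_abs]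
      note [measurable] = bounded_kernel_measurable[OF cs\<mu>] \<phi>l(2) g(2)
      \<comment> \<open>Convolution ignores null sets of the kernel, so this holds at every
        \<open>x\<close>.\<close>
      have "kconv \<phi>_lam g x = kconv (cos_series \<mu>) g x" for x
      proof -
        have "AE y in torus. \<phi>_lam (x - y) = cos_series \<mu> (x - y)"
          by (rule AE_torus_reflect[OF _ _ \<phi>l_ae]) (auto simp: \<phi>l(1) cos_series_periodic)
        then have "AE y in torus. \<phi>_lam (x - y) * g y = cos_series \<mu> (x - y) * g y"
          by eventually_elim simp
        then show ?thesis unfolding kconv_def by (rule integral_cong_AE[rotated 2]) auto
      qed
      with f_ae have f_ae': "AE x in torus. f x = kconv (cos_series \<mu>) g x" by simp
      \<comment> \<open>\<open>T\<close> collects the frequencies above \<open>m\<close>,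
        \<open>R\<close> the aliasing error. Both are measured from the truncated convolution with
        \<open>cos_poly m \<mu>\<close>, which cancels in \<open>T - R\<close>.\<close>
      define T where "T = (\<lambda>x. kconv (cos_series \<mu>) g x - kconv (cos_poly m \<mu>) g x)"
      define R where "R = (\<lambda>x. 1 / (2 * real m + 1) *
        (\<Sum>l = 0..2 * m. kconv (cos_poly m w) g (mesh m * real l) * cos_series b (x - mesh m * real l))
          - kconv (cos_poly m \<mu>) g x)"
      have Q_ae: "AE x in torus. Q x = 1 / (2 * real m + 1) *
        (\<Sum>l = 0..2 * m. kconv (cos_poly m w) g (mesh m * real l) * cos_series b (x - mesh m * real l))"
      proof -
        have "AE x in torus. \<forall>l\<in>{0..2 * m}. \<phi>_\<beta> (x - mesh m * real l) = cos_series b (x - mesh m * real l)"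
          by (intro AE_finite_allI \<phi>b_shift) auto
        then show ?thesis by eventually_elim (simp add: Q)
      qed
      have fQ: "AE x in torus. f x - Q x = T x - R x"
        using f_ae' Q_ae by eventually_elim (simp add: T_def R_def)
      have LK: "Lp_fun p (kconv k g)" if "bounded_kernel k" for k
        using p by (intro Lp_fun_kconv that gi) auto
      have LT: "Lp_fun p T"
        unfolding T_def by (intro Lp_fun_diff p LK cs\<mu> bounded_kernel_cos_poly)
      have Rm: "R \<in> borel_measurable borel"
        using Lp_funD[OF LK[OF bounded_kernel_cos_poly[of m \<mu>]]] unfolding R_def by measurable
      let ?n = "LINT y|torus. \<bar>g y\<bar>"
      have R_le: "\<bar>R x\<bar> \<le> C * \<mu> m * Lp_norm p g" for x
      proof -
        have "\<bar>R x\<bar> \<le> (\<bar>w 0\<bar> + 2 * (\<Sum>k = 1..m. \<bar>w k\<bar>)) * cos_tail m b * ?n"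
          using sampling_error[OF gi b_sum, of m w x] unfolding bw R_def .
        also have "\<dots> \<le> C * \<mu> m * Lp_norm p g"
          using C(1) \<mu>_pos[OF m]
          by (intro mult_mono[OF C(2)[OF m] integral_abs_le_Lp_norm[OF p g(3)]]) auto
        finally show ?thesis .
      qed
      have LR: "Lp_fun p R" using p0 by (intro Lp_fun_bounded[OF _ Rm R_le]) simp
      have "Lp_norm p (\<lambda>x. f x - Q x) = Lp_norm p (\<lambda>x. T x - R x)"
        using fQ Lp_funD[OF LT] Rm by (intro Lp_norm_cong_AE) auto
      also have "\<dots> \<le> Lp_norm p T + Lp_norm p R"
        by (rule Lp_norm_diff_triangle[OF p LT LR])
      also have "\<dots> \<le> 2 * (A * Lp_norm p g) * \<mu> m + C * \<mu> m * Lp_norm p g"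
      proof (rule add_mono)
        have "Lp_norm p T \<le> 2 * (A * Lp_norm p g) * \<mu> (Suc m)"
          unfolding T_def using m
          by (intro cos_series_tail_bound[where \<mu> = \<mu>] p g(3) dir \<mu>_abs less_imp_le[OF \<mu>_pos] \<mu>_dec) auto
        also have "\<dots> \<le> 2 * (A * Lp_norm p g) * \<mu> m"
          using m A \<mu>_dec[of m "Suc m"] by (intro mult_left_mono) auto
        finally show "Lp_norm p T \<le> 2 * (A * Lp_norm p g) * \<mu> m" .
        show "Lp_norm p R \<le> C * \<mu> m * Lp_norm p g" by (rule Lp_norm_bounded[OF p0 Rm R_le])
      qed
      also have "\<dots> = c * Lp_norm p g * \<mu> m" by (simp add: c_def algebra_simps)
      finally have "ennreal (Lp_norm p (\<lambda>x. f x - Q x)) \<le> ennreal (c * Lp_norm p g * \<mu> m)"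
        by (rule ennreal_leI)
      also have "\<dots> = ennreal c * ennreal (Lp_norm p g) * ennreal (\<mu> m)"
        using c \<mu>_pos[OF m] by (simp add: ennreal_mult')
      also have "\<dots> \<le> ennreal c * ennreal (Lp_norm p g) * (\<Sum>k. ennreal (\<mu> (m * Suc k)))"
        by (intro mult_left_mono first) simp
      finally show ?thesis by (simp add: Q_def norm_f)
    qed
  qed

  have M: "M_approx (2 * m + 1) (Phi_ball \<phi>_lam p) \<phi>_\<beta> p \<le> ennreal c * (\<Sum>k. ennreal (\<mu> (m * Suc k)))"
    if m: "1 \<le> m" for m
    unfolding M_approx_def
  proof (rule SUP_least)
    fix f assume "f \<in> Phi_ball \<phi>_lam p"
    then have f: "f \<in> Phi_space \<phi>_lam p" "Phi_norm \<phi>_lam p f \<le> 1" by (auto simp: Phi_ball_def)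
    \<comment> \<open>The prefactor of \<open>Q_op\<close> is absorbed into the coefficients, and
      \<open>l - 1\<close> matches nodes numbered from \<open>0\<close> with translates numbered
      from \<open>1\<close>.\<close>
    define v where "v = (\<lambda>l. 1 / (2 * real m + 1) *
        V_op lam \<beta> m (Phi_density \<phi>_lam p f) (mesh m * real (l - 1)))"
    define y where "y = (\<lambda>l. mesh m * real (l - 1))"
    have y: "y \<in> {1..2 * m + 1} \<rightarrow> {0..2 * pi}"
    proof
      fix l assume l: "l \<in> {1..2 * m + 1}"
      have "mesh m * real (l - 1) \<le> mesh m * (2 * real m + 1)"
        using l by (intro mult_left_mono) (auto simp: mesh_def)
      also have "\<dots> = 2 * pi" by (simp add: mesh_def)
      finally show "y l \<in> {0..2 * pi}" by (simp add: y_def mesh_def)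
    qed
    have Q: "Q_op lam \<beta> \<phi>_lam \<phi>_\<beta> p m f x = (\<Sum>l = 1..2 * m + 1. v l * \<phi>_\<beta> (x - y l))" for x
    proof -
      have "Q_op lam \<beta> \<phi>_lam \<phi>_\<beta> p m f x = (\<Sum>l = 0..2 * m. v (Suc l) * \<phi>_\<beta> (x - y (Suc l)))"
        unfolding Q_op_def v_def y_def sum_distrib_left by (simp add: mult_ac)
      also have "\<dots> = (\<Sum>l = Suc 0..Suc (2 * m). v l * \<phi>_\<beta> (x - y l))"
        by (rule sum.shift_bounds_cl_Suc_ivl[symmetric])
      finally show ?thesis by simp
    qed
    have "(INF c\<in>UNIV. INF y\<in>{1..2 * m + 1} \<rightarrow> {0..2 * pi}.
        ennreal (Lp_norm p (\<lambda>x. f x - (\<Sum>l = 1..2 * m + 1. c l * \<phi>_\<beta> (x - y l)))))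
      \<le> ennreal (Lp_norm p (\<lambda>x. f x - (\<Sum>l = 1..2 * m + 1. v l * \<phi>_\<beta> (x - y l))))"
      by (rule INF_lower2[where i = v], rule UNIV_I, rule INF_lower2[where i = y], rule y, rule order_refl)
    also have "\<dots> = ennreal (Lp_norm p (\<lambda>x. f x - Q_op lam \<beta> \<phi>_lam \<phi>_\<beta> p m f x))"
      unfolding Q ..
    also have "\<dots> \<le> ennreal c * ennreal (Phi_norm \<phi>_lam p f) * (\<Sum>k. ennreal (\<mu> (m * Suc k)))"
      by (rule main[OF f(1) m])
    also have "\<dots> \<le> ennreal c * 1 * (\<Sum>k. ennreal (\<mu> (m * Suc k)))"
      using f(2) by (intro mult_right_mono mult_left_mono) auto
    finally show "(INF c\<in>UNIV. INF y\<in>{1..2 * m + 1} \<rightarrow> {0..2 * pi}.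
        ennreal (Lp_norm p (\<lambda>x. f x - (\<Sum>l = 1..2 * m + 1. c l * \<phi>_\<beta> (x - y l)))))
      \<le> ennreal c * (\<Sum>k. ennreal (\<mu> (m * Suc k)))"
      by simp
  qed
  show ?thesis
    using c main M unfolding \<mu>_def by (intro exI[of _ c]) blast
qed

end
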